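(* Fix $\Lambda,\Sigma>0$, $d\ge1$, $\nu\in\mathcal{M}(\mathbb{R}^d)$. Let $(\mu_t)_{t\in[0,1]}$ be an absolutely continuous curve in $(\mathcal{M}(\mathbb{R}^d),\mathsf{HK}_{\Lambda,\Sigma})$ with metric derivative in $L^2((0,1))$, let $(v,w)$ be a Borel vector field as in the context, and let $\mathcal{N}\subset(0,1)$ be the set defined in the context (whose complement in $(0,1)$ is $\mathscr{L}^1$-negligible). Let $t\in\mathcal{N}$, and let $\alpha_t,\alpha_\star\in\mathcal{M}_2(\mathfrak{C})$ with $\mathfrak{h}\alpha_t\le\mu_t$, $\mathfrak{h}\alpha_\star\le\nu$, and $\beta_{t,\star}$ a finite nonnegative measure on $\mathfrak{C}\times\mathfrak{C}$ with marginals $\alpha_t,\alpha_\star$, such that $\beta_{t,\star}$ is optimal in $$\mathsf{HK}_{\Lambda,\Sigma}(\mu_t,\nu)^2=\min\Big\{\mathcal{W}_{\mathfrak{C}}(\alpha_1,\alpha_2)^2+\frac4\Sigma\big((\mu_t-\mathfrak{h}\alpha_1)(\mathbb{R}^d)+(\nu-\mathfrak{h}\alpha_2)(\mathbb{R}^d)\big):\ \alpha_i\in\mathcal{M}_2(\mathfrak{C}),\ \mathfrak{h}\alpha_1\le\mu_t,\ \mathfrak{h}\alpha_2\le\nu\Big\},$$ i.e. $(\alpha_t,\alpha_\star)$ attains this minimum and $\beta_{t,\star}$ is an optimal coupling for $\mathcal{W}_{\mathfrak{C}}(\alpha_t,\alpha_\star)$. Then $$\frac{\mathrm{d}}{\mathrm{d}t}\Big[\tfrac12\mathsf{HK}_{\Lambda,\Sigma}(\mu_t,\nu)^2\Big]=\mathcal{F}_{t,\star}+2\int_{\mathbb{R}^d}w_t(x)\,\mathrm{d}(\mu_t-\mathfrak{h}\alpha_t)(x),$$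 where $$\mathcal{F}_{t,\star}:=2\int_{\mathfrak{C}\times\mathfrak{C}}\Big[r_1^2w_t(x_1)-r_1r_2w_t(x_1)\cos\big(\sqrt{\Sigma/(4\Lambda)}|x_1-x_2|\big)-r_1r_2\sqrt{\Lambda/\Sigma}\,\langle S_{\Lambda,\Sigma}(x_1,x_2),v_t(x_1)\rangle\Big]\,\mathrm{d}\beta_{t,\star}([x_1,r_1],[x_2,r_2]),$$ with $S_{\Lambda,\Sigma}(x_1,x_2):=\frac{\sin(\sqrt{\Sigma/(4\Lambda)}|x_1-x_2|)}{|x_1-x_2|}(x_2-x_1)$ if $x_1\neq x_2$ and $S_{\Lambda,\Sigma}(x_1,x_1):=0$.
   Context: $\mathcal{M}(\mathbb{R}^d)$: finite nonnegative Radon measures on $\mathbb{R}^d$. Cone $\mathfrak{C}:=\mathbb{R}^d\times[0,\infty)/\sim$ with $(x_1,r_1)\sim(x_2,r_2)$ iff $r_1=r_2=0$ or $(x_1,r_1)=(x_2,r_2)$; $[x,r]$ is the class, $\mathfrak{o}$ the vertex; points of $\mathfrak{C}$ are written $[x,r]$ (the vertex as $[\bar x,0]$ for a fixed $\bar x\in\mathbb{R}^d$). ${\sf d}_{\mathfrak{C}}([x_1,r_1],[x_2,r_2])^2:=\frac4\Sigma\big(r_1^2+r_2^2-2r_1r_2\cos(\min\{\sqrt{\Sigma/(4\Lambda)}|x_1-x_2|,\pi\})\big)$. $\mathcal{M}_2(\mathfrak{C})$: finite nonnegative Radon measures on $\mathfrak{C}$ with finite second moment. $\mathcal{W}_{\mathfrak{C}}(\alpha_1,\alpha_2)^2$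 is $+\infty$ if total masses differ, otherwise $\min\int{\sf d}_{\mathfrak{C}}^2\,\mathrm{d}\beta$ over couplings $\beta$. $({\sf x},{\sf r})([x,r]):=(x,r)$ for $r>0$, $({\sf x},{\sf r})(\mathfrak{o}):=(\bar x,0)$; $\mathfrak{h}\alpha:={\sf x}_\#({\sf r}^2\alpha)$. $\mathsf{HK}_{\Lambda,\Sigma}(\mu_1,\mu_2)^2:=\min\{\mathcal{W}_{\mathfrak{C}}(\alpha_1,\alpha_2)^2:\mathfrak{h}\alpha_i=\mu_i\}$; it is known that this also equals the minimum formula displayed in the claim (with $\mu_t,\nu$ replaced by $\mu_1,\mu_2$), and minimizers exist. Metric derivative $|\mu_t'|:=\lim_{h\to0}\mathsf{HK}_{\Lambda,\Sigma}(\mu_{t+h},\mu_t)/|h|$; absolute continuity: $\mathsf{HK}_{\Lambda,\Sigma}(\mu_s,\mu_t)\le\int_s^t|\mu_r'|\mathrm{d}r$. $(v,w):(0,1)\times\mathbb{R}^d\to\mathbb{R}^d\times\mathbb{R}$ is Borel with $\int_0^1\!\int(\partial_t\psi+\Lambda\langle\nabla\psi,v\rangle+\Sigma\psi w)\,\mathrm{d}\mu_t\,\mathrm{d}t=0$ for all $\psi\in C_c^\infty((0,1)\times\mathbb{R}^d)$ and $\int(\Lambda|v_t|^2+\Sigma|w_t|^2)\,\mathrm{d}\mu_t=|\mu_t'|^2$ for a.e. $t$, where $v_t=v(t,\cdot)$, $w_t=w(t,\cdot)$ (such a field exists). $\mathcal{D}(\mathbb{R}^d)$ is a fixed countable subset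 of $C_c^\infty(\mathbb{R}^d)$ such that every function in $C_c^\infty(\mathbb{R}^d)$ is a $C^1$-norm limit of elements of $\mathcal{D}(\mathbb{R}^d)$. $\mathcal{N}$ is the set of $t\in(0,1)$ such that: (a) the limit defining $|\mu_t'|$ exists; (b) $(v_t,w_t)$ lies in the closure in $L^2(\mu_t;\mathbb{R}^d\times\mathbb{R})$ (norm $(\int(\Lambda|\bar v|^2+\Sigma|\bar w|^2)\mathrm{d}\mu_t)^{1/2}$) of $\{(\nabla\zeta,\zeta):\zeta\in C_c^\infty(\mathbb{R}^d)\}$ and $\int(\Lambda|v_t|^2+\Sigma|w_t|^2)\mathrm{d}\mu_t=|\mu_t'|^2$; (c) $\tau\mapsto\frac12\mathsf{HK}_{\Lambda,\Sigma}(\mu_\tau,\nu)^2$ is differentiable at $t$; (d) for all $\psi\in\mathcal{D}(\mathbb{R}^d)$, $\lim_{h\to0}\frac1h(\int\psi\,\mathrm{d}\mu_{t+h}-\int\psi\,\mathrm{d}\mu_t)=\int(\Lambda\langle\nabla\psi,v_t\rangle+\Sigma\psi w_t)\,\mathrm{d}\mu_t$. *)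

theory Defs
  imports "HOL-Analysis.Analysis"
begin

coinductive C_inf :: "('a::euclidean_space \<Rightarrow> real) \<Rightarrow> bool" where
  "(\<forall>x. f differentiable (at x)) \<Longrightarrow>
   (\<forall>e\<in>Basis. C_inf (\<lambda>x. frechet_derivative f (at x) e)) \<Longrightarrow> C_inf f"

definition tsupp :: "('a::real_normed_vector \<Rightarrow> real) \<Rightarrow> 'a set" where
  "tsupp f = closure {x. f x \<noteq> 0}"

definition Cc_inf :: "('a::euclidean_space \<Rightarrow> real) set" where
  "Cc_inf = {f. C_inf f \<and> compact (tsupp f)}"

definition Cc_inf_time :: "(real \<times> 'a::euclidean_space \<Rightarrow> real) set" where
  "Cc_inf_time = {f. C_inf f \<and> compact (tsupp f) \<and> tsupp f \<subseteq> {0<..<1} \<times> UNIV}"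

definition grad :: "('a::euclidean_space \<Rightarrow> real) \<Rightarrow> 'a \<Rightarrow> 'a" where
  "grad f x = (\<Sum>e\<in>Basis. frechet_derivative f (at x) e *\<^sub>R e)"

definition grad_x :: "(real \<times> 'a::euclidean_space \<Rightarrow> real) \<Rightarrow> real \<Rightarrow> 'a \<Rightarrow> 'a" where
  "grad_x f t x = grad (\<lambda>y. f (t, y)) x"

definition dt :: "(real \<times> 'a::euclidean_space \<Rightarrow> real) \<Rightarrow> real \<Rightarrow> 'a \<Rightarrow> real" where
  "dt f t x = frechet_derivative f (at (t, x)) (1, 0)"

text \<open>finite nonnegative (Borel, hence Radon) measures on a Euclidean / Polish space\<close>
definition fin_meas :: "'a::topological_space measure \<Rightarrow> bool" where
  "fin_meas M \<longleftrightarrow> sets M = sets borel \<and> finite_measure M"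

definition meas_le :: "'a measure \<Rightarrow> 'a measure \<Rightarrow> bool" where
  "meas_le M N \<longleftrightarrow> (\<forall>A\<in>sets M. emeasure M A \<le> emeasure N A)"

text \<open>A point of the cone $\mathfrak{C}$ is represented by its canonical
representative $({\sf x},{\sf r})([x,r]) \in \mathbb{R}^d\times[0,\infty)$, i.e.
$(x,r)$ with $r>0$, and $(0,0)$ for the vertex (we take $\bar x = 0$).  The map is
a bijection of $\mathfrak{C}$ onto the set below, and a Borel isomorphism between
the Borel sets of $\mathfrak{C}$ and the Borel subsets of that set.\<close>
definition cone_set :: "('a::euclidean_space \<times> real) set" where
  "cone_set = {(x, r). r > 0} \<union> {(0, 0)}"

definition dC :: "real \<Rightarrow> real \<Rightarrow> ('a::euclidean_space \<times> real) \<Rightarrow> ('a \<times> real) \<Rightarrow> real" where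
  "dC \<Lambda> \<Sigma> p q = sqrt (4 / \<Sigma> * ((snd p)\<^sup>2 + (snd q)\<^sup>2
      - 2 * snd p * snd q * cos (min (sqrt (\<Sigma> / (4 * \<Lambda>)) * norm (fst p - fst q)) pi)))"

text \<open>$\mathcal{M}_2(\mathfrak{C})$: finite Borel measures on the cone with finite
second moment (moment = $\int {\sf d}_{\mathfrak C}([x,r],\mathfrak o)^2 = \frac4\Sigma\int r^2$).\<close>
definition M2C :: "('a::euclidean_space \<times> real) measure \<Rightarrow> bool" where
  "M2C \<alpha> \<longleftrightarrow> fin_meas \<alpha> \<and> emeasure \<alpha> (UNIV - cone_set) = 0
      \<and> integrable \<alpha> (\<lambda>p. (snd p)\<^sup>2)"

definition hmap :: "('a::euclidean_space \<times> real) measure \<Rightarrow> 'a measure" where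
  "hmap \<alpha> = distr (density \<alpha> (\<lambda>p. ennreal ((snd p)\<^sup>2))) borel fst"

definition coupling ::
  "(('a::euclidean_space \<times> real) \<times> ('a \<times> real)) measure \<Rightarrow> ('a \<times> real) measure \<Rightarrow> ('a \<times> real) measure \<Rightarrow> bool" where
  "coupling \<beta> \<alpha>1 \<alpha>2 \<longleftrightarrow> fin_meas \<beta> \<and> distr \<beta> borel fst = \<alpha>1 \<and> distr \<beta> borel snd = \<alpha>2"

definition cost :: "real \<Rightarrow> real \<Rightarrow> (('a::euclidean_space \<times> real) \<times> ('a \<times> real)) measure \<Rightarrow> ennreal" where
  "cost \<Lambda> \<Sigma> \<beta> = (\<integral>\<^sup>+ pq. ennreal ((dC \<Lambda> \<Sigma> (fst pq) (snd pq))\<^sup>2) \<partial>\<beta>)"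

text \<open>$\mathcal{W}_{\mathfrak C}^2$; it is $+\infty$ iff there is no coupling (different masses).\<close>
definition WC2 :: "real \<Rightarrow> real \<Rightarrow> ('a::euclidean_space \<times> real) measure \<Rightarrow> ('a \<times> real) measure \<Rightarrow> ennreal" where
  "WC2 \<Lambda> \<Sigma> \<alpha>1 \<alpha>2 = (INF \<beta>\<in>{\<beta>. coupling \<beta> \<alpha>1 \<alpha>2}. cost \<Lambda> \<Sigma> \<beta>)"

definition HK2 :: "real \<Rightarrow> real \<Rightarrow> 'a::euclidean_space measure \<Rightarrow> 'a measure \<Rightarrow> ennreal" where
  "HK2 \<Lambda> \<Sigma> \<mu>1 \<mu>2 = (INF a\<in>{(\<alpha>1, \<alpha>2). M2C \<alpha>1 \<and> M2C \<alpha>2 \<and> hmap \<alpha>1 = \<mu>1 \<and> hmap \<alpha>2 = \<mu>2}.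
        WC2 \<Lambda> \<Sigma> (fst a) (snd a))"

definition HK :: "real \<Rightarrow> real \<Rightarrow> 'a::euclidean_space measure \<Rightarrow> 'a measure \<Rightarrow> real" where
  "HK \<Lambda> \<Sigma> \<mu>1 \<mu>2 = sqrt (enn2real (HK2 \<Lambda> \<Sigma> \<mu>1 \<mu>2))"

definition HK_obj :: "real \<Rightarrow> real \<Rightarrow> 'a::euclidean_space measure \<Rightarrow> 'a measure
      \<Rightarrow> ('a \<times> real) measure \<Rightarrow> ('a \<times> real) measure \<Rightarrow> ennreal" where
  "HK_obj \<Lambda> \<Sigma> \<mu>1 \<mu>2 \<alpha>1 \<alpha>2 = WC2 \<Lambda> \<Sigma> \<alpha>1 \<alpha>2 + ennreal (4 / \<Sigma> *
      ((measure \<mu>1 UNIV - measure (hmap \<alpha>1) UNIV) + (measure \<mu>2 UNIV - measure (hmap \<alpha>2) UNIV)))"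

definition HK_admissible :: "'a::euclidean_space measure \<Rightarrow> 'a measure
      \<Rightarrow> ('a \<times> real) measure \<Rightarrow> ('a \<times> real) measure \<Rightarrow> bool" where
  "HK_admissible \<mu>1 \<mu>2 \<alpha>1 \<alpha>2 \<longleftrightarrow>
     M2C \<alpha>1 \<and> M2C \<alpha>2 \<and> meas_le (hmap \<alpha>1) \<mu>1 \<and> meas_le (hmap \<alpha>2) \<mu>2"

text \<open>metric derivative $|\mu_t'|$ (meaningful where the limit exists)\<close>
definition metric_deriv :: "real \<Rightarrow> real \<Rightarrow> (real \<Rightarrow> 'a::euclidean_space measure) \<Rightarrow> real \<Rightarrow> real" where
  "metric_deriv \<Lambda> \<Sigma> \<mu> t = Lim (at 0) (\<lambda>h. HK \<Lambda> \<Sigma> (\<mu> (t + h)) (\<mu> t) / \<bar>h\<bar>)"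

definition metric_deriv_exists :: "real \<Rightarrow> real \<Rightarrow> (real \<Rightarrow> 'a::euclidean_space measure) \<Rightarrow> real \<Rightarrow> bool" where
  "metric_deriv_exists \<Lambda> \<Sigma> \<mu> t \<longleftrightarrow> (\<exists>L. ((\<lambda>h. HK \<Lambda> \<Sigma> (\<mu> (t + h)) (\<mu> t) / \<bar>h\<bar>) \<longlongrightarrow> L) (at 0))"

definition AC2_curve :: "real \<Rightarrow> real \<Rightarrow> (real \<Rightarrow> 'a::euclidean_space measure) \<Rightarrow> bool" where
  "AC2_curve \<Lambda> \<Sigma> \<mu> \<longleftrightarrow>
     (\<forall>t\<in>{0..1}. fin_meas (\<mu> t)) \<and>
     (AE t in lborel. t \<in> {0<..<1} \<longrightarrow> metric_deriv_exists \<Lambda> \<Sigma> \<mu> t) \<and>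
     set_integrable lborel {0<..<1} (metric_deriv \<Lambda> \<Sigma> \<mu>) \<and>
     set_integrable lborel {0<..<1} (\<lambda>t. (metric_deriv \<Lambda> \<Sigma> \<mu> t)\<^sup>2) \<and>
     (\<forall>s t. 0 \<le> s \<longrightarrow> s \<le> t \<longrightarrow> t \<le> 1 \<longrightarrow>
        HK \<Lambda> \<Sigma> (\<mu> s) (\<mu> t) \<le> (LINT r:{s..t}|lborel. metric_deriv \<Lambda> \<Sigma> \<mu> r))"

definition L2norm2 :: "real \<Rightarrow> real \<Rightarrow> 'a::euclidean_space measure \<Rightarrow> ('a \<Rightarrow> 'a) \<Rightarrow> ('a \<Rightarrow> real) \<Rightarrow> ennreal" where
  "L2norm2 \<Lambda> \<Sigma> M vv ww = (\<integral>\<^sup>+ x. ennreal (\<Lambda> * (norm (vv x))\<^sup>2 + \<Sigma> * (ww x)\<^sup>2) \<partial>M)"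

definition tangent_field :: "real \<Rightarrow> real \<Rightarrow> (real \<Rightarrow> 'a::euclidean_space measure)
      \<Rightarrow> (real \<Rightarrow> 'a \<Rightarrow> 'a) \<Rightarrow> (real \<Rightarrow> 'a \<Rightarrow> real) \<Rightarrow> bool" where
  "tangent_field \<Lambda> \<Sigma> \<mu> v w \<longleftrightarrow>
     (\<lambda>p. v (fst p) (snd p)) \<in> borel_measurable borel \<and>
     (\<lambda>p. w (fst p) (snd p)) \<in> borel_measurable borel \<and>
     (\<forall>\<psi>\<in>Cc_inf_time.
        (LINT t:{0<..<1}|lborel. (LINT x|\<mu> t.
           dt \<psi> t x + \<Lambda> * inner (grad_x \<psi> t x) (v t x) + \<Sigma> * \<psi> (t, x) * w t x)) = 0) \<and>
     (AE t in lborel. t \<in> {0<..<1} \<longrightarrow>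
        L2norm2 \<Lambda> \<Sigma> (\<mu> t) (v t) (w t) = ennreal ((metric_deriv \<Lambda> \<Sigma> \<mu> t)\<^sup>2))"

definition C1_dense_countable :: "('a::euclidean_space \<Rightarrow> real) set \<Rightarrow> bool" where
  "C1_dense_countable D \<longleftrightarrow> countable D \<and> D \<subseteq> Cc_inf \<and>
     (\<forall>\<zeta>\<in>Cc_inf. \<forall>\<epsilon>>0. \<exists>\<psi>\<in>D. \<forall>x. \<bar>\<zeta> x - \<psi> x\<bar> \<le> \<epsilon> \<and> norm (grad \<zeta> x - grad \<psi> x) \<le> \<epsilon>)"

definition good_times :: "real \<Rightarrow> real \<Rightarrow> (real \<Rightarrow> 'a::euclidean_space measure)
      \<Rightarrow> (real \<Rightarrow> 'a \<Rightarrow> 'a) \<Rightarrow> (real \<Rightarrow> 'a \<Rightarrow> real) \<Rightarrow> 'a measure \<Rightarrow> ('a \<Rightarrow> real) set \<Rightarrow> real set" where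
  "good_times \<Lambda> \<Sigma> \<mu> v w \<nu> D = {t \<in> {0<..<1}.
     metric_deriv_exists \<Lambda> \<Sigma> \<mu> t \<and>
     (\<forall>\<epsilon>>0. \<exists>\<zeta>\<in>Cc_inf. L2norm2 \<Lambda> \<Sigma> (\<mu> t) (\<lambda>x. v t x - grad \<zeta> x) (\<lambda>x. w t x - \<zeta> x) < ennreal \<epsilon>) \<and>
     L2norm2 \<Lambda> \<Sigma> (\<mu> t) (v t) (w t) = ennreal ((metric_deriv \<Lambda> \<Sigma> \<mu> t)\<^sup>2) \<and>
     (\<lambda>\<tau>. (HK \<Lambda> \<Sigma> (\<mu> \<tau>) \<nu>)\<^sup>2 / 2) differentiable (at t) \<and>
     (\<forall>\<psi>\<in>D. ((\<lambda>h. ((LINT x|\<mu> (t + h). \<psi> x) - (LINT x|\<mu> t. \<psi> x)) / h) \<longlongrightarrow>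
         (LINT x|\<mu> t. \<Lambda> * inner (grad \<psi> x) (v t x) + \<Sigma> * \<psi> x * w t x)) (at 0))}"

definition S_fun :: "real \<Rightarrow> real \<Rightarrow> 'a::euclidean_space \<Rightarrow> 'a \<Rightarrow> 'a" where
  "S_fun \<Lambda> \<Sigma> x1 x2 = (if x1 \<noteq> x2
     then (sin (sqrt (\<Sigma> / (4 * \<Lambda>)) * norm (x1 - x2)) / norm (x1 - x2)) *\<^sub>R (x2 - x1) else 0)"

definition F_term :: "real \<Rightarrow> real \<Rightarrow> ('a::euclidean_space \<Rightarrow> 'a) \<Rightarrow> ('a \<Rightarrow> real)
      \<Rightarrow> (('a \<times> real) \<times> ('a \<times> real)) measure \<Rightarrow> real" where
  "F_term \<Lambda> \<Sigma> vt wt \<beta> = 2 * (LINT pq|\<beta>.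
     (let x1 = fst (fst pq); r1 = snd (fst pq); x2 = fst (snd pq); r2 = snd (snd pq) in
       r1\<^sup>2 * wt x1 - r1 * r2 * wt x1 * cos (sqrt (\<Sigma> / (4 * \<Lambda>)) * norm (x1 - x2))
       - r1 * r2 * sqrt (\<Lambda> / \<Sigma>) * inner (S_fun \<Lambda> \<Sigma> x1 x2) (vt x1)))"

end

theory Submission
  imports Defs
begin

text \<open>
  Since $\tau \mapsto \frac12 HK(\mu_\tau,\nu)^2$ is differentiable at $t$, it is enough to bound
  $HK(\mu_{t+h},\nu)^2$ from above to first order in $h$, for both signs of $h$.  Approximate $(v_t,w_t)$ in
  $L^2(\mu_t)$ within $\epsilon$ by $(\nabla\psi,\psi)$ with a test function $\psi$, and move $\mu_t$ to $\tilde\mu_h$ by the cone map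
  $[x,r] \mapsto [x + h\Lambda\nabla\psi(x), r(1 + \frac{h\Sigma}2 \psi(x))]$.

  Moving the first points of almost optimal plans between $\mu_t$ and $\mu_{t+h}$, and using the
  continuity equation for $\psi$ together with $|\mu_t'| = |(v_t,w_t)|_{L^2}$, gives
  $HK(\mu_{t+h},\tilde\mu_h) \le \epsilon|h|$ for small $h$.  Moving the first points of an optimal plan between $\mu_t$ and $\nu$, and using
  that $s \mapsto \cos(\min(\sqrt s,\pi))$ is convex, gives
  $HK(\tilde\mu_h,\nu)^2 \le HK(\mu_t,\nu)^2 + hV_\psi + O(h^2)$, where $V_\psi$ is twice the claimed expression with
  $(\nabla\psi,\psi)$ in place of $(v_t,w_t)$.  The two estimates combine by the triangle inequality for $HK$, and
  $\epsilon \to 0$.  The plan consists of $\beta$ and of the residual masses sent to the vertex; by optimality it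
  charges no pair at angle larger than $\pi/2$, so the truncated cosine can be replaced by the cosine.
\<close>

text \<open>The two estimates need different accuracy. Towards \<open>\<nu>\<close>, a first-order
  expansion with an O(h^2) remainder is enough. Along the curve the squared distance is itself of
  order h^2, so an uncontrolled O(h^2) error would ruin the bound: the h^2 coefficient must come out
  exactly, with a remainder K |h| (d^2 + h^2 r1^2). That remainder is o(h^2) because near-optimal
  costs are O(h^2). It is available because, for close pairs, the first variation of d^2 is up to
  O(d^2) minus twice the increment of r^2 \<psi>(x), the quantity whose rate of change the
  continuity equation gives. Plans are handled through homogeneous marginals: any measure space
  carrying two base points and two nonnegative radii with the right marginals yields a competitor.
  Moving points, cutting a plan and gluing two plans thus give competitors directly. The triangle
  inequality is kept in the weighted form (1 + \<delta>) a^2 + (1 + 1/\<delta>) b^2. A weight of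
  size |h| \<epsilon> on the main term keeps all losses at order |h| \<epsilon>.\<close>

definition ccos :: "real \<Rightarrow> real" where
  "ccos a = cos (min a pi)"

text \<open>Minus twice the derivative of \<open>ccos a\<close> in the variable a^2: sin a / a up to
  pi, its limit 1 at 0, and 0 beyond pi, where \<open>ccos\<close> is constant.\<close>

definition csinc :: "real \<Rightarrow> real" where
  "csinc a = (if a = 0 then 1 else if a \<le> pi then sin a / a else 0)"

text \<open>Concavity of sin on [0, pi] together with sin 0 = 0 makes sin x / x decreasing;
  multiplied out, the inequality covers zero arguments as well.\<close>

lemma sin_ratio_antimono:
  fixes a b :: real
  assumes "0 \<le> b" "b \<le> a" "a \<le> pi"
  shows "b * sin a \<le> a * sin b"
proof (cases "a = 0")
  case False
  have "concave_on {0..pi} sin"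
    by (rule f''_le0_imp_concave[where f' = cos and f'' = "\<lambda>x. - sin x"])
       (auto intro!: derivative_eq_intros sin_ge_zero)
  then have "convex_on {0..pi} (\<lambda>x. - sin x)"
    by (simp add: concave_on_def)
  from convex_onD[OF this, of "b / a" 0 a] have "b / a * sin a \<le> sin b"
    using False assms by simp
  then have "a * (b / a * sin a) \<le> a * sin b"
    using assms by (intro mult_left_mono) auto
  then show ?thesis using False by simp
qed (use assms in auto)

lemma csinc_nonneg: "0 \<le> a \<Longrightarrow> 0 \<le> csinc a"
  by (auto simp: csinc_def intro!: divide_nonneg_nonneg sin_ge_zero)

lemma csinc_le_1: "0 \<le> a \<Longrightarrow> csinc a \<le> 1"
  using sin_x_le_x[of a] by (auto simp: csinc_def)

lemma mult_csinc: "0 \<le> a \<Longrightarrow> a * csinc a = sin (min a pi)"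
  by (auto simp: csinc_def min_def)

lemma csinc_measurable [measurable]: "csinc \<in> borel_measurable borel"
  unfolding csinc_def by measurable

lemma ccos_measurable [measurable]: "ccos \<in> borel_measurable borel"
  unfolding ccos_def by measurable

lemma ccos_bounds: "-1 \<le> ccos a" "ccos a \<le> 1"
  by (auto simp: ccos_def)

text \<open>Convexity of $s \mapsto \cos(\min(\sqrt s,\pi))$, in tangent-line form with $s = a^2$.\<close>
lemma ccos_tangent:
  assumes "0 \<le> a" "0 \<le> b"
  shows "ccos b \<ge> ccos a - csinc a * (b\<^sup>2 - a\<^sup>2) / 2"
proof (cases "a \<le> pi")
  case False
  then have "csinc a = 0" "ccos a = -1"
    using pi_gt_zero by (auto simp: csinc_def ccos_def min_def simp del: pi_gt_zero)
  then show ?thesis by (simp add: ccos_bounds)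
next
  case True
  have key: "cos c \<ge> cos a - csinc a * (c\<^sup>2 - a\<^sup>2) / 2" if c: "0 \<le> c" "c \<le> pi" for c
  proof -
    \<comment> \<open>On [0, pi] the function \<open>G\<close> is minimal at \<open>a\<close>: its
      derivative csinc a * x - sin x changes sign from minus to plus there because sin x / x
      decreases. The tangent inequality is \<open>G a \<le> G c\<close>.\<close>
    define G where "G = (\<lambda>x. cos x + csinc a * x\<^sup>2 / 2)"
    have der: "(G has_real_derivative (- sin x + csinc a * x)) (at x)" for x
      unfolding G_def by (auto intro!: derivative_eq_intros)
    have sgn: "x * sin a = a * (csinc a * x)" if "a \<noteq> 0" for x
      using that True by (simp add: csinc_def)
    have "G a \<le> G c"
    proof (cases "a \<le> c")
      case le: True
      show ?thesis
      proof (rule DERIV_nonneg_imp_nondecreasing[OF le])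
        fix x assume x: "a \<le> x" "x \<le> c"
        have "sin x \<le> csinc a * x"
        proof (cases "a = 0")
          case True then show ?thesis using sin_x_le_x[of x] x by (simp add: csinc_def)
        next
          case False
          have "a * sin x \<le> x * sin a" using sin_ratio_antimono[of a x] x c assms by simp
          also have "\<dots> = a * (csinc a * x)" by (rule sgn[OF False])
          finally show ?thesis using False assms by (simp add: mult_le_cancel_left)
        qed
        then show "\<exists>y. (G has_real_derivative y) (at x) \<and> 0 \<le> y"
          using der[of x] by (intro exI[of _ "- sin x + csinc a * x"]) auto
      qed
    next
      case False
      then have le: "c \<le> a" and a0: "a \<noteq> 0" using c by auto
      show ?thesis
      proof (rule DERIV_nonpos_imp_nonincreasing[OF le])
        fix x assume x: "c \<le> x" "x \<le> a"
        have "x * sin a \<le> a * sin x" using sin_ratio_antimono[of x a] x c True by simp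
        then have "a * (csinc a * x) \<le> a * sin x" using sgn[OF a0] by simp
        then have "csinc a * x \<le> sin x" using a0 assms by (simp add: mult_le_cancel_left)
        then show "\<exists>y. (G has_real_derivative y) (at x) \<and> y \<le> 0"
          using der[of x] by (intro exI[of _ "- sin x + csinc a * x"]) auto
      qed
    qed
    then show ?thesis by (simp add: G_def algebra_simps diff_divide_distrib)
  qed
  \<comment> \<open>Beyond pi the cosine is frozen while b^2 keeps growing and the slope -csinc a /
    2 is not positive, so the case of large b reduces to \<open>min b pi\<close>.\<close>
  have "csinc a * ((min b pi)\<^sup>2 - a\<^sup>2) \<le> csinc a * (b\<^sup>2 - a\<^sup>2)"
    using csinc_nonneg[OF assms(1)] assms by (intro mult_left_mono diff_right_mono power_mono) auto
  moreover have "ccos a = cos a" using True by (simp add: ccos_def)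
  ultimately show ?thesis using key[of "min b pi"] assms by (simp add: ccos_def)
qed

text \<open>Jordan's inequality sin (m/2) >= m / pi for m in [0, pi], combined with 1 - cos m = 2
  sin^2 (m/2).\<close>

lemma one_minus_ccos_ge:
  assumes "0 \<le> a"
  shows "(min a pi)\<^sup>2 \<le> pi\<^sup>2 / 2 * (1 - ccos a)"
proof -
  define m where "m = min a pi"
  have m: "0 \<le> m" "m \<le> pi" using assms by (auto simp: m_def)
  have "m / 2 * sin (pi / 2) \<le> pi / 2 * sin (m / 2)"
    using sin_ratio_antimono[of "m / 2" "pi / 2"] m by auto
  then have "m \<le> pi * sin (m / 2)" by simp
  then have "m\<^sup>2 \<le> (pi * sin (m / 2))\<^sup>2" using m by (intro power_mono) auto
  also have "\<dots> = pi\<^sup>2 / 2 * (1 - cos m)"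
    using cos_double_sin[of "m / 2"] by (simp add: power_mult_distrib)
  finally show ?thesis by (simp add: m_def ccos_def)
qed

lemma one_minus_ccos_le:
  assumes "0 \<le> a"
  shows "1 - ccos a \<le> a\<^sup>2 / 2"
  using ccos_tangent[of 0 a] assms by (simp add: csinc_def ccos_def)

section \<open>The cone distance\<close>

text \<open>The radicand is nonnegative for radii of any sign because \<open>ccos\<close> lies in
  [-1, 1], so the root can be squared away on the whole product space and not only on
  \<open>cone_set\<close>.\<close>

lemma dC_sq:
  assumes "\<Sigma> > 0"
  shows "(dC \<Lambda> \<Sigma> p q)\<^sup>2 = 4 / \<Sigma> * ((snd p)\<^sup>2 + (snd q)\<^sup>2
      - 2 * snd p * snd q * ccos (sqrt (\<Sigma> / (4 * \<Lambda>)) * norm (fst p - fst q)))"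
proof -
  let ?c = "ccos (sqrt (\<Sigma> / (4 * \<Lambda>)) * norm (fst p - fst q))"
  have "\<bar>snd p * snd q * ?c\<bar> \<le> \<bar>snd p * snd q\<bar> * 1"
    unfolding abs_mult using ccos_bounds[of "sqrt (\<Sigma> / (4 * \<Lambda>)) * norm (fst p - fst q)"]
    by (intro mult_left_mono) (auto simp: abs_if)
  then have "2 * snd p * snd q * ?c \<le> 2 * \<bar>snd p * snd q\<bar>" by linarith
  also have "\<dots> \<le> (snd p)\<^sup>2 + (snd q)\<^sup>2"
    using zero_le_power2[of "\<bar>snd p\<bar> - \<bar>snd q\<bar>"] by (simp add: power2_diff abs_mult)
  finally show ?thesis
    using assms unfolding dC_def ccos_def by (subst real_sqrt_pow2) auto
qed

lemma dC_measurable [measurable]: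
  "(\<lambda>p. dC \<Lambda> \<Sigma> (fst p) (snd p)) \<in> borel_measurable borel"
proof -
  have "continuous_on UNIV (\<lambda>p. dC \<Lambda> \<Sigma> (fst p) (snd p))"
    unfolding dC_def by (intro continuous_intros)
  then show ?thesis by (rule borel_measurable_continuous_onI)
qed

lemma dC_measurable2 [measurable (raw)]:
  assumes "f \<in> borel_measurable M" "g \<in> borel_measurable M"
  shows "(\<lambda>x. dC \<Lambda> \<Sigma> (f x) (g x)) \<in> borel_measurable M"
proof -
  have "(\<lambda>x. (f x, g x)) \<in> borel_measurable M" using assms by (simp add: borel_measurable_Pair)
  from measurable_compose[OF this dC_measurable] show ?thesis by simp
qed

lemma dC_nonneg: "\<Sigma> > 0 \<Longrightarrow> 0 \<le> dC \<Lambda> \<Sigma> p q"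
  using dC_sq[of \<Sigma> \<Lambda> p q] zero_le_power2[of "dC \<Lambda> \<Sigma> p q"]
  unfolding dC_def by (subst real_sqrt_ge_0_iff) (simp add: ccos_def)

lemma dC_commute: "dC \<Lambda> \<Sigma> p q = dC \<Lambda> \<Sigma> q p"
  by (simp add: dC_def norm_minus_commute algebra_simps)

text \<open>Dilations act on both radii at once. This homogeneity lets a plan be rescaled pointwise
  and reweighted at unchanged cost, and it lets radii be matched when two plans are glued.\<close>

lemma dC_scale:
  assumes "\<Sigma> > 0" "0 \<le> c"
  shows "dC \<Lambda> \<Sigma> (x, c * r) (y, c * s) = c * dC \<Lambda> \<Sigma> (x, r) (y, s)"
proof (rule power2_eq_imp_eq)
  show "(dC \<Lambda> \<Sigma> (x, c * r) (y, c * s))\<^sup>2 = (c * dC \<Lambda> \<Sigma> (x, r) (y, s))\<^sup>2"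
    unfolding power_mult_distrib dC_sq[OF assms(1)] by (simp add: algebra_simps power2_eq_square)
qed (use assms in \<open>auto intro!: mult_nonneg_nonneg dC_nonneg\<close>)

text \<open>From \<open>ccos \<ge> -1\<close>. It makes the cost integrable against every plan with
  finite homogeneous marginals.\<close>

lemma dC_le_add:
  assumes "\<Sigma> > 0"
  shows "(dC \<Lambda> \<Sigma> p q)\<^sup>2 \<le> 8 / \<Sigma> * ((snd p)\<^sup>2 + (snd q)\<^sup>2)"
proof -
  let ?c = "ccos (sqrt (\<Sigma> / (4 * \<Lambda>)) * norm (fst p - fst q))"
  have "\<bar>snd p * snd q * ?c\<bar> \<le> \<bar>snd p * snd q\<bar> * 1"
    unfolding abs_mult using ccos_bounds[of "sqrt (\<Sigma> / (4 * \<Lambda>)) * norm (fst p - fst q)"]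
    by (intro mult_left_mono) (auto simp: abs_if)
  then have "- 2 * snd p * snd q * ?c \<le> 2 * \<bar>snd p * snd q\<bar>" by linarith
  also have "\<dots> \<le> (snd p)\<^sup>2 + (snd q)\<^sup>2"
    using zero_le_power2[of "\<bar>snd p\<bar> - \<bar>snd q\<bar>"] by (simp add: power2_diff abs_mult)
  finally have "(snd p)\<^sup>2 + (snd q)\<^sup>2 - 2 * snd p * snd q * ?c \<le> 2 * ((snd p)\<^sup>2 + (snd q)\<^sup>2)" by simp
  then have "4 / \<Sigma> * ((snd p)\<^sup>2 + (snd q)\<^sup>2 - 2 * snd p * snd q * ?c) \<le> 4 / \<Sigma> * (2 * ((snd p)\<^sup>2 + (snd q)\<^sup>2))"
    using assms by (intro mult_left_mono) auto
  then show ?thesis unfolding dC_sq[OF assms] by simp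
qed

lemma norm_cis_diff_sq:
  "(cmod (complex_of_real r * cis a - complex_of_real s * cis b))\<^sup>2 = r\<^sup>2 + s\<^sup>2 - 2 * r * s * cos (a - b)"
proof -
  have "(r * cos a - s * cos b)\<^sup>2 + (r * sin a - s * sin b)\<^sup>2
      = r\<^sup>2 * ((cos a)\<^sup>2 + (sin a)\<^sup>2) + s\<^sup>2 * ((cos b)\<^sup>2 + (sin b)\<^sup>2) - 2 * r * s * (cos a * cos b + sin a * sin b)"
    by (simp only: power2_diff power_mult_distrib) (simp add: algebra_simps del: sin_cos_squared_add sin_cos_squared_add2)
  then show ?thesis by (simp add: cmod_power2 cos_diff)
qed

text \<open>Develop the three points in the plane with angles $a$ and $b \le \pi - a$; cutting the second angle
  at $\pi - a$ only decreases the second distance, and keeps the first and third point on opposite sides.\<close>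
lemma dC_triangle:
  assumes \<Lambda>: "\<Lambda> > 0" and \<Sigma>: "\<Sigma> > 0" and r: "0 \<le> snd p" "0 \<le> snd q" "0 \<le> snd s"
  shows "dC \<Lambda> \<Sigma> p s \<le> dC \<Lambda> \<Sigma> p q + dC \<Lambda> \<Sigma> q s"
proof -
  define k where "k = sqrt (\<Sigma> / (4 * \<Lambda>))"
  have k0: "0 \<le> k" using \<Lambda> \<Sigma> by (simp add: k_def)
  define A where "A = k * norm (fst p - fst q)"
  define B where "B = k * norm (fst q - fst s)"
  define C where "C = k * norm (fst p - fst s)"
  have AB: "0 \<le> A" "0 \<le> B" and C0: "0 \<le> C" using k0 by (auto simp: A_def B_def C_def)
  have "k * norm (fst p - fst s) \<le> k * (norm (fst p - fst q) + norm (fst q - fst s))"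
    using k0 norm_triangle_ineq[of "fst p - fst q" "fst q - fst s"] by (intro mult_left_mono) auto
  then have CAB: "C \<le> A + B" by (simp add: A_def B_def C_def distrib_left)
  define a where "a = min A pi"
  define b where "b = min B (pi - a)"
  have ab: "0 \<le> a" "a \<le> pi" "0 \<le> b" "a + b \<le> pi" "b \<le> min B pi"
    using AB by (auto simp: a_def b_def min_def)
  have Cab: "min C pi \<le> a + b" using CAB AB by (auto simp: a_def b_def)
  define z1 where "z1 = complex_of_real (snd p) * cis 0"
  define z2 where "z2 = complex_of_real (snd q) * cis a"
  define z3 where "z3 = complex_of_real (snd s) * cis (a + b)"
  have 1: "dC \<Lambda> \<Sigma> p q = sqrt (4 / \<Sigma>) * cmod (z1 - z2)"
  proof (rule power2_eq_imp_eq)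
    show "(dC \<Lambda> \<Sigma> p q)\<^sup>2 = (sqrt (4 / \<Sigma>) * cmod (z1 - z2))\<^sup>2"
      using \<Sigma> unfolding dC_sq[OF \<Sigma>] power_mult_distrib z1_def z2_def norm_cis_diff_sq
      by (simp add: ccos_def a_def A_def k_def)
  qed (use \<Sigma> in \<open>auto intro!: dC_nonneg\<close>)
  have 2: "sqrt (4 / \<Sigma>) * cmod (z2 - z3) \<le> dC \<Lambda> \<Sigma> q s"
  proof (rule power2_le_imp_le)
    have "cos (min B pi) \<le> cos b" using ab AB by (intro cos_monotone_0_pi_le) auto
    then have "snd q * snd s * cos (min B pi) \<le> snd q * snd s * cos b"
      using r by (intro mult_left_mono) auto
    then have "4 / \<Sigma> * ((snd q)\<^sup>2 + (snd s)\<^sup>2 - 2 * snd q * snd s * cos b) \<le>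
        4 / \<Sigma> * ((snd q)\<^sup>2 + (snd s)\<^sup>2 - 2 * snd q * snd s * cos (min B pi))"
      using \<Sigma> by (intro mult_left_mono) auto
    then show "(sqrt (4 / \<Sigma>) * cmod (z2 - z3))\<^sup>2 \<le> (dC \<Lambda> \<Sigma> q s)\<^sup>2"
      using \<Sigma> unfolding dC_sq[OF \<Sigma>] power_mult_distrib z3_def z2_def norm_cis_diff_sq
      by (simp add: ccos_def B_def k_def)
  qed (use \<Sigma> in \<open>auto intro!: dC_nonneg\<close>)
  \<comment> \<open>Here min C pi <= a + b <= pi, so opening the angle to a + b can only increase
    the distance.\<close>
  have 3: "dC \<Lambda> \<Sigma> p s \<le> sqrt (4 / \<Sigma>) * cmod (z1 - z3)"
  proof (rule power2_le_imp_le)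
    have "cos (a + b) \<le> cos (min C pi)" using ab Cab C0 by (intro cos_monotone_0_pi_le) auto
    then have "snd p * snd s * cos (a + b) \<le> snd p * snd s * cos (min C pi)"
      using r by (intro mult_left_mono) auto
    then have "4 / \<Sigma> * ((snd p)\<^sup>2 + (snd s)\<^sup>2 - 2 * snd p * snd s * cos (min C pi)) \<le>
        4 / \<Sigma> * ((snd p)\<^sup>2 + (snd s)\<^sup>2 - 2 * snd p * snd s * cos (a + b))"
      using \<Sigma> by (intro mult_left_mono) auto
    then show "(dC \<Lambda> \<Sigma> p s)\<^sup>2 \<le> (sqrt (4 / \<Sigma>) * cmod (z1 - z3))\<^sup>2"
      using \<Sigma> cos_minus[of "a + b"] unfolding dC_sq[OF \<Sigma>] power_mult_distrib z3_def z1_def norm_cis_diff_sq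
      by (simp add: ccos_def C_def k_def)
  qed (use \<Sigma> in auto)
  have "cmod (z1 - z3) \<le> cmod (z1 - z2) + cmod (z2 - z3)"
    using norm_triangle_ineq[of "z1 - z2" "z2 - z3"] by simp
  then have "sqrt (4 / \<Sigma>) * cmod (z1 - z3) \<le> sqrt (4 / \<Sigma>) * (cmod (z1 - z2) + cmod (z2 - z3))"
    using \<Sigma> by (intro mult_left_mono) auto
  then show ?thesis using 1 2 3 by (simp add: distrib_left)
qed

section \<open>Test functions\<close>

lemma C_infD:
  assumes "C_inf f"
  shows "f differentiable (at x)" "e \<in> Basis \<Longrightarrow> C_inf (\<lambda>x. frechet_derivative f (at x) e)"
  using assms by (auto elim: C_inf.cases)

lemma C_inf_continuous: "C_inf f \<Longrightarrow> continuous_on UNIV f"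
  using C_infD(1) by (auto intro!: continuous_at_imp_continuous_on differentiable_imp_continuous_within)

lemma has_derivative_grad:
  assumes "f differentiable (at x)"
  shows "(f has_derivative (\<lambda>h. inner (grad f x) h)) (at x)"
proof -
  have der: "(f has_derivative frechet_derivative f (at x)) (at x)"
    using assms by (simp add: frechet_derivative_works)
  then interpret linear "frechet_derivative f (at x)"
    by (rule has_derivative_linear)
  have "frechet_derivative f (at x) h = inner (grad f x) h" for h
  proof -
    have "frechet_derivative f (at x) h = frechet_derivative f (at x) (\<Sum>e\<in>Basis. (h \<bullet> e) *\<^sub>R e)"
      by (simp add: euclidean_representation)
    also have "\<dots> = (\<Sum>e\<in>Basis. (h \<bullet> e) * frechet_derivative f (at x) e)"
      by (simp add: sum scale)
    also have "\<dots> = inner (grad f x) h"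
      by (simp add: grad_def inner_sum_left inner_commute[of h] mult.commute)
    finally show ?thesis .
  qed
  with der show ?thesis by (metis (no_types, lifting) ext)
qed

text \<open>Off the closed support f vanishes on an open set, so its partial derivatives vanish
  there too. Through this closure property, boundedness of functions in \<open>Cc_inf\<close> passes
  to gradients, and bounded gradients give Lipschitz bounds, also for the gradient itself.\<close>

lemma Cc_inf_partial:
  assumes "f \<in> Cc_inf" "e \<in> Basis"
  shows "(\<lambda>x. frechet_derivative f (at x) e) \<in> Cc_inf"
proof -
  let ?g = "\<lambda>x. frechet_derivative f (at x) e"
  have "?g x = 0" if "x \<notin> tsupp f" for x
  proof -
    have "((\<lambda>_. 0) has_derivative (\<lambda>_. 0)) (at x)" by simp
    moreover have "open (- tsupp f)" "x \<in> - tsupp f" using that by (auto simp: tsupp_def)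
    moreover have "0 = f y" if "y \<in> - tsupp f" for y
      using that closure_subset[of "{x. f x \<noteq> 0}"] by (auto simp: tsupp_def)
    ultimately have "(f has_derivative (\<lambda>_. 0)) (at x)"
      by (rule has_derivative_transform_within_open) auto
    then have "frechet_derivative f (at x) = (\<lambda>_. 0)" by (metis frechet_derivative_at)
    then show ?thesis by simp
  qed
  then have "{x. ?g x \<noteq> 0} \<subseteq> tsupp f" by auto
  then have "tsupp ?g \<subseteq> tsupp f"
    unfolding tsupp_def[of ?g] by (intro closure_minimal) (auto simp: tsupp_def)
  then have "compact (tsupp ?g)"
    using assms by (metis (no_types, lifting) Cc_inf_def closed_Int_compact closed_closure inf.absorb_iff1 mem_Collect_eq tsupp_def)
  with C_infD(2)[of f e] assms show ?thesis by (auto simp: Cc_inf_def)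
qed

lemma Cc_inf_bounded:
  assumes "f \<in> Cc_inf"
  obtains B where "0 \<le> B" "\<And>x. \<bar>f x\<bar> \<le> B"
proof -
  have "compact (f ` tsupp f)"
    using assms C_inf_continuous[of f]
    by (auto simp: Cc_inf_def intro!: compact_continuous_image elim: continuous_on_subset)
  then obtain B where B: "\<And>y. y \<in> f ` tsupp f \<Longrightarrow> norm y \<le> B"
    using compact_imp_bounded bounded_iff by metis
  have "\<bar>f x\<bar> \<le> max 0 B" for x
  proof (cases "f x = 0")
    case False
    then have "x \<in> tsupp f" using closure_subset[of "{x. f x \<noteq> 0}"] by (auto simp: tsupp_def)
    then show ?thesis using B[of "f x"] by auto
  qed auto
  then show ?thesis using that[of "max 0 B"] by auto
qed

lemma Cc_inf_grad_bounded:
  assumes "f \<in> Cc_inf"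
  obtains B where "0 \<le> B" "\<And>x. norm (grad f x) \<le> B"
proof -
  have "\<forall>e\<in>Basis. \<exists>b\<ge>0. \<forall>x. \<bar>frechet_derivative f (at x) e\<bar> \<le> b"
    using Cc_inf_partial[OF assms] Cc_inf_bounded by metis
  then obtain b where b: "\<And>e x. e \<in> Basis \<Longrightarrow> \<bar>frechet_derivative f (at x) e\<bar> \<le> b e" "\<And>e. e \<in> Basis \<Longrightarrow> 0 \<le> b e"
    by metis
  have "norm (grad f x) \<le> (\<Sum>e\<in>Basis. b e)" for x
    unfolding grad_def by (rule order_trans[OF norm_sum]) (auto intro!: sum_mono b)
  then show ?thesis using that[of "\<Sum>e\<in>Basis. b e"] b(2) by (auto intro: sum_nonneg)
qed

lemma Cc_inf_Lipschitz:
  assumes "f \<in> Cc_inf"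
  obtains L where "0 \<le> L" "\<And>x y. \<bar>f x - f y\<bar> \<le> L * norm (x - y)"
proof -
  obtain B where B: "0 \<le> B" "\<And>x. norm (grad f x) \<le> B" using Cc_inf_grad_bounded[OF assms] by blast
  have "norm (f x - f y) \<le> B * norm (x - y)" for x y
  proof (rule differentiable_bound[where f' = "\<lambda>x h. inner (grad f x) h" and S = UNIV])
    fix z
    show "(f has_derivative (\<bullet>) (grad f z)) (at z within UNIV)"
      using assms C_infD(1) by (auto intro!: has_derivative_grad simp: Cc_inf_def)
    show "onorm ((\<bullet>) (grad f z)) \<le> B"
      by (rule order_trans[OF _ B(2)[of z]], rule onorm_le) (simp add: Cauchy_Schwarz_ineq2)
  qed auto
  then show ?thesis using that[of B] B by simp
qed

lemma Cc_inf_grad_Lipschitz: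
  assumes "f \<in> Cc_inf"
  obtains L where "0 \<le> L" "\<And>x y. norm (grad f x - grad f y) \<le> L * norm (x - y)"
proof -
  have "\<forall>e\<in>Basis. \<exists>b\<ge>0. \<forall>x y. \<bar>frechet_derivative f (at x) e - frechet_derivative f (at y) e\<bar> \<le> b * norm (x - y)"
    using Cc_inf_partial[OF assms] Cc_inf_Lipschitz by metis
  then obtain b where b: "\<And>e x y. e \<in> Basis \<Longrightarrow>
      \<bar>frechet_derivative f (at x) e - frechet_derivative f (at y) e\<bar> \<le> b e * norm (x - y)"
    "\<And>e. e \<in> Basis \<Longrightarrow> 0 \<le> b e"
    by metis
  have "norm (grad f x - grad f y) \<le> (\<Sum>e\<in>Basis. b e) * norm (x - y)" for x y
    unfolding grad_def sum_subtractf[symmetric] sum_distrib_right scaleR_diff_left[symmetric]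
    by (rule order_trans[OF norm_sum]) (auto intro!: sum_mono b)
  then show ?thesis using that[of "\<Sum>e\<in>Basis. b e"] b(2) by (auto intro: sum_nonneg)
qed

text \<open>Mean value inequality on the segment for z -> f z - <grad f x, z>, whose gradient is at
  most L |y - x| there.\<close>

lemma Cc_inf_Taylor:
  assumes "f \<in> Cc_inf"
  obtains L where "0 \<le> L" "\<And>x y. \<bar>f y - f x - inner (grad f x) (y - x)\<bar> \<le> L * (norm (y - x))\<^sup>2"
proof -
  obtain L where L: "0 \<le> L" "\<And>x y. norm (grad f x - grad f y) \<le> L * norm (x - y)"
    using Cc_inf_grad_Lipschitz[OF assms] by blast
  have "\<bar>f y - f x - inner (grad f x) (y - x)\<bar> \<le> L * (norm (y - x))\<^sup>2" for x y
  proof -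
    let ?p = "\<lambda>z. f z - inner (grad f x) z"
    have "norm (?p y - ?p x) \<le> (L * norm (y - x)) * norm (y - x)"
    proof (rule differentiable_bound[where f' = "\<lambda>z h. inner (grad f z - grad f x) h" and S = "closed_segment x y"])
      fix z assume z: "z \<in> closed_segment x y"
      have "(f has_derivative (\<lambda>h. inner (grad f z) h)) (at z)"
        using assms C_infD(1) by (auto intro!: has_derivative_grad simp: Cc_inf_def)
      then have "(?p has_derivative (\<lambda>h. inner (grad f z) h - inner (grad f x) h)) (at z)"
        by (intro derivative_intros) auto
      moreover have "(\<lambda>h. inner (grad f z) h - inner (grad f x) h) = (\<bullet>) (grad f z - grad f x)"
        by (auto simp: inner_diff_left)
      ultimately show "(?p has_derivative (\<bullet>) (grad f z - grad f x)) (at z within closed_segment x y)"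
        by (auto intro: has_derivative_at_withinI)
      have "norm (grad f z - grad f x) \<le> L * norm (z - x)" by (rule L)
      also have "\<dots> \<le> L * norm (y - x)"
        using L(1) segment_bound(1)[OF z] by (intro mult_left_mono) auto
      finally show "onorm ((\<bullet>) (grad f z - grad f x)) \<le> L * norm (y - x)"
        by (intro order_trans[OF onorm_le[of _ "norm (grad f z - grad f x)"]]) (simp_all add: Cauchy_Schwarz_ineq2)
    qed auto
    then show ?thesis by (simp add: inner_diff_right power2_eq_square algebra_simps)
  qed
  then show ?thesis using that[of L] L by simp
qed

lemma Cc_inf_measurable: "f \<in> Cc_inf \<Longrightarrow> f \<in> borel_measurable borel"
  using C_inf_continuous by (auto simp: Cc_inf_def intro: borel_measurable_continuous_onI)

lemma Cc_inf_grad_measurable: "f \<in> Cc_inf \<Longrightarrow> grad f \<in> borel_measurable borel"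
  unfolding grad_def[abs_def] using Cc_inf_measurable[OF Cc_inf_partial]
  by (intro borel_measurable_sum borel_measurable_scaleR) auto

section \<open>Sums of measures\<close>

text \<open>Superposition over the sigma-algebra of the first argument. Plans are assembled with it
  from transported pieces and pieces paired with the vertex.\<close>

definition add_measure :: "'a measure \<Rightarrow> 'a measure \<Rightarrow> 'a measure" where
  "add_measure M N = measure_of (space M) (sets M) (\<lambda>A. emeasure M A + emeasure N A)"

lemma sets_add_measure [simp, measurable_cong]: "sets (add_measure M N) = sets M"
  by (simp add: add_measure_def)

lemma space_add_measure [simp]: "space (add_measure M N) = space M"
  by (simp add: add_measure_def)

lemma emeasure_add_measure:
  assumes "sets N = sets M" "A \<in> sets M"
  shows "emeasure (add_measure M N) A = emeasure M A + emeasure N A"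
  unfolding add_measure_def
proof (rule emeasure_measure_of_sigma)
  show "countably_additive (sets M) (\<lambda>A. emeasure M A + emeasure N A)"
    using assms by (auto simp: countably_additive_def suminf_add[symmetric] suminf_emeasure)
qed (use assms in \<open>auto simp: positive_def intro: sets.sigma_algebra_axioms\<close>)

lemma nn_integral_add_measure:
  assumes "sets N = sets M" and f: "f \<in> borel_measurable M"
  shows "(\<integral>\<^sup>+x. f x \<partial>add_measure M N) = (\<integral>\<^sup>+x. f x \<partial>M) + (\<integral>\<^sup>+x. f x \<partial>N)"
  using f
proof induction
  case (cong f g)
  have "space N = space M" using assms(1) by (rule sets_eq_imp_space_eq)
  with cong(3) have "(\<integral>\<^sup>+x. f x \<partial>add_measure M N) = (\<integral>\<^sup>+x. g x \<partial>add_measure M N)"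
    "(\<integral>\<^sup>+x. f x \<partial>M) = (\<integral>\<^sup>+x. g x \<partial>M)" "(\<integral>\<^sup>+x. f x \<partial>N) = (\<integral>\<^sup>+x. g x \<partial>N)"
    by (auto intro!: nn_integral_cong)
  with cong show ?case by simp
next
  case (set A)
  then show ?case using assms by (simp add: emeasure_add_measure)
next
  case (mult u c)
  moreover have "u \<in> borel_measurable N" using mult assms by (simp cong: measurable_cong_sets)
  ultimately show ?case by (simp add: nn_integral_cmult distrib_left)
next
  case (add u v)
  moreover have "u \<in> borel_measurable N" "v \<in> borel_measurable N" using add assms by (simp_all cong: measurable_cong_sets)
  ultimately show ?case by (simp add: nn_integral_add algebra_simps)
next
  case (seq U)
  have U: "U i \<in> borel_measurable N" for i using seq assms by (simp cong: measurable_cong_sets)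
  have "(\<integral>\<^sup>+x. (SUP i. U i x) \<partial>add_measure M N) = (SUP i. \<integral>\<^sup>+x. U i x \<partial>add_measure M N)"
    using seq by (intro nn_integral_monotone_convergence_SUP) auto
  also have "\<dots> = (SUP i. (\<integral>\<^sup>+x. U i x \<partial>M) + (\<integral>\<^sup>+x. U i x \<partial>N))"
    using seq by simp
  also have "\<dots> = (SUP i. \<integral>\<^sup>+x. U i x \<partial>M) + (SUP i. \<integral>\<^sup>+x. U i x \<partial>N)"
    using seq by (intro ennreal_SUP_add) (auto simp: incseq_def le_fun_def intro!: nn_integral_mono)
  also have "\<dots> = (\<integral>\<^sup>+x. (SUP i. U i x) \<partial>M) + (\<integral>\<^sup>+x. (SUP i. U i x) \<partial>N)"
    using seq U by (simp add: nn_integral_monotone_convergence_SUP)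
  finally show ?case by (simp add: image_comp)
qed

lemma AE_add_measure:
  assumes sets: "sets N = sets M" and "AE x in M. P x" "AE x in N. P x"
  shows "AE x in add_measure M N. P x"
proof -
  have sp: "space N = space M" using sets by (rule sets_eq_imp_space_eq)
  obtain A where A: "{x \<in> space M. \<not> P x} \<subseteq> A" "A \<in> sets M" "emeasure M A = 0"
    using assms(2) by (auto elim!: AE_E)
  obtain B where B: "{x \<in> space N. \<not> P x} \<subseteq> B" "B \<in> sets N" "emeasure N B = 0"
    using assms(3) by (auto elim!: AE_E)
  \<comment> \<open>One exceptional set for both measures: every failure lies in \<open>A\<close>
    and in \<open>B\<close>, and the intersection is null for each of them.\<close>
  have "emeasure M (A \<inter> B) = 0" "emeasure N (A \<inter> B) = 0"
    using A B sets by (auto intro: emeasure_eq_0)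
  then have "A \<inter> B \<in> null_sets (add_measure M N)"
    using A B sets by (auto simp: null_sets_def emeasure_add_measure)
  then show ?thesis by (rule AE_I') (use A B sp in auto)
qed

lemma integral_add_measure:
  fixes f :: "'a \<Rightarrow> real"
  assumes sets: "sets N = sets M" and f: "integrable M f" "integrable N f"
  shows "(\<integral>x. f x \<partial>add_measure M N) = (\<integral>x. f x \<partial>M) + (\<integral>x. f x \<partial>N)"
proof -
  have m: "f \<in> borel_measurable M" using f by auto
  have *: "integrable (add_measure M N) f"
    using f sets by (auto simp: integrable_iff_bounded nn_integral_add_measure)
  have fin: "(\<integral>\<^sup>+x. ennreal (f x) \<partial>M) < \<infinity>" "(\<integral>\<^sup>+x. ennreal (- f x) \<partial>M) < \<infinity>"
     "(\<integral>\<^sup>+x. ennreal (f x) \<partial>N) < \<infinity>" "(\<integral>\<^sup>+x. ennreal (- f x) \<partial>N) < \<infinity>"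
    using f by (auto simp: real_integrable_def less_top)
  show "(\<integral>x. f x \<partial>add_measure M N) = (\<integral>x. f x \<partial>M) + (\<integral>x. f x \<partial>N)"
    unfolding real_lebesgue_integral_def[OF *] real_lebesgue_integral_def[OF f(1)] real_lebesgue_integral_def[OF f(2)]
    using m sets fin by (simp add: nn_integral_add_measure enn2real_plus)
qed

lemma borel_measurable_fst [measurable (raw)]:
  fixes f :: "'c \<Rightarrow> 'a::{second_countable_topology} \<times> 'b::{second_countable_topology}"
  assumes "f \<in> borel_measurable M"
  shows "(\<lambda>x. fst (f x)) \<in> borel_measurable M"
  using measurable_compose[OF assms borel_measurable_continuous_onI[of fst]] by (simp add: continuous_on_fst)

lemma borel_measurable_snd [measurable (raw)]:
  fixes f :: "'c \<Rightarrow> 'a::{second_countable_topology} \<times> 'b::{second_countable_topology}"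
  assumes "f \<in> borel_measurable M"
  shows "(\<lambda>x. snd (f x)) \<in> borel_measurable M"
  using measurable_compose[OF assms borel_measurable_continuous_onI[of snd]] by (simp add: continuous_on_snd)

section \<open>Plans with prescribed homogeneous marginals\<close>

text \<open>X_#(R^2 M) is the homogeneous marginal of the cone-valued map [X, R];
  \<open>hmap\<close> is the case X = \<open>fst\<close>, R = \<open>snd\<close>. Evaluating it on
  sets allows marginals to be compared across different parameter spaces.\<close>

lemma emeasure_homogeneous_marginal:
  fixes X :: "'b \<Rightarrow> 'a::euclidean_space" and R :: "'b \<Rightarrow> real"
  assumes [measurable]: "X \<in> borel_measurable M" "R \<in> borel_measurable M" "A \<in> sets borel"
  shows "emeasure (distr (density M (\<lambda>\<omega>. ennreal ((R \<omega>)\<^sup>2))) borel X) A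
    = (\<integral>\<^sup>+\<omega>. ennreal ((R \<omega>)\<^sup>2) * indicator A (X \<omega>) \<partial>M)"
proof -
  have "emeasure (distr (density M (\<lambda>\<omega>. ennreal ((R \<omega>)\<^sup>2))) borel X) A
      = (\<integral>\<^sup>+\<omega>. ennreal ((R \<omega>)\<^sup>2) * indicator (X -` A \<inter> space M) \<omega> \<partial>M)"
    by (simp add: emeasure_distr emeasure_density)
  also have "\<dots> = (\<integral>\<^sup>+\<omega>. ennreal ((R \<omega>)\<^sup>2) * indicator A (X \<omega>) \<partial>M)"
    by (intro nn_integral_cong) (auto simp: indicator_def)
  finally show ?thesis .
qed

lemma homogeneous_marginal_cong:
  fixes X :: "'b \<Rightarrow> 'a::euclidean_space" and Y :: "'c \<Rightarrow> 'a"
  assumes "X \<in> borel_measurable M" "R \<in> borel_measurable M" "Y \<in> borel_measurable N" "S \<in> borel_measurable N"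
    and "\<And>A. A \<in> sets borel \<Longrightarrow> (\<integral>\<^sup>+\<omega>. ennreal ((R \<omega>)\<^sup>2) * indicator A (X \<omega>) \<partial>M)
      = (\<integral>\<^sup>+\<omega>. ennreal ((S \<omega>)\<^sup>2) * indicator A (Y \<omega>) \<partial>N)"
  shows "distr (density M (\<lambda>\<omega>. ennreal ((R \<omega>)\<^sup>2))) borel X = distr (density N (\<lambda>\<omega>. ennreal ((S \<omega>)\<^sup>2))) borel Y"
  by (rule measure_eqI) (use assms in \<open>simp_all add: emeasure_homogeneous_marginal\<close>)

lemma hmap_distr:
  assumes [measurable]: "Z \<in> borel_measurable M"
  shows "hmap (distr M borel Z) = distr (density M (\<lambda>p. ennreal ((snd (Z p))\<^sup>2))) borel (\<lambda>p. fst (Z p))"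
  unfolding hmap_def by (rule homogeneous_marginal_cong) (simp_all add: nn_integral_distr)

lemma cone_set_measurable [measurable]: "cone_set \<in> sets borel"
proof -
  have "cone_set = {p::'a \<times> real. snd p > 0} \<union> {(0, 0)}" by (auto simp: cone_set_def)
  moreover have "{p::'a \<times> real. snd p > 0} \<union> {(0, 0)} \<in> sets borel" by (rule sets.Un) simp_all
  ultimately show ?thesis by (rule ssubst)
qed

text \<open>The weight \<theta>^2 cancels the division of the radius by \<theta>, so the homogeneous
  marginal is kept. The bound R^2 <= \<theta>^2 makes the new radii at most 1, hence a finite second
  moment, and forces R = 0 where \<theta> = 0. Base points of radius 0 are reset to 0 in order to
  land in \<open>cone_set\<close>.\<close>

lemma normalized_lift:
  fixes X :: "'b \<Rightarrow> 'a::euclidean_space" and R \<theta> :: "'b \<Rightarrow> real"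
  assumes [measurable]: "X \<in> borel_measurable M" "R \<in> borel_measurable M" "\<theta> \<in> borel_measurable M"
    and R: "AE \<omega> in M. 0 \<le> R \<omega>" and \<theta>: "\<And>\<omega>. 0 \<le> \<theta> \<omega>" "\<And>\<omega>. (R \<omega>)\<^sup>2 \<le> (\<theta> \<omega>)\<^sup>2"
    and fin: "(\<integral>\<^sup>+\<omega>. ennreal ((\<theta> \<omega>)\<^sup>2) \<partial>M) < \<infinity>"
  defines "\<alpha> \<equiv> distr (density M (\<lambda>\<omega>. ennreal ((\<theta> \<omega>)\<^sup>2))) borel (\<lambda>\<omega>. (if R \<omega> = 0 then 0 else X \<omega>, R \<omega> / \<theta> \<omega>))"
  shows "M2C \<alpha>" "hmap \<alpha> = distr (density M (\<lambda>\<omega>. ennreal ((R \<omega>)\<^sup>2))) borel X"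
proof -
  let ?Z = "\<lambda>\<omega>. (if R \<omega> = 0 then 0 else X \<omega>, R \<omega> / \<theta> \<omega>)"
  let ?N = "density M (\<lambda>\<omega>. ennreal ((\<theta> \<omega>)\<^sup>2))"
  have Z[measurable]: "?Z \<in> borel_measurable M" by (intro borel_measurable_Pair) auto
  have "emeasure ?N (space ?N) = (\<integral>\<^sup>+\<omega>. ennreal ((\<theta> \<omega>)\<^sup>2) \<partial>M)"
    by (simp add: emeasure_density cong: nn_integral_cong)
  then have N: "finite_measure ?N" using fin by (intro finite_measureI) auto
  then have \<alpha>: "finite_measure \<alpha>" unfolding \<alpha>_def by (rule finite_measure.finite_measure_distr) auto
  have "AE \<omega> in ?N. ?Z \<omega> \<in> cone_set"
  proof (subst AE_density, measurable, use R in eventually_elim, safe)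
    fix \<omega> assume "0 \<le> R \<omega>" "0 < ennreal ((\<theta> \<omega>)\<^sup>2)"
    moreover have "0 < R \<omega> / \<theta> \<omega>" if "0 < R \<omega>"
      using that \<theta>[of \<omega>] by (intro divide_pos_pos) (auto simp: order_less_le)
    ultimately show "?Z \<omega> \<in> cone_set" by (auto simp: cone_set_def order_less_le)
  qed
  then have "AE p in \<alpha>. p \<in> cone_set" unfolding \<alpha>_def by (subst AE_distr_iff) auto
  then have 1: "emeasure \<alpha> (UNIV - cone_set) = 0"
    using emeasure_eq_0_AE[of "\<lambda>p. p \<notin> cone_set" \<alpha>] by (simp add: \<alpha>_def set_diff_eq)
  have b: "(R \<omega> / \<theta> \<omega>)\<^sup>2 \<le> 1" for \<omega>
    using \<theta>(2)[of \<omega>] by (simp add: power_divide divide_le_eq_1)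
  have "integrable ?N (\<lambda>\<omega>. (R \<omega> / \<theta> \<omega>)\<^sup>2)"
    using b by (intro finite_measure.integrable_const_bound[OF N, of _ 1]) auto
  then have "integrable \<alpha> (\<lambda>p. (snd p)\<^sup>2)"
    unfolding \<alpha>_def by (subst integrable_distr_eq) auto
  with 1 \<alpha> show "M2C \<alpha>" by (auto simp: M2C_def fin_meas_def \<alpha>_def)
  have "hmap \<alpha> = distr (density ?N (\<lambda>p. ennreal ((snd (?Z p))\<^sup>2))) borel (\<lambda>p. fst (?Z p))"
    unfolding \<alpha>_def by (rule hmap_distr) simp
  also have "\<dots> = distr (density M (\<lambda>\<omega>. ennreal ((R \<omega>)\<^sup>2))) borel X"
  proof (rule homogeneous_marginal_cong)
    fix A :: "'a set" assume [measurable]: "A \<in> sets borel"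
    have *: "ennreal ((\<theta> \<omega>)\<^sup>2) * (ennreal ((snd (?Z \<omega>))\<^sup>2) * indicator A (fst (?Z \<omega>)))
      = ennreal ((R \<omega>)\<^sup>2) * indicator A (X \<omega>)" for \<omega>
    proof (cases "R \<omega> = 0")
      case False
      then have "\<theta> \<omega> \<noteq> 0" using \<theta>(2)[of \<omega>] by auto
      then show ?thesis using False
        by (simp add: mult.assoc[symmetric] ennreal_mult[symmetric] power_divide)
    qed auto
    show "(\<integral>\<^sup>+\<omega>. ennreal ((snd (?Z \<omega>))\<^sup>2) * indicator A (fst (?Z \<omega>)) \<partial>?N)
        = (\<integral>\<^sup>+\<omega>. ennreal ((R \<omega>)\<^sup>2) * indicator A (X \<omega>) \<partial>M)"
      by (subst nn_integral_density) (auto simp: * simp del: fst_conv snd_conv)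
  qed auto
  finally show "hmap \<alpha> = distr (density M (\<lambda>\<omega>. ennreal ((R \<omega>)\<^sup>2))) borel X" .
qed

text \<open>Dilating a plan by $1/\theta$ and weighting it by $\theta^2$ preserves homogeneous marginals and cost; with
  $\theta^2 = R_1^2 + R_2^2$ the result is a finite measure, so the parametrising measure may be infinite.\<close>
lemma HK2_le_param:
  fixes X1 X2 :: "'b \<Rightarrow> 'a::euclidean_space" and R1 R2 :: "'b \<Rightarrow> real"
  assumes \<Sigma>: "\<Sigma> > 0"
    and [measurable]: "X1 \<in> borel_measurable M" "R1 \<in> borel_measurable M" "X2 \<in> borel_measurable M" "R2 \<in> borel_measurable M"
    and R: "AE \<omega> in M. 0 \<le> R1 \<omega>" "AE \<omega> in M. 0 \<le> R2 \<omega>"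
    and m: "distr (density M (\<lambda>\<omega>. ennreal ((R1 \<omega>)\<^sup>2))) borel X1 = \<mu>1" "distr (density M (\<lambda>\<omega>. ennreal ((R2 \<omega>)\<^sup>2))) borel X2 = \<mu>2"
    and fin: "finite_measure \<mu>1" "finite_measure \<mu>2"
  shows "HK2 \<Lambda> \<Sigma> \<mu>1 \<mu>2 \<le> (\<integral>\<^sup>+\<omega>. ennreal ((dC \<Lambda> \<Sigma> (X1 \<omega>, R1 \<omega>) (X2 \<omega>, R2 \<omega>))\<^sup>2) \<partial>M)"
proof -
  define \<theta> where "\<theta> = (\<lambda>\<omega>. sqrt ((R1 \<omega>)\<^sup>2 + (R2 \<omega>)\<^sup>2))"
  have [measurable]: "\<theta> \<in> borel_measurable M" unfolding \<theta>_def by measurable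
  have \<theta>: "0 \<le> \<theta> \<omega>" "(\<theta> \<omega>)\<^sup>2 = (R1 \<omega>)\<^sup>2 + (R2 \<omega>)\<^sup>2" for \<omega> by (auto simp: \<theta>_def)
  let ?N = "density M (\<lambda>\<omega>. ennreal ((\<theta> \<omega>)\<^sup>2))"
  let ?Z1 = "\<lambda>\<omega>. (if R1 \<omega> = 0 then 0 else X1 \<omega>, R1 \<omega> / \<theta> \<omega>)"
  let ?Z2 = "\<lambda>\<omega>. (if R2 \<omega> = 0 then 0 else X2 \<omega>, R2 \<omega> / \<theta> \<omega>)"
  have Z[measurable]: "?Z1 \<in> borel_measurable M" "?Z2 \<in> borel_measurable M" by (intro borel_measurable_Pair; auto)+
  have Z'[measurable]: "(\<lambda>\<omega>. (?Z1 \<omega>, ?Z2 \<omega>)) \<in> borel_measurable M" by (intro borel_measurable_Pair Z)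
  have e: "emeasure \<mu>1 UNIV = (\<integral>\<^sup>+\<omega>. ennreal ((R1 \<omega>)\<^sup>2) \<partial>M)" "emeasure \<mu>2 UNIV = (\<integral>\<^sup>+\<omega>. ennreal ((R2 \<omega>)\<^sup>2) \<partial>M)"
    unfolding m[symmetric] by (simp_all add: emeasure_homogeneous_marginal)
  have "(\<integral>\<^sup>+\<omega>. ennreal ((\<theta> \<omega>)\<^sup>2) \<partial>M) = emeasure \<mu>1 UNIV + emeasure \<mu>2 UNIV"
    unfolding e \<theta> by (simp add: nn_integral_add)
  also have "\<dots> < \<infinity>" using fin by (simp add: finite_measure.emeasure_finite less_top[symmetric])
  finally have finN: "(\<integral>\<^sup>+\<omega>. ennreal ((\<theta> \<omega>)\<^sup>2) \<partial>M) < \<infinity>" .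
  have "emeasure ?N (space ?N) = (\<integral>\<^sup>+\<omega>. ennreal ((\<theta> \<omega>)\<^sup>2) \<partial>M)"
    by (simp add: emeasure_density cong: nn_integral_cong)
  then have N: "finite_measure ?N" using finN by (intro finite_measureI) auto
  define \<beta> where "\<beta> = distr ?N borel (\<lambda>\<omega>. (?Z1 \<omega>, ?Z2 \<omega>))"
  have "coupling \<beta> (distr ?N borel ?Z1) (distr ?N borel ?Z2)"
    unfolding coupling_def fin_meas_def \<beta>_def
    by (auto simp: distr_distr comp_def intro!: finite_measure.finite_measure_distr[OF N])
  then have wc: "WC2 \<Lambda> \<Sigma> (distr ?N borel ?Z1) (distr ?N borel ?Z2) \<le> cost \<Lambda> \<Sigma> \<beta>"
    unfolding WC2_def by (intro INF_lower) auto
  have hk: "HK2 \<Lambda> \<Sigma> \<mu>1 \<mu>2 \<le> WC2 \<Lambda> \<Sigma> (distr ?N borel ?Z1) (distr ?N borel ?Z2)"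
    unfolding HK2_def
    using normalized_lift[of X1 M R1 \<theta>] normalized_lift[of X2 M R2 \<theta>] \<theta> finN R m
    by (intro INF_lower2[of "(distr ?N borel ?Z1, distr ?N borel ?Z2)"]) auto
  have "cost \<Lambda> \<Sigma> \<beta> = (\<integral>\<^sup>+\<omega>. ennreal ((dC \<Lambda> \<Sigma> (X1 \<omega>, R1 \<omega>) (X2 \<omega>, R2 \<omega>))\<^sup>2) \<partial>M)"
  proof -
    have *: "(\<theta> \<omega>)\<^sup>2 * (dC \<Lambda> \<Sigma> (?Z1 \<omega>) (?Z2 \<omega>))\<^sup>2 = (dC \<Lambda> \<Sigma> (X1 \<omega>, R1 \<omega>) (X2 \<omega>, R2 \<omega>))\<^sup>2" for \<omega>
    proof (cases "\<theta> \<omega> = 0")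
      case True
      then have "(R1 \<omega>)\<^sup>2 + (R2 \<omega>)\<^sup>2 = 0" using \<theta>(2)[of \<omega>] by simp
      then have "R1 \<omega> = 0" "R2 \<omega> = 0" by (auto simp: sum_power2_eq_zero_iff)
      with True show ?thesis by (simp add: dC_sq[OF \<Sigma>])
    next
      case False
      have "\<theta> \<omega> * dC \<Lambda> \<Sigma> (x, R1 \<omega> / \<theta> \<omega>) (y, R2 \<omega> / \<theta> \<omega>) = dC \<Lambda> \<Sigma> (x, R1 \<omega>) (y, R2 \<omega>)" for x y :: 'a
        using dC_scale[OF \<Sigma> \<theta>(1)[of \<omega>], of \<Lambda> x "R1 \<omega> / \<theta> \<omega>" y "R2 \<omega> / \<theta> \<omega>"] False by simp
      then have "(\<theta> \<omega> * dC \<Lambda> \<Sigma> (?Z1 \<omega>) (?Z2 \<omega>))\<^sup>2 = (dC \<Lambda> \<Sigma> (fst (?Z1 \<omega>), R1 \<omega>) (fst (?Z2 \<omega>), R2 \<omega>))\<^sup>2"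
        by simp
      \<comment> \<open>Resetting base points at radius 0 is harmless: they enter only through the
        term that carries the product of both radii.\<close>
      also have "\<dots> = (dC \<Lambda> \<Sigma> (X1 \<omega>, R1 \<omega>) (X2 \<omega>, R2 \<omega>))\<^sup>2"
        by (simp add: dC_sq[OF \<Sigma>])
      finally show ?thesis by (simp only: power_mult_distrib)
    qed
    have "cost \<Lambda> \<Sigma> \<beta> = (\<integral>\<^sup>+\<omega>. ennreal ((dC \<Lambda> \<Sigma> (?Z1 \<omega>) (?Z2 \<omega>))\<^sup>2) \<partial>?N)"
      unfolding cost_def \<beta>_def by (subst nn_integral_distr) auto
    also have "\<dots> = (\<integral>\<^sup>+\<omega>. ennreal ((\<theta> \<omega>)\<^sup>2 * (dC \<Lambda> \<Sigma> (?Z1 \<omega>) (?Z2 \<omega>))\<^sup>2) \<partial>M)"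
      by (subst nn_integral_density) (auto simp: ennreal_mult)
    finally show ?thesis unfolding * .
  qed
  with order_trans[OF hk wc] show ?thesis by (rule ord_le_eq_trans)
qed

text \<open>A plan prescribed by its homogeneous marginals alone. Points of radius 0 may carry any
  base point and radii are nonnegative almost everywhere, which suits superposition; by
  \<open>HK2_le_cost\<close> the cost of such a plan still bounds \<open>HK2\<close> from
  above.\<close>

definition hplan :: "(('a::euclidean_space \<times> real) \<times> ('a \<times> real)) measure \<Rightarrow> 'a measure \<Rightarrow> 'a measure \<Rightarrow> bool" where
  "hplan \<gamma> \<mu>1 \<mu>2 \<longleftrightarrow> fin_meas \<gamma> \<and> (AE p in \<gamma>. 0 \<le> snd (fst p)) \<and> (AE p in \<gamma>. 0 \<le> snd (snd p)) \<and>
     distr (density \<gamma> (\<lambda>p. ennreal ((snd (fst p))\<^sup>2))) borel (\<lambda>p. fst (fst p)) = \<mu>1 \<and>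
     distr (density \<gamma> (\<lambda>p. ennreal ((snd (snd p))\<^sup>2))) borel (\<lambda>p. fst (snd p)) = \<mu>2"

lemma sets_fin_meas: "fin_meas \<gamma> \<Longrightarrow> sets \<gamma> = sets borel"
  by (simp add: fin_meas_def)

lemma hplanD:
  assumes "hplan \<gamma> \<mu>1 \<mu>2"
  shows "sets \<gamma> = sets borel" "finite_measure \<gamma>" "AE p in \<gamma>. 0 \<le> snd (fst p)" "AE p in \<gamma>. 0 \<le> snd (snd p)"
  using assms by (auto simp: hplan_def fin_meas_def)

lemma hplan_coupling:
  assumes "coupling \<beta> \<alpha>1 \<alpha>2" "M2C \<alpha>1" "M2C \<alpha>2"
  shows "hplan \<beta> (hmap \<alpha>1) (hmap \<alpha>2)"
proof -
  have \<beta>: "fin_meas \<beta>" "distr \<beta> borel fst = \<alpha>1" "distr \<beta> borel snd = \<alpha>2" using assms by (auto simp: coupling_def)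
  note [measurable_cong] = sets_fin_meas[OF \<beta>(1)]
  have "AE p in \<alpha>. 0 \<le> snd p" if "M2C \<alpha>" for \<alpha> :: "('a \<times> real) measure"
  proof (rule AE_I')
    show "UNIV - cone_set \<in> null_sets \<alpha>" using that by (auto simp: null_sets_def M2C_def fin_meas_def)
    show "{p \<in> space \<alpha>. \<not> 0 \<le> snd p} \<subseteq> UNIV - cone_set" by (auto simp: cone_set_def)
  qed
  then have 1: "AE p in \<alpha>1. 0 \<le> snd p" "AE p in \<alpha>2. 0 \<le> snd p" using assms by auto
  have 2: "AE p in \<beta>. 0 \<le> snd (fst p)" "AE p in \<beta>. 0 \<le> snd (snd p)"
    using AE_distrD[OF _ 1(1)[folded \<beta>(2)]] AE_distrD[OF _ 1(2)[folded \<beta>(3)]] by simp_all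
  show ?thesis unfolding hplan_def \<beta>(2,3)[symmetric] using \<beta>(1) 2
    by (auto simp: hmap_distr)
qed

text \<open>Strict inequality descends through the two nested infima, first to a pair of lifts and
  then to a coupling of them. Near-optimal plans are obtained this way.\<close>

lemma HK2_less_plan:
  assumes "HK2 \<Lambda> \<Sigma> \<mu>1 \<mu>2 < c"
  obtains \<gamma> where "hplan \<gamma> \<mu>1 \<mu>2" "cost \<Lambda> \<Sigma> \<gamma> < c"
proof -
  obtain \<alpha>1 \<alpha>2 where \<alpha>: "M2C \<alpha>1" "M2C \<alpha>2" "hmap \<alpha>1 = \<mu>1" "hmap \<alpha>2 = \<mu>2" "WC2 \<Lambda> \<Sigma> \<alpha>1 \<alpha>2 < c"
    using assms unfolding HK2_def INF_less_iff by auto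
  then obtain \<beta> where "coupling \<beta> \<alpha>1 \<alpha>2" "cost \<Lambda> \<Sigma> \<beta> < c"
    unfolding WC2_def INF_less_iff by auto
  with hplan_coupling[of \<beta> \<alpha>1 \<alpha>2] \<alpha> that show ?thesis by auto
qed

lemma
  assumes \<gamma>: "hplan \<gamma> \<mu>1 \<mu>2" and f: "f \<in> borel_measurable borel"
  shows hplan_nn_integral1: "(\<integral>\<^sup>+p. ennreal ((snd (fst p))\<^sup>2) * f (fst (fst p)) \<partial>\<gamma>) = (\<integral>\<^sup>+x. f x \<partial>\<mu>1)"
    and hplan_nn_integral2: "(\<integral>\<^sup>+p. ennreal ((snd (snd p))\<^sup>2) * f (fst (snd p)) \<partial>\<gamma>) = (\<integral>\<^sup>+x. f x \<partial>\<mu>2)"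
proof -
  have g: "fin_meas \<gamma>" using \<gamma> by (simp add: hplan_def)
  note [measurable_cong] = sets_fin_meas[OF g] and [measurable] = f
  have e: "\<mu>1 = distr (density \<gamma> (\<lambda>p. ennreal ((snd (fst p))\<^sup>2))) borel (\<lambda>p. fst (fst p))"
     "\<mu>2 = distr (density \<gamma> (\<lambda>p. ennreal ((snd (snd p))\<^sup>2))) borel (\<lambda>p. fst (snd p))"
    using \<gamma> by (auto simp: hplan_def)
  show "(\<integral>\<^sup>+p. ennreal ((snd (fst p))\<^sup>2) * f (fst (fst p)) \<partial>\<gamma>) = (\<integral>\<^sup>+x. f x \<partial>\<mu>1)"
    unfolding e(1) by (simp add: nn_integral_distr nn_integral_density)
  show "(\<integral>\<^sup>+p. ennreal ((snd (snd p))\<^sup>2) * f (fst (snd p)) \<partial>\<gamma>) = (\<integral>\<^sup>+x. f x \<partial>\<mu>2)"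
    unfolding e(2) by (simp add: nn_integral_distr nn_integral_density)
qed

lemma
  fixes f :: "'a::euclidean_space \<Rightarrow> real"
  assumes \<gamma>: "hplan \<gamma> \<mu>1 \<mu>2" and f: "f \<in> borel_measurable borel"
  shows hplan_integrable1: "integrable \<gamma> (\<lambda>p. (snd (fst p))\<^sup>2 * f (fst (fst p))) \<longleftrightarrow> integrable \<mu>1 f"
    and hplan_integrable2: "integrable \<gamma> (\<lambda>p. (snd (snd p))\<^sup>2 * f (fst (snd p))) \<longleftrightarrow> integrable \<mu>2 f"
    and hplan_integral1: "(\<integral>p. (snd (fst p))\<^sup>2 * f (fst (fst p)) \<partial>\<gamma>) = (\<integral>x. f x \<partial>\<mu>1)"
    and hplan_integral2: "(\<integral>p. (snd (snd p))\<^sup>2 * f (fst (snd p)) \<partial>\<gamma>) = (\<integral>x. f x \<partial>\<mu>2)"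
proof -
  have g: "fin_meas \<gamma>" using \<gamma> by (simp add: hplan_def)
  note [measurable_cong] = sets_fin_meas[OF g] and [measurable] = f
  have e: "\<mu>1 = distr (density \<gamma> (\<lambda>p. ennreal ((snd (fst p))\<^sup>2))) borel (\<lambda>p. fst (fst p))"
     "\<mu>2 = distr (density \<gamma> (\<lambda>p. ennreal ((snd (snd p))\<^sup>2))) borel (\<lambda>p. fst (snd p))"
    using \<gamma> by (auto simp: hplan_def)
  show "integrable \<gamma> (\<lambda>p. (snd (fst p))\<^sup>2 * f (fst (fst p))) \<longleftrightarrow> integrable \<mu>1 f"
    "(\<integral>p. (snd (fst p))\<^sup>2 * f (fst (fst p)) \<partial>\<gamma>) = (\<integral>x. f x \<partial>\<mu>1)"
    unfolding e(1) by (simp_all add: integrable_distr_eq integrable_density integral_distr integral_density)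
  show "integrable \<gamma> (\<lambda>p. (snd (snd p))\<^sup>2 * f (fst (snd p))) \<longleftrightarrow> integrable \<mu>2 f"
    "(\<integral>p. (snd (snd p))\<^sup>2 * f (fst (snd p)) \<partial>\<gamma>) = (\<integral>x. f x \<partial>\<mu>2)"
    unfolding e(2) by (simp_all add: integrable_distr_eq integrable_density integral_distr integral_density)
qed

section \<open>Symmetry of the distance, superposition of plans, finiteness of the cost\<close>

lemma HK2_commute_le:
  assumes "\<Sigma> > 0" "fin_meas \<mu>1" "fin_meas \<mu>2"
  shows "HK2 \<Lambda> \<Sigma> \<mu>2 \<mu>1 \<le> HK2 \<Lambda> \<Sigma> \<mu>1 \<mu>2"
proof (rule dense_ge)
  fix c assume "HK2 \<Lambda> \<Sigma> \<mu>1 \<mu>2 < c"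
  then obtain \<gamma> where \<gamma>: "hplan \<gamma> \<mu>1 \<mu>2" "cost \<Lambda> \<Sigma> \<gamma> < c" by (rule HK2_less_plan)
  have g: "fin_meas \<gamma>" using \<gamma> by (simp add: hplan_def)
  note [measurable_cong] = sets_fin_meas[OF g]
  have "HK2 \<Lambda> \<Sigma> \<mu>2 \<mu>1 \<le> (\<integral>\<^sup>+p. ennreal ((dC \<Lambda> \<Sigma> (fst (snd p), snd (snd p)) (fst (fst p), snd (fst p)))\<^sup>2) \<partial>\<gamma>)"
    using \<gamma>(1) assms by (intro HK2_le_param) (auto simp: hplan_def fin_meas_def)
  also have "\<dots> = cost \<Lambda> \<Sigma> \<gamma>" by (simp add: cost_def dC_commute)
  finally show "HK2 \<Lambda> \<Sigma> \<mu>2 \<mu>1 \<le> c" using \<gamma>(2) by simp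
qed

lemma hplan_add:
  assumes 1: "hplan \<gamma>1 \<mu>1 \<mu>2" and 2: "hplan \<gamma>2 \<nu>1 \<nu>2"
  shows "hplan (add_measure \<gamma>1 \<gamma>2) (add_measure \<mu>1 \<nu>1) (add_measure \<mu>2 \<nu>2)"
proof -
  have g: "fin_meas \<gamma>1" "fin_meas \<gamma>2" using 1 2 by (auto simp: hplan_def)
  then have s: "sets \<gamma>1 = sets borel" "sets \<gamma>2 = sets borel" by (auto simp: fin_meas_def)
  note [measurable_cong] = sets_fin_meas[OF g(1)] sets_fin_meas[OF g(2)]
  have [measurable_cong]: "sets (add_measure \<gamma>1 \<gamma>2) = sets borel" using s by simp
  have s': "sets \<gamma>2 = sets \<gamma>1" using s by simp
  have \<mu>: "sets \<mu>1 = sets borel" "sets \<mu>2 = sets borel" "sets \<nu>1 = sets borel" "sets \<nu>2 = sets borel"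
    using 1 2 by (auto simp: hplan_def)
  have "emeasure \<gamma>1 UNIV < \<infinity>" "emeasure \<gamma>2 UNIV < \<infinity>"
    using g by (auto simp: fin_meas_def less_top[symmetric] finite_measure.emeasure_finite)
  then have "finite_measure (add_measure \<gamma>1 \<gamma>2)"
    using s by (intro finite_measureI) (auto simp: emeasure_add_measure sets_eq_imp_space_eq[OF s(1)])
  moreover have "distr (density (add_measure \<gamma>1 \<gamma>2) (\<lambda>p. ennreal ((snd (fst p))\<^sup>2))) borel (\<lambda>p. fst (fst p)) = add_measure \<mu>1 \<nu>1"
  proof (rule measure_eqI)
    fix A :: "'a set" assume "A \<in> sets (distr (density (add_measure \<gamma>1 \<gamma>2) (\<lambda>p. ennreal ((snd (fst p))\<^sup>2))) borel (\<lambda>p. fst (fst p)))"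
    then have [measurable]: "A \<in> sets borel" by simp
    show "emeasure (distr (density (add_measure \<gamma>1 \<gamma>2) (\<lambda>p. ennreal ((snd (fst p))\<^sup>2))) borel (\<lambda>p. fst (fst p))) A = emeasure (add_measure \<mu>1 \<nu>1) A"
      using \<mu> hplan_nn_integral1[OF 1, of "indicator A"] hplan_nn_integral1[OF 2, of "indicator A"]
      by (simp add: emeasure_homogeneous_marginal emeasure_add_measure nn_integral_add_measure[OF s'])
  qed (use \<mu> in simp)
  moreover have "distr (density (add_measure \<gamma>1 \<gamma>2) (\<lambda>p. ennreal ((snd (snd p))\<^sup>2))) borel (\<lambda>p. fst (snd p)) = add_measure \<mu>2 \<nu>2"
  proof (rule measure_eqI)
    fix A :: "'a set" assume "A \<in> sets (distr (density (add_measure \<gamma>1 \<gamma>2) (\<lambda>p. ennreal ((snd (snd p))\<^sup>2))) borel (\<lambda>p. fst (snd p)))"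
    then have [measurable]: "A \<in> sets borel" by simp
    show "emeasure (distr (density (add_measure \<gamma>1 \<gamma>2) (\<lambda>p. ennreal ((snd (snd p))\<^sup>2))) borel (\<lambda>p. fst (snd p))) A = emeasure (add_measure \<mu>2 \<nu>2) A"
      using \<mu> hplan_nn_integral2[OF 1, of "indicator A"] hplan_nn_integral2[OF 2, of "indicator A"]
      by (simp add: emeasure_homogeneous_marginal emeasure_add_measure nn_integral_add_measure[OF s'])
  qed (use \<mu> in simp)
  ultimately show ?thesis
    using 1 2 s s' by (auto simp: hplan_def fin_meas_def intro!: AE_add_measure)
qed

text \<open>Destruction and creation of mass as plans: [x, 1] is paired with the vertex, whose
  radius 0 makes the opposite homogeneous marginal the null measure.\<close>

lemma hplan_to_vertex:
  assumes "fin_meas \<rho>"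
  shows "hplan (distr \<rho> borel (\<lambda>x. ((x, 1), (0, 0)))) \<rho> (null_measure borel)"
    "hplan (distr \<rho> borel (\<lambda>x. ((0, 0), (x, 1)))) (null_measure borel) \<rho>"
proof -
  note [measurable_cong] = sets_fin_meas[OF assms]
  have s: "sets \<rho> = sets borel" "finite_measure \<rho>" using assms by (auto simp: fin_meas_def)
  have 1[measurable]: "(\<lambda>x::'a. ((x, 1::real), (0::'a, 0::real))) \<in> borel_measurable borel"
    "(\<lambda>x::'a. ((0::'a, 0::real), (x, 1::real))) \<in> borel_measurable borel"
    by (intro borel_measurable_Pair; simp)+
  have f: "finite_measure (distr \<rho> borel (\<lambda>x::'a. ((x, 1::real), (0::'a, 0::real))))"
     "finite_measure (distr \<rho> borel (\<lambda>x::'a. ((0::'a, 0::real), (x, 1::real))))"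
    by (rule finite_measure.finite_measure_distr[OF s(2)]; simp)+
  have "distr (density (distr \<rho> borel (\<lambda>x. ((x, 1::real), (0::'a, 0::real)))) (\<lambda>p. ennreal ((snd (fst p))\<^sup>2))) borel (\<lambda>p. fst (fst p)) = \<rho>"
    "distr (density (distr \<rho> borel (\<lambda>x. ((x, 1::real), (0::'a, 0::real)))) (\<lambda>p. ennreal ((snd (snd p))\<^sup>2))) borel (\<lambda>p. fst (snd p)) = null_measure borel"
    "distr (density (distr \<rho> borel (\<lambda>x. ((0::'a, 0::real), (x, 1::real)))) (\<lambda>p. ennreal ((snd (fst p))\<^sup>2))) borel (\<lambda>p. fst (fst p)) = null_measure borel"
    "distr (density (distr \<rho> borel (\<lambda>x. ((0::'a, 0::real), (x, 1::real)))) (\<lambda>p. ennreal ((snd (snd p))\<^sup>2))) borel (\<lambda>p. fst (snd p)) = \<rho>"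
    by (rule measure_eqI; simp add: s emeasure_homogeneous_marginal nn_integral_distr)+
  then show "hplan (distr \<rho> borel (\<lambda>x. ((x, 1), (0, 0)))) \<rho> (null_measure borel)"
    "hplan (distr \<rho> borel (\<lambda>x. ((0, 0), (x, 1)))) (null_measure borel) \<rho>"
    unfolding hplan_def using f by (simp_all add: fin_meas_def AE_distr_iff)
qed

lemma hplan_cost_finite:
  assumes "\<Sigma> > 0" and \<gamma>: "hplan \<gamma> \<mu>1 \<mu>2" and fin: "fin_meas \<mu>1" "fin_meas \<mu>2"
  shows "integrable \<gamma> (\<lambda>p. (snd (fst p))\<^sup>2)" "integrable \<gamma> (\<lambda>p. (snd (snd p))\<^sup>2)"
    "integrable \<gamma> (\<lambda>p. (dC \<Lambda> \<Sigma> (fst p) (snd p))\<^sup>2)"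
    "cost \<Lambda> \<Sigma> \<gamma> = ennreal (\<integral>p. (dC \<Lambda> \<Sigma> (fst p) (snd p))\<^sup>2 \<partial>\<gamma>)"
proof -
  have g: "fin_meas \<gamma>" using \<gamma> by (simp add: hplan_def)
  note [measurable_cong] = sets_fin_meas[OF g]
  have c: "integrable \<mu>1 (\<lambda>x. 1::real)" "integrable \<mu>2 (\<lambda>x. 1::real)"
    using fin by (auto simp: fin_meas_def finite_measure.integrable_const)
  have "integrable \<gamma> (\<lambda>p. (snd (fst p))\<^sup>2 * 1)" "integrable \<gamma> (\<lambda>p. (snd (snd p))\<^sup>2 * 1)"
    by (rule iffD2[OF hplan_integrable1[OF \<gamma> borel_measurable_const] c(1)]
        iffD2[OF hplan_integrable2[OF \<gamma> borel_measurable_const] c(2)])+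
  then show i: "integrable \<gamma> (\<lambda>p. (snd (fst p))\<^sup>2)" "integrable \<gamma> (\<lambda>p. (snd (snd p))\<^sup>2)"
    by (simp_all only: mult_1_right)
  have "integrable \<gamma> (\<lambda>p. 8 / \<Sigma> * ((snd (fst p))\<^sup>2 + (snd (snd p))\<^sup>2))" using i by auto
  then show "integrable \<gamma> (\<lambda>p. (dC \<Lambda> \<Sigma> (fst p) (snd p))\<^sup>2)"
  proof (rule Bochner_Integration.integrable_bound)
    have "norm ((dC \<Lambda> \<Sigma> (fst p) (snd p))\<^sup>2) \<le> norm (8 / \<Sigma> * ((snd (fst p))\<^sup>2 + (snd (snd p))\<^sup>2))"
      for p :: "('a \<times> real) \<times> ('a \<times> real)"
      using order_trans[OF dC_le_add[OF assms(1), of \<Lambda> "fst p" "snd p"] abs_ge_self] by simp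
    then show "AE p in \<gamma>. norm ((dC \<Lambda> \<Sigma> (fst p) (snd p))\<^sup>2) \<le> norm (8 / \<Sigma> * ((snd (fst p))\<^sup>2 + (snd (snd p))\<^sup>2))"
      by (rule AE_I2)
  qed measurable
  then show "cost \<Lambda> \<Sigma> \<gamma> = ennreal (\<integral>p. (dC \<Lambda> \<Sigma> (fst p) (snd p))\<^sup>2 \<partial>\<gamma>)"
    unfolding cost_def by (intro nn_integral_eq_integral) auto
qed

lemma HK2_le_cost:
  assumes "\<Sigma> > 0" "hplan \<gamma> \<mu>1 \<mu>2" "fin_meas \<mu>1" "fin_meas \<mu>2"
  shows "HK2 \<Lambda> \<Sigma> \<mu>1 \<mu>2 \<le> cost \<Lambda> \<Sigma> \<gamma>"
proof -
  have g: "fin_meas \<gamma>" using assms by (simp add: hplan_def)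
  note [measurable_cong] = sets_fin_meas[OF g]
  have "HK2 \<Lambda> \<Sigma> \<mu>1 \<mu>2 \<le> (\<integral>\<^sup>+p. ennreal ((dC \<Lambda> \<Sigma> (fst (fst p), snd (fst p)) (fst (snd p), snd (snd p)))\<^sup>2) \<partial>\<gamma>)"
    using assms by (intro HK2_le_param) (auto simp: hplan_def fin_meas_def)
  then show ?thesis by (simp add: cost_def)
qed

lemma add_null_measure:
  assumes "sets M = sets borel"
  shows "add_measure M (null_measure borel) = M" "add_measure (null_measure borel) M = M"
  by (rule measure_eqI; simp add: assms emeasure_add_measure)+

text \<open>Routing all mass of both measures through the vertex is a plan of finite cost.
  Finiteness is what makes \<open>enn2real\<close> in the definition of \<open>HK\<close>
  faithful.\<close>

lemma HK2_finite:
  assumes "\<Sigma> > 0" "fin_meas \<mu>1" "fin_meas \<mu>2"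
  shows "HK2 \<Lambda> \<Sigma> \<mu>1 \<mu>2 < \<infinity>"
proof -
  have "hplan (add_measure (distr \<mu>1 borel (\<lambda>x. ((x, 1), (0, 0)))) (distr \<mu>2 borel (\<lambda>x. ((0, 0), (x, 1))))) \<mu>1 \<mu>2" (is "hplan ?\<gamma> _ _")
    using hplan_add[OF hplan_to_vertex(1)[OF assms(2)] hplan_to_vertex(2)[OF assms(3)]] assms
    by (simp add: add_null_measure fin_meas_def)
  from HK2_le_cost[OF assms(1) this assms(2,3), of \<Lambda>] hplan_cost_finite(4)[OF assms(1) this assms(2,3), of \<Lambda>]
  show ?thesis by (simp add: le_less_trans)
qed

lemma HK_sq:
  assumes "\<Sigma> > 0" "fin_meas \<mu>1" "fin_meas \<mu>2"
  shows "ennreal ((HK \<Lambda> \<Sigma> \<mu>1 \<mu>2)\<^sup>2) = HK2 \<Lambda> \<Sigma> \<mu>1 \<mu>2"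
  using HK2_finite[OF assms] by (simp add: HK_def)

section \<open>Gluing plans\<close>

lemma young_square:
  fixes s t \<delta> :: real
  assumes "\<delta> > 0"
  shows "(s + t)\<^sup>2 \<le> (1 + \<delta>) * s\<^sup>2 + (1 + 1 / \<delta>) * t\<^sup>2"
proof -
  have "0 \<le> (\<delta> * s - t)\<^sup>2 / \<delta>" using assms by simp
  also have "(\<delta> * s - t)\<^sup>2 / \<delta> = \<delta> * s\<^sup>2 - 2 * s * t + t\<^sup>2 / \<delta>"
    using assms by (simp add: power2_eq_square field_simps)
  finally show ?thesis by (simp add: power2_sum algebra_simps)
qed

text \<open>Young with parameter \<delta> splits off the last leg, then Young with parameter \<eta>
  itself splits off the small leg b \<eta>: its coefficient (1 + 1/\<eta>) \<eta>^2 = \<eta> +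
  \<eta>^2 still vanishes with \<eta>.\<close>

lemma young_square3:
  fixes a b c \<delta> \<eta> :: real
  assumes "\<delta> > 0" "\<eta> > 0" "0 \<le> D" "D \<le> a + b * \<eta> + c"
  shows "D\<^sup>2 \<le> (1 + \<delta>) * (1 + \<eta>) * a\<^sup>2 + (1 + \<delta>) * (\<eta> + \<eta>\<^sup>2) * b\<^sup>2 + (1 + 1 / \<delta>) * c\<^sup>2"
proof -
  have "D\<^sup>2 \<le> ((a + b * \<eta>) + c)\<^sup>2" using assms by (intro power_mono) auto
  also have "\<dots> \<le> (1 + \<delta>) * (a + b * \<eta>)\<^sup>2 + (1 + 1 / \<delta>) * c\<^sup>2" by (rule young_square) fact
  also have "(1 + \<delta>) * (a + b * \<eta>)\<^sup>2 \<le> (1 + \<delta>) * ((1 + \<eta>) * a\<^sup>2 + (1 + 1 / \<eta>) * (b * \<eta>)\<^sup>2)"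
    using assms by (intro mult_left_mono young_square) auto
  also have "(1 + 1 / \<eta>) * (b * \<eta>)\<^sup>2 = (\<eta> + \<eta>\<^sup>2) * b\<^sup>2"
    using assms by (simp add: power2_eq_square field_simps)
  finally show ?thesis by (simp add: algebra_simps)
qed

text \<open>For equal radii the squared distance is (8/\<Sigma>) r^2 (1 - ccos a), and 1 - ccos a <=
  a^2 / 2 with a^2 = \<Sigma> |x - y|^2 / (4 \<Lambda>). Measuring |x - y| in units of sqrt
  \<Lambda> makes the constant 1.\<close>

lemma dC_same_radius:
  assumes "\<Lambda> > 0" "\<Sigma> > 0" "0 \<le> r" "norm (x - y) \<le> \<eta> * sqrt \<Lambda>" "0 \<le> \<eta>"
  shows "dC \<Lambda> \<Sigma> (x, r) (y, r) \<le> r * \<eta>"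
proof (rule power2_le_imp_le)
  let ?a = "sqrt (\<Sigma> / (4 * \<Lambda>)) * norm (x - y)"
  have "(norm (x - y))\<^sup>2 \<le> (\<eta> * sqrt \<Lambda>)\<^sup>2" using assms by (intro power_mono) auto
  then have n: "(norm (x - y))\<^sup>2 \<le> \<eta>\<^sup>2 * \<Lambda>" using assms by (simp add: power_mult_distrib)
  have "1 - ccos ?a \<le> ?a\<^sup>2 / 2" using assms by (intro one_minus_ccos_le) auto
  also have "\<dots> = \<Sigma> / (8 * \<Lambda>) * (norm (x - y))\<^sup>2" using assms by (simp add: power_mult_distrib)
  also have "\<dots> \<le> \<Sigma> / (8 * \<Lambda>) * (\<eta>\<^sup>2 * \<Lambda>)" using assms by (intro mult_left_mono n) auto
  also have "\<dots> = \<Sigma> / 8 * \<eta>\<^sup>2" using assms by simp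
  finally have "8 / \<Sigma> * r\<^sup>2 * (1 - ccos ?a) \<le> 8 / \<Sigma> * r\<^sup>2 * (\<Sigma> / 8 * \<eta>\<^sup>2)"
    using assms by (intro mult_left_mono) auto
  also have "\<dots> = (r * \<eta>)\<^sup>2" using assms by (simp add: power_mult_distrib)
  also have "8 / \<Sigma> * r\<^sup>2 * (1 - ccos ?a) = (dC \<Lambda> \<Sigma> (x, r) (y, r))\<^sup>2"
    unfolding dC_sq[OF assms(2)] by (simp add: power2_eq_square algebra_simps diff_divide_distrib)
  finally show "(dC \<Lambda> \<Sigma> (x, r) (y, r))\<^sup>2 \<le> (r * \<eta>)\<^sup>2" .
qed (use assms in auto)

text \<open>The index of a point is that of the first member of a countable dense sequence at
  distance less than \<eta>/2; two points sharing it are within \<eta> of each other.\<close>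

lemma small_cells:
  fixes \<eta> :: real
  assumes "\<eta> > 0"
  obtains \<iota> :: "'a::euclidean_space \<Rightarrow> nat"
  where "\<iota> \<in> measurable borel (count_space UNIV)" "\<And>x y. \<iota> x = \<iota> y \<Longrightarrow> norm (x - y) \<le> \<eta>"
proof -
  obtain Q :: "'a set" where Q: "countable Q" "\<And>X. open X \<Longrightarrow> X \<noteq> {} \<Longrightarrow> \<exists>d\<in>Q. d \<in> X"
    using countable_dense_setE by blast
  then have "Q \<noteq> {}" using Q(2)[of UNIV] by auto
  define q where "q = from_nat_into Q"
  have ex: "\<exists>n. dist x (q n) < \<eta> / 2" for x
  proof -
    obtain d where "d \<in> Q" "d \<in> ball x (\<eta> / 2)" using Q(2)[of "ball x (\<eta> / 2)"] assms by auto
    moreover then obtain n where "d = q n" using Q(1) from_nat_into_surj unfolding q_def by metis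
    ultimately show ?thesis by auto
  qed
  define \<iota> where "\<iota> = (\<lambda>x. LEAST n. dist x (q n) < \<eta> / 2)"
  have \<iota>: "dist x (q (\<iota> x)) < \<eta> / 2" for x unfolding \<iota>_def by (rule LeastI_ex[OF ex])
  show ?thesis
  proof (rule that)
    show "\<iota> \<in> measurable borel (count_space UNIV)" unfolding \<iota>_def by measurable
    fix x y assume "\<iota> x = \<iota> y"
    then show "norm (x - y) \<le> \<eta>" using \<iota>[of x] \<iota>[of y] dist_triangle2[of x y "q (\<iota> x)"]
      by (simp add: dist_norm)
  qed
qed

text \<open>Instead of disintegrating along the middle marginal, couple independently inside each small cell of the middle
  space, and move from one middle point to the other within the cell at cost at most $\eta$ times the radius.  The radii are
  made compatible by multiplying each side with the middle radius of the other.  Cells of zero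
  $\mu_2$-mass only carry middle points at the vertex.\<close>
lemma HK2_glue_plans:
  fixes \<mu>1 \<mu>2 \<mu>3 :: "'a::euclidean_space measure"
  assumes \<Lambda>: "\<Lambda> > 0" and \<Sigma>: "\<Sigma> > 0" and \<delta>: "\<delta> > 0" and \<eta>: "\<eta> > 0"
    and fin: "fin_meas \<mu>1" "fin_meas \<mu>2" "fin_meas \<mu>3"
    and G: "hplan G \<mu>1 \<mu>2" and H: "hplan H \<mu>2 \<mu>3"
  shows "HK2 \<Lambda> \<Sigma> \<mu>1 \<mu>3 \<le> ennreal ((1 + \<delta>) * (1 + \<eta>)) * cost \<Lambda> \<Sigma> G
      + ennreal ((1 + \<delta>) * (\<eta> + \<eta>\<^sup>2)) * emeasure \<mu>2 UNIV + ennreal (1 + 1 / \<delta>) * cost \<Lambda> \<Sigma> H"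
proof -
  have sG[measurable_cong]: "sets G = sets borel" and sH[measurable_cong]: "sets H = sets borel"
    using hplanD(1)[OF G] hplanD(1)[OF H] by auto
  have s2[measurable_cong]: "sets \<mu>2 = sets borel" using fin by (simp add: fin_meas_def)
  interpret G: finite_measure G by (rule hplanD(2)[OF G])
  interpret H: finite_measure H by (rule hplanD(2)[OF H])
  interpret GH: pair_sigma_finite G H ..
  interpret \<mu>2: finite_measure \<mu>2 using fin by (simp add: fin_meas_def)
  have "\<eta> * sqrt \<Lambda> > 0" using \<eta> \<Lambda> by simp
  then obtain \<iota> :: "'a \<Rightarrow> nat" where \<iota>[measurable]: "\<iota> \<in> measurable borel (count_space UNIV)"
    and cell: "\<And>x y. \<iota> x = \<iota> y \<Longrightarrow> norm (x - y) \<le> \<eta> * sqrt \<Lambda>" by (rule small_cells) blast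
  define m where "m = (\<lambda>x. measure \<mu>2 {y. \<iota> y = \<iota> x})"
  \<comment> \<open>A real-valued copy of the cell index, so that lying in the same cell is a
    comparison of Borel functions.\<close>
  define j where "j = (\<lambda>x. real (\<iota> x))"
  have jm[measurable]: "j \<in> borel_measurable borel" unfolding j_def by measurable
  have mm[measurable]: "m \<in> borel_measurable borel"
    using measurable_compose[OF \<iota>, of "\<lambda>i. measure \<mu>2 {y. \<iota> y = i}" borel] by (simp add: m_def)
  have cell_sets[measurable]: "{y. \<iota> y = \<iota> x} \<in> sets borel" for x
    using measurable_sets[OF \<iota>, of "{\<iota> x}"] by (simp add: vimage_def)
  \<comment> \<open>Density of the independent coupling inside each cell, normalised by the cell
    mass. In a cell of zero mass 1 / 0 = 0, so \<open>W\<close> vanishes there and its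
    \<open>\<mu>2\<close>-integral is \<open>good\<close> instead of 1.\<close>
  define W where "W = (\<lambda>x y. if j x = j y then ennreal (1 / m x) else 0)"
  have Wm[measurable (raw)]: "(\<lambda>z. W (f z) (g z)) \<in> borel_measurable N"
    if [measurable]: "f \<in> borel_measurable N" "g \<in> borel_measurable N" for f g and N :: "'c measure"
    unfolding W_def by measurable
  have m_eq: "m x = m y" if "j x = j y" for x y using that by (simp add: j_def m_def)
  have Wsym: "W x y = W y x" for x y using m_eq[of x y] by (auto simp: W_def)
  define good where "good = (\<lambda>x. if m x = 0 then 0 else 1 :: ennreal)"
  define bad where "bad = (\<lambda>x. if m x = 0 then 1 else 0 :: ennreal)"
  have [measurable]: "good \<in> borel_measurable borel" "bad \<in> borel_measurable borel"
    unfolding good_def bad_def by measurable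
  have gb: "good x + bad x = 1" for x by (simp add: good_def bad_def)
  have intW: "(\<integral>\<^sup>+y. W x y \<partial>\<mu>2) = good x" for x
  proof -
    have "(\<integral>\<^sup>+y. W x y \<partial>\<mu>2) = (\<integral>\<^sup>+y. ennreal (1 / m x) * indicator {y. \<iota> y = \<iota> x} y \<partial>\<mu>2)"
      by (intro nn_integral_cong) (auto simp: W_def j_def)
    also have "\<dots> = ennreal (1 / m x) * emeasure \<mu>2 {y. \<iota> y = \<iota> x}"
      using s2 by (intro nn_integral_cmult_indicator) auto
    also have "emeasure \<mu>2 {y. \<iota> y = \<iota> x} = ennreal (m x)"
      by (simp add: m_def \<mu>2.emeasure_eq_measure)
    also have "ennreal (1 / m x) * ennreal (m x) = good x"
      by (auto simp: good_def ennreal_mult''[symmetric] m_def)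
    finally show ?thesis .
  qed
  have intH: "(\<integral>\<^sup>+q. ennreal ((snd (fst q))\<^sup>2) * W x (fst (fst q)) \<partial>H) = good x" for x
    using hplan_nn_integral1[OF H, of "W x"] intW[of x] by simp
  have intG: "(\<integral>\<^sup>+p. ennreal ((snd (snd p))\<^sup>2) * W x (fst (snd p)) \<partial>G) = good x" for x
    using hplan_nn_integral2[OF G, of "W x"] intW[of x] by simp
  \<comment> \<open>There are countably many cells, so the union of those of zero mass is
    null.\<close>
  have "AE x in \<mu>2. \<forall>i. \<iota> x = i \<longrightarrow> m x \<noteq> 0"
    unfolding AE_all_countable
  proof
    fix i
    show "AE x in \<mu>2. \<iota> x = i \<longrightarrow> m x \<noteq> 0"
    proof (cases "\<exists>y. \<iota> y = i \<and> m y = 0")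
      case True
      then obtain y where y: "\<iota> y = i" "m y = 0" by auto
      then have "{x. \<iota> x = i} \<in> null_sets \<mu>2"
        using cell_sets[of y] s2 by (auto simp: null_sets_def m_def \<mu>2.emeasure_eq_measure)
      then show ?thesis by (rule AE_I') auto
    qed auto
  qed
  then have AEm: "AE x in \<mu>2. m x \<noteq> 0" by auto
  then have "(\<integral>\<^sup>+x. bad x \<partial>\<mu>2) = 0"
    by (subst nn_integral_0_iff_AE) (auto simp: bad_def)
  then have "(\<integral>\<^sup>+q. ennreal ((snd (fst q))\<^sup>2) * bad (fst (fst q)) \<partial>H) = 0"
    "(\<integral>\<^sup>+p. ennreal ((snd (snd p))\<^sup>2) * bad (fst (snd p)) \<partial>G) = 0"
    using hplan_nn_integral1[OF H, of bad] hplan_nn_integral2[OF G, of bad] by simp_all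
  then have "AE q in H. ennreal ((snd (fst q))\<^sup>2) * bad (fst (fst q)) = 0"
    "AE p in G. ennreal ((snd (snd p))\<^sup>2) * bad (fst (snd p)) = 0"
    by (simp_all add: nn_integral_0_iff_AE)
  \<comment> \<open>The r^2-weighted integral of \<open>bad\<close> over a plan is its
    \<open>\<mu>2\<close>-integral, which is 0: almost every middle point in a zero-mass cell has
    radius 0.\<close>
  then have badH: "AE q in H. m (fst (fst q)) = 0 \<longrightarrow> snd (fst q) = 0"
    and badG: "AE p in G. m (fst (snd p)) = 0 \<longrightarrow> snd (snd p) = 0"
    by (auto simp: bad_def)


  \<comment> \<open>Write r2 and r2' for the middle radii in \<open>G\<close> and \<open>H\<close>.
    Glued pairs get the radii r1 r2' and r3 r2, so that after rescaling both middle points have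
    radius r2 r2'. Absolute values make the radii nonnegative everywhere. Pairs with middle point in
    a zero-mass cell have their outer points paired with the vertex by \<open>?\<Psi>1\<close> and
    \<open>?\<Psi>2\<close>.\<close>
  let ?\<Phi> = "\<lambda>pq :: (('a \<times> real) \<times> ('a \<times> real)) \<times> (('a \<times> real) \<times> ('a \<times> real)). ((fst (fst (fst pq)), \<bar>snd (fst (fst pq))\<bar> * \<bar>snd (fst (snd pq))\<bar>),
      (fst (snd (snd pq)), \<bar>snd (snd (snd pq))\<bar> * \<bar>snd (snd (fst pq))\<bar>))"
  let ?\<Psi>1 = "\<lambda>p :: (('a \<times> real) \<times> ('a \<times> real)). ((fst (fst p), \<bar>snd (fst p)\<bar>), (0::'a, 0::real))"
  let ?\<Psi>2 = "\<lambda>q :: (('a \<times> real) \<times> ('a \<times> real)). ((0::'a, 0::real), (fst (snd q), \<bar>snd (snd q)\<bar>))"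
  define A where "A = distr (density (G \<Otimes>\<^sub>M H) (\<lambda>pq. W (fst (snd (fst pq))) (fst (fst (snd pq))))) borel ?\<Phi>"
  define B where "B = distr (density G (\<lambda>p. bad (fst (snd p)))) borel ?\<Psi>1"
  define C where "C = distr (density H (\<lambda>q. bad (fst (fst q)))) borel ?\<Psi>2"
  define Q where "Q = add_measure A (add_measure B C)"
  have sABC: "sets A = sets borel" "sets B = sets borel" "sets C = sets borel" by (auto simp: A_def B_def C_def)
  have sQ[measurable_cong]: "sets Q = sets borel" using sABC by (simp add: Q_def)
  have GHb: "sets (G \<Otimes>\<^sub>M H) = sets borel" using sets_pair_measure_cong[OF sG sH] by (simp only: borel_prod)
  note [measurable_cong] = GHb
  have \<Phi>[measurable]: "?\<Phi> \<in> borel_measurable borel" "?\<Psi>1 \<in> borel_measurable borel" "?\<Psi>2 \<in> borel_measurable borel"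
    by measurable
  have intQ: "(\<integral>\<^sup>+z. f z \<partial>Q) = (\<integral>\<^sup>+p. \<integral>\<^sup>+q. W (fst (snd p)) (fst (fst q)) * f (?\<Phi> (p, q)) \<partial>H \<partial>G)
      + ((\<integral>\<^sup>+p. bad (fst (snd p)) * f (?\<Psi>1 p) \<partial>G) + (\<integral>\<^sup>+q. bad (fst (fst q)) * f (?\<Psi>2 q) \<partial>H))"
    if [measurable]: "f \<in> borel_measurable borel" for f
  proof -
    have "(\<integral>\<^sup>+z. f z \<partial>A) = (\<integral>\<^sup>+pq. W (fst (snd (fst pq))) (fst (fst (snd pq))) * f (?\<Phi> pq) \<partial>(G \<Otimes>\<^sub>M H))"
      unfolding A_def by (subst nn_integral_distr, measurable, subst nn_integral_density) measurable
    also have "\<dots> = (\<integral>\<^sup>+p. \<integral>\<^sup>+q. W (fst (snd p)) (fst (fst q)) * f (?\<Phi> (p, q)) \<partial>H \<partial>G)"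
      by (subst H.nn_integral_fst[symmetric]) auto
    finally have 1: "(\<integral>\<^sup>+z. f z \<partial>A) = \<dots>" .
    have 2: "(\<integral>\<^sup>+z. f z \<partial>B) = (\<integral>\<^sup>+p. bad (fst (snd p)) * f (?\<Psi>1 p) \<partial>G)"
      unfolding B_def by (subst nn_integral_distr, measurable, subst nn_integral_density) measurable
    have 3: "(\<integral>\<^sup>+z. f z \<partial>C) = (\<integral>\<^sup>+q. bad (fst (fst q)) * f (?\<Psi>2 q) \<partial>H)"
      unfolding C_def by (subst nn_integral_distr, measurable, subst nn_integral_density) measurable
    have mA: "f \<in> borel_measurable A" "f \<in> borel_measurable B"
      using that sABC by (simp_all cong: measurable_cong_sets)
    show ?thesis unfolding Q_def using mA sABC by (simp add: nn_integral_add_measure 1 2 3)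
  qed

  have nn: "AE z in Q. 0 \<le> snd (fst z)" "AE z in Q. 0 \<le> snd (snd z)"
  proof -
    have "AE z in A. 0 \<le> snd (fst z) \<and> 0 \<le> snd (snd z)" "AE z in B. 0 \<le> snd (fst z) \<and> 0 \<le> snd (snd z)"
      "AE z in C. 0 \<le> snd (fst z) \<and> 0 \<le> snd (snd z)"
      unfolding A_def B_def C_def by (subst AE_distr_iff; simp)+
    then have "AE z in Q. 0 \<le> snd (fst z) \<and> 0 \<le> snd (snd z)"
      unfolding Q_def using sABC by (intro AE_add_measure) auto
    then show "AE z in Q. 0 \<le> snd (fst z)" "AE z in Q. 0 \<le> snd (snd z)" by auto
  qed

  have m1: "distr (density Q (\<lambda>z. ennreal ((snd (fst z))\<^sup>2))) borel (\<lambda>z. fst (fst z)) = \<mu>1"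
  proof (rule measure_eqI)
    fix E assume "E \<in> sets (distr (density Q (\<lambda>z. ennreal ((snd (fst z))\<^sup>2))) borel (\<lambda>z. fst (fst z)))"
    then have [measurable]: "E \<in> sets borel" by simp
    let ?g = "\<lambda>p. ennreal ((snd (fst p))\<^sup>2) * indicator E (fst (fst p))"
    have "emeasure (distr (density Q (\<lambda>z. ennreal ((snd (fst z))\<^sup>2))) borel (\<lambda>z. fst (fst z))) E = (\<integral>\<^sup>+z. ?g z \<partial>Q)"
      by (rule emeasure_homogeneous_marginal) auto
    also have "\<dots> = (\<integral>\<^sup>+p. \<integral>\<^sup>+q. ?g p * (ennreal ((snd (fst q))\<^sup>2) * W (fst (snd p)) (fst (fst q))) \<partial>H \<partial>G)
        + (\<integral>\<^sup>+p. ?g p * bad (fst (snd p)) \<partial>G)"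
      by (subst intQ) (auto simp: power_mult_distrib ennreal_mult ac_simps intro!: nn_integral_cong)
    \<comment> \<open>Integrating out \<open>q\<close> turns the factor r2'^2 W into
      \<open>good\<close>; the vertex part supplies \<open>bad\<close>, and the two weights add up
      to 1.\<close>
    also have "\<dots> = (\<integral>\<^sup>+p. ?g p * good (fst (snd p)) \<partial>G) + (\<integral>\<^sup>+p. ?g p * bad (fst (snd p)) \<partial>G)"
      by (subst nn_integral_cmult) (auto simp: intH)
    also have "\<dots> = (\<integral>\<^sup>+p. ?g p * good (fst (snd p)) + ?g p * bad (fst (snd p)) \<partial>G)"
      by (rule nn_integral_add[symmetric]) auto
    also have "\<dots> = (\<integral>\<^sup>+p. ?g p \<partial>G)"
      by (simp add: distrib_left[symmetric] gb)
    also have "\<dots> = emeasure \<mu>1 E"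
      using hplan_nn_integral1[OF G, of "indicator E"] fin(1) by (simp add: fin_meas_def)
    finally show "emeasure (distr (density Q (\<lambda>z. ennreal ((snd (fst z))\<^sup>2))) borel (\<lambda>z. fst (fst z))) E = emeasure \<mu>1 E" .
  qed (use fin in \<open>simp add: fin_meas_def\<close>)
  have m3: "distr (density Q (\<lambda>z. ennreal ((snd (snd z))\<^sup>2))) borel (\<lambda>z. fst (snd z)) = \<mu>3"
  proof (rule measure_eqI)
    fix E assume "E \<in> sets (distr (density Q (\<lambda>z. ennreal ((snd (snd z))\<^sup>2))) borel (\<lambda>z. fst (snd z)))"
    then have [measurable]: "E \<in> sets borel" by simp
    let ?g = "\<lambda>p. ennreal ((snd (snd p))\<^sup>2) * indicator E (fst (snd p))"
    have "emeasure (distr (density Q (\<lambda>z. ennreal ((snd (snd z))\<^sup>2))) borel (\<lambda>z. fst (snd z))) E = (\<integral>\<^sup>+z. ?g z \<partial>Q)"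
      by (rule emeasure_homogeneous_marginal) auto
    also have "\<dots> = (\<integral>\<^sup>+p. \<integral>\<^sup>+q. ?g q * (ennreal ((snd (snd p))\<^sup>2) * W (fst (fst q)) (fst (snd p))) \<partial>H \<partial>G)
        + (\<integral>\<^sup>+q. ?g q * bad (fst (fst q)) \<partial>H)"
      by (subst intQ) (auto simp: power_mult_distrib ennreal_mult ac_simps Wsym intro!: nn_integral_cong)
    also have "(\<integral>\<^sup>+p. \<integral>\<^sup>+q. ?g q * (ennreal ((snd (snd p))\<^sup>2) * W (fst (fst q)) (fst (snd p))) \<partial>H \<partial>G)
        = (\<integral>\<^sup>+q. \<integral>\<^sup>+p. ?g q * (ennreal ((snd (snd p))\<^sup>2) * W (fst (fst q)) (fst (snd p))) \<partial>G \<partial>H)"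
      by (rule GH.Fubini'[symmetric]) measurable
    also have "\<dots> = (\<integral>\<^sup>+q. ?g q * good (fst (fst q)) \<partial>H)"
      by (subst nn_integral_cmult) (auto simp: intG)
    also have "\<dots> + (\<integral>\<^sup>+q. ?g q * bad (fst (fst q)) \<partial>H) = (\<integral>\<^sup>+q. ?g q * good (fst (fst q)) + ?g q * bad (fst (fst q)) \<partial>H)"
      by (rule nn_integral_add[symmetric]) auto
    also have "\<dots> = (\<integral>\<^sup>+q. ?g q \<partial>H)"
      by (simp add: distrib_left[symmetric] gb)
    also have "\<dots> = emeasure \<mu>3 E"
      using hplan_nn_integral2[OF H, of "indicator E"] fin(3) by (simp add: fin_meas_def)
    finally show "emeasure (distr (density Q (\<lambda>z. ennreal ((snd (snd z))\<^sup>2))) borel (\<lambda>z. fst (snd z))) E = emeasure \<mu>3 E" .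
  qed (use fin in \<open>simp add: fin_meas_def\<close>)

  let ?d = "\<lambda>p. ennreal ((dC \<Lambda> \<Sigma> (fst p) (snd p))\<^sup>2)"
  define c1 where "c1 = ennreal ((1 + \<delta>) * (1 + \<eta>))"
  define c2 where "c2 = ennreal ((1 + \<delta>) * (\<eta> + \<eta>\<^sup>2))"
  define c3 where "c3 = ennreal (1 + 1 / \<delta>)"
  have "1 * 1 \<le> (1 + \<delta>) * (1 + \<eta>)" using \<delta> \<eta> by (intro mult_mono) auto
  then have c: "1 \<le> c1" "1 \<le> c3" using \<delta> by (auto simp: c1_def c3_def ennreal_1[symmetric] simp del: ennreal_1 intro!: ennreal_leI)
  have "HK2 \<Lambda> \<Sigma> \<mu>1 \<mu>3 \<le> (\<integral>\<^sup>+z. ennreal ((dC \<Lambda> \<Sigma> (fst (fst z), snd (fst z)) (fst (snd z), snd (snd z)))\<^sup>2) \<partial>Q)"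
    using fin by (intro HK2_le_param[OF \<Sigma>] nn m1 m3) (auto simp: fin_meas_def)
  also have "\<dots> = (\<integral>\<^sup>+z. ?d z \<partial>Q)" by simp
  also have "\<dots> = (\<integral>\<^sup>+p. \<integral>\<^sup>+q. W (fst (snd p)) (fst (fst q)) * ?d (?\<Phi> (p, q)) \<partial>H \<partial>G)
      + ((\<integral>\<^sup>+p. bad (fst (snd p)) * ?d (?\<Psi>1 p) \<partial>G) + (\<integral>\<^sup>+q. bad (fst (fst q)) * ?d (?\<Psi>2 q) \<partial>H))"
    by (rule intQ) measurable
  \<comment> \<open>On these pairs the old partner already has radius 0, so replacing it by (0, 0)
    leaves the distance unchanged.\<close>
  also have "(\<integral>\<^sup>+p. bad (fst (snd p)) * ?d (?\<Psi>1 p) \<partial>G) = (\<integral>\<^sup>+p. bad (fst (snd p)) * ?d p \<partial>G)"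
    using badG hplanD(3)[OF G]
    by (intro nn_integral_cong_AE) (auto elim!: eventually_elim2 simp: bad_def dC_sq[OF \<Sigma>])
  also have "(\<integral>\<^sup>+q. bad (fst (fst q)) * ?d (?\<Psi>2 q) \<partial>H) = (\<integral>\<^sup>+q. bad (fst (fst q)) * ?d q \<partial>H)"
    using badH hplanD(4)[OF H]
    by (intro nn_integral_cong_AE) (auto elim!: eventually_elim2 simp: bad_def dC_sq[OF \<Sigma>])
  finally have hk: "HK2 \<Lambda> \<Sigma> \<mu>1 \<mu>3 \<le> (\<integral>\<^sup>+p. \<integral>\<^sup>+q. W (fst (snd p)) (fst (fst q)) * ?d (?\<Phi> (p, q)) \<partial>H \<partial>G)
      + ((\<integral>\<^sup>+p. bad (fst (snd p)) * ?d p \<partial>G) + (\<integral>\<^sup>+q. bad (fst (fst q)) * ?d q \<partial>H))" .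
  have "(\<integral>\<^sup>+p. \<integral>\<^sup>+q. W (fst (snd p)) (fst (fst q)) * ?d (?\<Phi> (p, q)) \<partial>H \<partial>G)
      \<le> c1 * (\<integral>\<^sup>+p. good (fst (snd p)) * ?d p \<partial>G) + c2 * emeasure \<mu>2 UNIV + c3 * (\<integral>\<^sup>+q. good (fst (fst q)) * ?d q \<partial>H)"
  proof -
    have pt: "W (fst (snd p)) (fst (fst q)) * ?d (?\<Phi> (p, q))
        \<le> c1 * (?d p * (ennreal ((snd (fst q))\<^sup>2) * W (fst (snd p)) (fst (fst q))))
          + c2 * (ennreal ((snd (snd p))\<^sup>2) * (ennreal ((snd (fst q))\<^sup>2) * W (fst (snd p)) (fst (fst q))))
          + c3 * (?d q * (ennreal ((snd (snd p))\<^sup>2) * W (fst (fst q)) (fst (snd p))))"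
      if nn: "0 \<le> snd (fst p)" "0 \<le> snd (snd p)" "0 \<le> snd (fst q)" "0 \<le> snd (snd q)" for p q
    proof (cases "j (fst (snd p)) = j (fst (fst q))")
      case False
      then show ?thesis by (simp add: W_def)
    next
      case True
      obtain x1 r1 x2 r2 where p: "p = ((x1, r1), (x2, r2))" by (metis prod.collapse)
      obtain x2' r2' x3 r3 where q: "q = ((x2', r2'), (x3, r3))" by (metis prod.collapse)
      have r: "0 \<le> r1" "0 \<le> r2" "0 \<le> r2'" "0 \<le> r3" using nn by (auto simp: p q)
      let ?D = "dC \<Lambda> \<Sigma> (x1, r1 * r2') (x3, r3 * r2)"
      \<comment> \<open>The path is x1 -> x2 -> x2' -> x3: a rescaled pair of \<open>G\<close>, a
        short step inside the cell at radius r2 r2', a rescaled pair of \<open>H\<close>.\<close>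
      have "?D \<le> dC \<Lambda> \<Sigma> (x1, r1 * r2') (x2', r2 * r2') + dC \<Lambda> \<Sigma> (x2', r2 * r2') (x3, r3 * r2)"
        using r by (intro dC_triangle[OF \<Lambda> \<Sigma>]) auto
      also have "dC \<Lambda> \<Sigma> (x1, r1 * r2') (x2', r2 * r2') \<le>
          dC \<Lambda> \<Sigma> (x1, r1 * r2') (x2, r2 * r2') + dC \<Lambda> \<Sigma> (x2, r2 * r2') (x2', r2 * r2')"
        using r by (intro dC_triangle[OF \<Lambda> \<Sigma>]) auto
      also have "dC \<Lambda> \<Sigma> (x1, r1 * r2') (x2, r2 * r2') = r2' * dC \<Lambda> \<Sigma> (x1, r1) (x2, r2)"
        using dC_scale[OF \<Sigma> r(3), of \<Lambda> x1 r1 x2 r2] by (simp add: mult.commute)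
      also have "dC \<Lambda> \<Sigma> (x2', r2 * r2') (x3, r3 * r2) = r2 * dC \<Lambda> \<Sigma> (x2', r2') (x3, r3)"
        using dC_scale[OF \<Sigma> r(2), of \<Lambda> x2' r2' x3 r3] by (simp add: mult.commute)
      also have "dC \<Lambda> \<Sigma> (x2, r2 * r2') (x2', r2 * r2') \<le> (r2 * r2') * \<eta>"
        using True cell[of x2 x2'] r \<eta> by (intro dC_same_radius[OF \<Lambda> \<Sigma>]) (auto simp: p q j_def)
      finally have "?D \<le> r2' * dC \<Lambda> \<Sigma> (x1, r1) (x2, r2) + (r2 * r2') * \<eta> + r2 * dC \<Lambda> \<Sigma> (x2', r2') (x3, r3)" by simp
      from young_square3[OF \<delta> \<eta> dC_nonneg[OF \<Sigma>] this]
      have "ennreal (?D\<^sup>2) \<le> ennreal ((1 + \<delta>) * (1 + \<eta>) * (r2' * dC \<Lambda> \<Sigma> (x1, r1) (x2, r2))\<^sup>2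
          + (1 + \<delta>) * (\<eta> + \<eta>\<^sup>2) * (r2 * r2')\<^sup>2 + (1 + 1 / \<delta>) * (r2 * dC \<Lambda> \<Sigma> (x2', r2') (x3, r3))\<^sup>2)"
        by (rule ennreal_leI)
      also have "\<dots> = c1 * (?d p * ennreal (r2'\<^sup>2)) + c2 * (ennreal (r2\<^sup>2) * ennreal (r2'\<^sup>2)) + c3 * (?d q * ennreal (r2\<^sup>2))"
        using \<delta> \<eta> by (simp add: c1_def c2_def c3_def p q power_mult_distrib ennreal_mult[symmetric] ennreal_plus[symmetric] ac_simps
            del: ennreal_plus)
      finally have "W x2 x2' * ennreal (?D\<^sup>2) \<le> W x2 x2' * \<dots>" by (rule mult_left_mono) simp
      then show ?thesis using r Wsym[of x2' x2] by (simp add: p q distrib_left ac_simps)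
    qed
    have "(\<integral>\<^sup>+p. \<integral>\<^sup>+q. W (fst (snd p)) (fst (fst q)) * ?d (?\<Phi> (p, q)) \<partial>H \<partial>G)
      \<le> (\<integral>\<^sup>+p. \<integral>\<^sup>+q. c1 * (?d p * (ennreal ((snd (fst q))\<^sup>2) * W (fst (snd p)) (fst (fst q))))
          + c2 * (ennreal ((snd (snd p))\<^sup>2) * (ennreal ((snd (fst q))\<^sup>2) * W (fst (snd p)) (fst (fst q))))
          + c3 * (?d q * (ennreal ((snd (snd p))\<^sup>2) * W (fst (fst q)) (fst (snd p)))) \<partial>H \<partial>G)"
    proof (rule nn_integral_mono_AE)
      show "AE p in G. (\<integral>\<^sup>+q. W (fst (snd p)) (fst (fst q)) * ?d (?\<Phi> (p, q)) \<partial>H)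
        \<le> (\<integral>\<^sup>+q. c1 * (?d p * (ennreal ((snd (fst q))\<^sup>2) * W (fst (snd p)) (fst (fst q))))
          + c2 * (ennreal ((snd (snd p))\<^sup>2) * (ennreal ((snd (fst q))\<^sup>2) * W (fst (snd p)) (fst (fst q))))
          + c3 * (?d q * (ennreal ((snd (snd p))\<^sup>2) * W (fst (fst q)) (fst (snd p)))) \<partial>H)"
        using hplanD(3,4)[OF G]
      proof eventually_elim
        case p: (elim p)
        show ?case
        proof (rule nn_integral_mono_AE)
          show "AE q in H. W (fst (snd p)) (fst (fst q)) * ?d (?\<Phi> (p, q))
              \<le> c1 * (?d p * (ennreal ((snd (fst q))\<^sup>2) * W (fst (snd p)) (fst (fst q))))
          + c2 * (ennreal ((snd (snd p))\<^sup>2) * (ennreal ((snd (fst q))\<^sup>2) * W (fst (snd p)) (fst (fst q))))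
          + c3 * (?d q * (ennreal ((snd (snd p))\<^sup>2) * W (fst (fst q)) (fst (snd p))))"
            using hplanD(3,4)[OF H] by eventually_elim (rule pt[OF p])
        qed
      qed
    qed
    also have "\<dots> = (\<integral>\<^sup>+p. c1 * (?d p * good (fst (snd p))) + c2 * (ennreal ((snd (snd p))\<^sup>2) * good (fst (snd p)))
          + c3 * (\<integral>\<^sup>+q. ?d q * (ennreal ((snd (snd p))\<^sup>2) * W (fst (fst q)) (fst (snd p))) \<partial>H) \<partial>G)"
      by (simp add: nn_integral_add nn_integral_cmult intH)
    also have "\<dots> = c1 * (\<integral>\<^sup>+p. ?d p * good (fst (snd p)) \<partial>G) + c2 * (\<integral>\<^sup>+p. ennreal ((snd (snd p))\<^sup>2) * good (fst (snd p)) \<partial>G)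
        + c3 * (\<integral>\<^sup>+p. \<integral>\<^sup>+q. ?d q * (ennreal ((snd (snd p))\<^sup>2) * W (fst (fst q)) (fst (snd p))) \<partial>H \<partial>G)"
      by (simp add: nn_integral_add nn_integral_cmult)
    also have "(\<integral>\<^sup>+p. \<integral>\<^sup>+q. ?d q * (ennreal ((snd (snd p))\<^sup>2) * W (fst (fst q)) (fst (snd p))) \<partial>H \<partial>G)
        = (\<integral>\<^sup>+q. \<integral>\<^sup>+p. ?d q * (ennreal ((snd (snd p))\<^sup>2) * W (fst (fst q)) (fst (snd p))) \<partial>G \<partial>H)"
      by (rule GH.Fubini'[symmetric]) measurable
    also have "\<dots> = (\<integral>\<^sup>+q. ?d q * good (fst (fst q)) \<partial>H)"
      by (simp add: nn_integral_cmult intG)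
    finally have le: "(\<integral>\<^sup>+p. \<integral>\<^sup>+q. W (fst (snd p)) (fst (fst q)) * ?d (?\<Phi> (p, q)) \<partial>H \<partial>G)
      \<le> c1 * (\<integral>\<^sup>+p. ?d p * good (fst (snd p)) \<partial>G) + c2 * (\<integral>\<^sup>+p. ennreal ((snd (snd p))\<^sup>2) * good (fst (snd p)) \<partial>G)
        + c3 * (\<integral>\<^sup>+q. ?d q * good (fst (fst q)) \<partial>H)" .
    have "(\<integral>\<^sup>+p. ennreal ((snd (snd p))\<^sup>2) * good (fst (snd p)) \<partial>G) \<le> emeasure \<mu>2 UNIV"
    proof -
      have "(\<integral>\<^sup>+p. ennreal ((snd (snd p))\<^sup>2) * good (fst (snd p)) \<partial>G) = (\<integral>\<^sup>+x. good x \<partial>\<mu>2)"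
        by (rule hplan_nn_integral2[OF G]) simp
      also have "\<dots> \<le> (\<integral>\<^sup>+x. 1 \<partial>\<mu>2)" by (intro nn_integral_mono) (simp add: good_def)
      also have "\<dots> = emeasure \<mu>2 UNIV" using sets_eq_imp_space_eq[OF s2] by simp
      finally show ?thesis .
    qed
    then have "c1 * (\<integral>\<^sup>+p. ?d p * good (fst (snd p)) \<partial>G) + c2 * (\<integral>\<^sup>+p. ennreal ((snd (snd p))\<^sup>2) * good (fst (snd p)) \<partial>G)
        + c3 * (\<integral>\<^sup>+q. ?d q * good (fst (fst q)) \<partial>H)
      \<le> c1 * (\<integral>\<^sup>+p. ?d p * good (fst (snd p)) \<partial>G) + c2 * emeasure \<mu>2 UNIV + c3 * (\<integral>\<^sup>+q. ?d q * good (fst (fst q)) \<partial>H)"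
      by (intro add_mono mult_left_mono order_refl) auto
    from order_trans[OF le this] show ?thesis by (simp add: mult.commute)
  qed
  from order_trans[OF hk add_right_mono[OF this]]
  have "HK2 \<Lambda> \<Sigma> \<mu>1 \<mu>3 \<le> c1 * (\<integral>\<^sup>+p. good (fst (snd p)) * ?d p \<partial>G) + c2 * emeasure \<mu>2 UNIV
      + c3 * (\<integral>\<^sup>+q. good (fst (fst q)) * ?d q \<partial>H)
      + ((\<integral>\<^sup>+p. bad (fst (snd p)) * ?d p \<partial>G) + (\<integral>\<^sup>+q. bad (fst (fst q)) * ?d q \<partial>H))"
    .
  \<comment> \<open>The uncoupled pairs are charged with the same constants, which are at least 1,
    so that \<open>good\<close> and \<open>bad\<close> parts recombine into the full costs.\<close>
  also have "\<dots> \<le> c1 * (\<integral>\<^sup>+p. good (fst (snd p)) * ?d p \<partial>G) + c2 * emeasure \<mu>2 UNIV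
      + c3 * (\<integral>\<^sup>+q. good (fst (fst q)) * ?d q \<partial>H)
      + (c1 * (\<integral>\<^sup>+p. bad (fst (snd p)) * ?d p \<partial>G) + c3 * (\<integral>\<^sup>+q. bad (fst (fst q)) * ?d q \<partial>H))"
    using mult_right_mono[OF c(1), of "\<integral>\<^sup>+p. bad (fst (snd p)) * ?d p \<partial>G"]
      mult_right_mono[OF c(2), of "\<integral>\<^sup>+q. bad (fst (fst q)) * ?d q \<partial>H"] by (intro add_mono order_refl) simp_all
  also have "\<dots> = c1 * ((\<integral>\<^sup>+p. good (fst (snd p)) * ?d p \<partial>G) + (\<integral>\<^sup>+p. bad (fst (snd p)) * ?d p \<partial>G)) + c2 * emeasure \<mu>2 UNIV
      + c3 * ((\<integral>\<^sup>+q. good (fst (fst q)) * ?d q \<partial>H) + (\<integral>\<^sup>+q. bad (fst (fst q)) * ?d q \<partial>H))"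
    by (simp add: distrib_left ac_simps)
  also have "(\<integral>\<^sup>+p. good (fst (snd p)) * ?d p \<partial>G) + (\<integral>\<^sup>+p. bad (fst (snd p)) * ?d p \<partial>G) = cost \<Lambda> \<Sigma> G"
    by (simp add: nn_integral_add[symmetric] distrib_right[symmetric] gb cost_def)
  also have "(\<integral>\<^sup>+q. good (fst (fst q)) * ?d q \<partial>H) + (\<integral>\<^sup>+q. bad (fst (fst q)) * ?d q \<partial>H) = cost \<Lambda> \<Sigma> H"
    by (simp add: nn_integral_add[symmetric] distrib_right[symmetric] gb cost_def)
  finally show ?thesis by (simp add: c1_def c2_def c3_def)
qed

text \<open>Squared triangle inequality with a free weight. Plans with surplus \<eta> over the two
  infima are glued in cells of size proportional to \<eta>; as \<eta> -> 0 the cell error,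
  proportional to the mass of \<open>\<mu>2\<close>, disappears.\<close>

lemma HK2_glue:
  fixes \<mu>1 \<mu>2 \<mu>3 :: "'a::euclidean_space measure"
  assumes \<Lambda>: "\<Lambda> > 0" and \<Sigma>: "\<Sigma> > 0" and \<delta>: "\<delta> > 0"
    and fin: "fin_meas \<mu>1" "fin_meas \<mu>2" "fin_meas \<mu>3"
  shows "(HK \<Lambda> \<Sigma> \<mu>1 \<mu>3)\<^sup>2 \<le> (1 + \<delta>) * (HK \<Lambda> \<Sigma> \<mu>1 \<mu>2)\<^sup>2 + (1 + 1 / \<delta>) * (HK \<Lambda> \<Sigma> \<mu>2 \<mu>3)\<^sup>2"
proof -
  define a where "a = (HK \<Lambda> \<Sigma> \<mu>1 \<mu>2)\<^sup>2"
  define b where "b = (HK \<Lambda> \<Sigma> \<mu>2 \<mu>3)\<^sup>2"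
  define K where "K = measure \<mu>2 UNIV"
  have ab: "0 \<le> a" "0 \<le> b" "0 \<le> K" by (auto simp: a_def b_def K_def)
  let ?R = "\<lambda>\<eta>. (1 + \<delta>) * (1 + \<eta>) * (a + \<eta>) + (1 + \<delta>) * (\<eta> + \<eta>\<^sup>2) * K + (1 + 1 / \<delta>) * (b + \<eta>)"
  have "(HK \<Lambda> \<Sigma> \<mu>1 \<mu>3)\<^sup>2 \<le> ?R \<eta>" if \<eta>: "\<eta> > 0" for \<eta>
  proof -
    have "HK2 \<Lambda> \<Sigma> \<mu>1 \<mu>2 < ennreal (a + \<eta>)" "HK2 \<Lambda> \<Sigma> \<mu>2 \<mu>3 < ennreal (b + \<eta>)"
      using HK_sq[OF \<Sigma> fin(1,2), of \<Lambda>] HK_sq[OF \<Sigma> fin(2,3), of \<Lambda>] \<eta> ab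
      by (auto simp: a_def b_def ennreal_less_iff simp flip: HK_sq[OF \<Sigma> fin(1,2), of \<Lambda>] HK_sq[OF \<Sigma> fin(2,3), of \<Lambda>])
    then obtain G H where G: "hplan G \<mu>1 \<mu>2" "cost \<Lambda> \<Sigma> G < ennreal (a + \<eta>)"
      and H: "hplan H \<mu>2 \<mu>3" "cost \<Lambda> \<Sigma> H < ennreal (b + \<eta>)"
      by (metis HK2_less_plan)
    have K: "emeasure \<mu>2 UNIV = ennreal K"
      using fin(2) by (simp add: fin_meas_def K_def finite_measure.emeasure_eq_measure)
    have "ennreal ((HK \<Lambda> \<Sigma> \<mu>1 \<mu>3)\<^sup>2) \<le> ennreal ((1 + \<delta>) * (1 + \<eta>)) * cost \<Lambda> \<Sigma> G
      + ennreal ((1 + \<delta>) * (\<eta> + \<eta>\<^sup>2)) * emeasure \<mu>2 UNIV + ennreal (1 + 1 / \<delta>) * cost \<Lambda> \<Sigma> H"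
      unfolding HK_sq[OF \<Sigma> fin(1,3)] by (rule HK2_glue_plans) fact+
    also have "\<dots> \<le> ennreal ((1 + \<delta>) * (1 + \<eta>)) * ennreal (a + \<eta>)
      + ennreal ((1 + \<delta>) * (\<eta> + \<eta>\<^sup>2)) * ennreal K + ennreal (1 + 1 / \<delta>) * ennreal (b + \<eta>)"
      unfolding K using G H by (intro add_mono mult_left_mono) auto
    also have "\<dots> = ennreal (?R \<eta>)"
      using \<delta> \<eta> ab by (simp add: ennreal_mult[symmetric] ennreal_plus[symmetric] del: ennreal_plus)
    finally show ?thesis using \<delta> \<eta> ab by (subst (asm) ennreal_le_iff) auto
  qed
  then have ev: "\<forall>\<^sub>F \<eta> in at_right 0. (HK \<Lambda> \<Sigma> \<mu>1 \<mu>3)\<^sup>2 \<le> ?R \<eta>"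
    by (auto simp: eventually_at_right_field intro!: exI[of _ 1])
  have "((\<lambda>\<eta>. ?R \<eta>) \<longlongrightarrow> (1 + \<delta>) * (1 + 0) * (a + 0) + (1 + \<delta>) * (0 + 0\<^sup>2) * K + (1 + 1 / \<delta>) * (b + 0)) (at_right 0)"
    by (intro tendsto_intros)
  from tendsto_lowerbound[OF this ev] show ?thesis by (simp add: a_def b_def)
qed

section \<open>Moving one point of a pair\<close>

text \<open>sin a / a >= cos a because a cos a - sin a decreases from 0; then 1 - cos a <= a^2 / 2
  <= 2 a, the last step by a <= pi < 4.\<close>

lemma csinc_ge:
  assumes "0 \<le> a" "a \<le> pi"
  shows "1 - csinc a \<le> 2 * a"
proof (cases "a = 0")
  case False
  have "0 * cos 0 - sin 0 \<ge> a * cos a - sin a"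
  proof (rule DERIV_nonpos_imp_nonincreasing[OF assms(1)])
    fix x assume x: "0 \<le> x" "x \<le> a"
    have "((\<lambda>x. x * cos x - sin x) has_real_derivative - x * sin x) (at x)"
      by (auto intro!: derivative_eq_intros)
    moreover have "- x * sin x \<le> 0" using x assms by (auto intro!: sin_ge_zero mult_nonneg_nonneg)
    ultimately show "\<exists>y. ((\<lambda>x. x * cos x - sin x) has_real_derivative y) (at x) \<and> y \<le> 0" by blast
  qed
  then have "cos a \<le> csinc a" using False assms by (simp add: csinc_def field_simps)
  moreover have "1 - cos a \<le> a\<^sup>2 / 2" using one_minus_ccos_le[OF assms(1)] assms by (simp add: ccos_def)
  moreover have "a\<^sup>2 / 2 \<le> 2 * a"
  proof -
    have "a * a \<le> a * 4" using assms pi_less_4 by (intro mult_left_mono) auto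
    then show ?thesis by (simp add: power2_eq_square)
  qed
  ultimately show ?thesis by simp
qed (simp add: csinc_def)

text \<open>This is \<open>ccos_tangent\<close> in the squared angle k^2 |u|^2, which is exactly
  quadratic in u; its second-order part k^2 |p|^2 enters with \<open>csinc \<le> 1\<close>. The
  bound crosses the truncation at pi without a case distinction.\<close>

lemma ccos_norm_semiconvex:
  fixes u p :: "'a::euclidean_space"
  assumes "0 \<le> k"
  shows "ccos (k * norm (u + p)) \<ge> ccos (k * norm u) - k\<^sup>2 * csinc (k * norm u) * inner u p - k\<^sup>2 * (norm p)\<^sup>2 / 2"
proof -
  let ?s = "csinc (k * norm u)"
  have "(k * norm (u + p))\<^sup>2 - (k * norm u)\<^sup>2 = k\<^sup>2 * (2 * inner u p + (norm p)\<^sup>2)"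
    by (simp add: power_mult_distrib power2_norm_eq_inner inner_add inner_commute algebra_simps)
  then have "ccos (k * norm (u + p)) \<ge> ccos (k * norm u) - ?s * (k\<^sup>2 * (2 * inner u p + (norm p)\<^sup>2)) / 2"
    using ccos_tangent[of "k * norm u" "k * norm (u + p)"] assms by simp
  moreover have "?s * (k\<^sup>2 * (norm p)\<^sup>2) \<le> 1 * (k\<^sup>2 * (norm p)\<^sup>2)"
    using csinc_le_1[of "k * norm u"] assms by (intro mult_right_mono) auto
  ultimately show ?thesis by (simp add: algebra_simps add_divide_distrib)
qed

text \<open>The directional derivative of $z_1 \mapsto d(z_1,z_2)^2$ at $z_1 = [x_1,r_1]$ in direction
  $(\dot x_1,\dot r_1) = (\Lambda g, \frac\Sigma2 z r_1)$.\<close>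
definition dC_var :: "real \<Rightarrow> real \<Rightarrow> ('a::euclidean_space \<times> real) \<Rightarrow> ('a \<times> real) \<Rightarrow> 'a \<Rightarrow> real \<Rightarrow> real" where
  "dC_var \<Lambda> \<Sigma> p q g z = 4 * z * (snd p)\<^sup>2
     - 4 * z * snd p * snd q * ccos (sqrt (\<Sigma> / (4 * \<Lambda>)) * norm (fst p - fst q))
     + 2 * snd p * snd q * csinc (sqrt (\<Sigma> / (4 * \<Lambda>)) * norm (fst p - fst q)) * inner (fst p - fst q) g"

text \<open>The radial factor is polynomial in h, so only the cosine calls for an inequality. Its
  lower bound enters with the weight -(8/\<Sigma>) r1 r2 (1 + h \<Sigma> z / 2), which is where
  nonnegativity of the moved radius matters. The h^2 and h^3 terms stay explicit because the two
  uses of the lemma estimate them differently.\<close>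

lemma dC_move:
  fixes x1 x2 g :: "'a::euclidean_space"
  assumes \<Lambda>: "\<Lambda> > 0" and \<Sigma>: "\<Sigma> > 0" and r: "0 \<le> r1" "0 \<le> r2" and pos: "0 \<le> 1 + h * \<Sigma> * z / 2"
  defines "\<sigma> \<equiv> csinc (sqrt (\<Sigma> / (4 * \<Lambda>)) * norm (x1 - x2))"
  shows "(dC \<Lambda> \<Sigma> (x1 + (h * \<Lambda>) *\<^sub>R g, r1 * (1 + h * \<Sigma> * z / 2)) (x2, r2))\<^sup>2 \<le>
    (dC \<Lambda> \<Sigma> (x1, r1) (x2, r2))\<^sup>2 + h * dC_var \<Lambda> \<Sigma> (x1, r1) (x2, r2) g z
    + h\<^sup>2 * (\<Sigma> * z\<^sup>2 * r1\<^sup>2 + \<Lambda> * (norm g)\<^sup>2 * (r1 * r2) + \<Sigma> * z * (r1 * r2 * (\<sigma> * inner (x1 - x2) g)))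
    + h ^ 3 * (\<Sigma> * \<Lambda> * z * (norm g)\<^sup>2 * (r1 * r2)) / 2"
proof -
  define k where "k = sqrt (\<Sigma> / (4 * \<Lambda>))"
  define u where "u = x1 - x2"
  define C where "C = ccos (k * norm u)"
  define C' where "C' = ccos (k * norm (u + (h * \<Lambda>) *\<^sub>R g))"
  define i where "i = inner u g"
  define n where "n = (norm g)\<^sup>2"
  have k: "0 \<le> k" "k\<^sup>2 = \<Sigma> / (4 * \<Lambda>)" using \<Lambda> \<Sigma> by (auto simp: k_def)
  have \<sigma>: "\<sigma> = csinc (k * norm u)" by (simp add: \<sigma>_def k_def u_def)
  define e where "e = 1 + h * \<Sigma> * z / 2"
  have e: "0 \<le> e" using pos by (simp add: e_def)
  have C': "C' \<ge> C - h * \<Sigma> / 4 * \<sigma> * i - h\<^sup>2 * \<Lambda> * \<Sigma> / 8 * n"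
    using ccos_norm_semiconvex[OF k(1), of u "(h * \<Lambda>) *\<^sub>R g"] \<Lambda> unfolding C_def[symmetric] C'_def[symmetric] \<sigma>[symmetric] k(2)
    by (simp add: i_def n_def power_mult_distrib power2_eq_square field_simps)
  have "(dC \<Lambda> \<Sigma> (x1 + (h * \<Lambda>) *\<^sub>R g, r1 * e) (x2, r2))\<^sup>2 = 4 / \<Sigma> * (r1\<^sup>2 * e\<^sup>2 + r2\<^sup>2) - 8 / \<Sigma> * (r1 * r2 * e) * C'"
    unfolding dC_sq[OF \<Sigma>] by (simp add: C'_def k_def u_def power_mult_distrib add_diff_eq diff_add_eq algebra_simps)
  also have "\<dots> \<le> 4 / \<Sigma> * (r1\<^sup>2 * e\<^sup>2 + r2\<^sup>2) - 8 / \<Sigma> * (r1 * r2 * e) * (C - h * \<Sigma> / 4 * \<sigma> * i - h\<^sup>2 * \<Lambda> * \<Sigma> / 8 * n)"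
    using \<Sigma> r e C' by (intro diff_left_mono mult_left_mono) auto
  also have "\<dots> = 4 / \<Sigma> * (r1\<^sup>2 + r2\<^sup>2 - 2 * r1 * r2 * C) + h * (4 * z * r1\<^sup>2 - 4 * z * r1 * r2 * C + 2 * r1 * r2 * \<sigma> * i)
    + h\<^sup>2 * (\<Sigma> * z\<^sup>2 * r1\<^sup>2 + \<Lambda> * n * (r1 * r2) + \<Sigma> * z * (r1 * r2 * (\<sigma> * i)))
    + h ^ 3 * (\<Sigma> * \<Lambda> * z * n * (r1 * r2)) / 2"
    using \<Sigma> unfolding e_def by (simp add: field_simps power2_eq_square power3_eq_cube)
  finally show ?thesis unfolding dC_sq[OF \<Sigma>] dC_var_def e_def C_def \<sigma> i_def n_def k_def u_def by simp
qed

text \<open>Cauchy-Schwarz and \<open>mult_csinc\<close>. The sine is kept because it vanishes with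
  the angle; \<open>dC_move_test_function\<close> exploits this through sin^2 <= 2 (1 - C).\<close>

lemma csinc_inner_bound:
  fixes u g :: "'a::euclidean_space"
  assumes k: "0 < k" and B: "norm g \<le> B"
  shows "\<bar>csinc (k * norm u) * inner u g\<bar> \<le> B / k * sin (min (k * norm u) pi)"
proof -
  let ?s = "csinc (k * norm u)"
  have s: "0 \<le> ?s" using k by (intro csinc_nonneg) auto
  have "\<bar>?s * inner u g\<bar> \<le> ?s * (norm u * norm g)"
    using s Cauchy_Schwarz_ineq2[of u g] by (simp add: abs_mult mult_left_mono)
  also have "\<dots> \<le> ?s * (norm u * B)" using s B by (intro mult_left_mono) auto
  also have "\<dots> = B / k * (k * norm u * ?s)" using k by simp
  also have "k * norm u * ?s = sin (min (k * norm u) pi)" using k by (intro mult_csinc) auto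
  finally show ?thesis .
qed

text \<open>A remainder uniform over all pairs, for bounded directions: the four summands of
  \<open>K\<close> bound the three h^2 terms and the h^3 term of \<open>dC_move\<close>, by |h| <= 1
  and r1 r2 <= r1^2 + r2^2.\<close>

lemma dC_move_le:
  assumes \<Lambda>: "\<Lambda> > 0" and \<Sigma>: "\<Sigma> > 0" and B: "0 \<le> B"
  obtains K where "0 \<le> K" "\<And>(x1::'a::euclidean_space) r1 x2 r2 h z g. \<lbrakk>0 \<le> r1; 0 \<le> r2; \<bar>h\<bar> \<le> 1; 0 \<le> 1 + h * \<Sigma> * z / 2; \<bar>z\<bar> \<le> B; norm g \<le> B\<rbrakk> \<Longrightarrow>
    (dC \<Lambda> \<Sigma> (x1 + (h * \<Lambda>) *\<^sub>R g, r1 * (1 + h * \<Sigma> * z / 2)) (x2, r2))\<^sup>2 \<le>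
    (dC \<Lambda> \<Sigma> (x1, r1) (x2, r2))\<^sup>2 + h * dC_var \<Lambda> \<Sigma> (x1, r1) (x2, r2) g z + K * h\<^sup>2 * (r1\<^sup>2 + r2\<^sup>2)"
proof -
  define k where "k = sqrt (\<Sigma> / (4 * \<Lambda>))"
  have k: "0 < k" using \<Lambda> \<Sigma> by (simp add: k_def)
  define K where "K = \<Sigma> * B\<^sup>2 + \<Lambda> * B\<^sup>2 + \<Sigma> * B * (B / k) + \<Sigma> * \<Lambda> * B * B\<^sup>2"
  have K: "0 \<le> K" using \<Lambda> \<Sigma> B k by (simp add: K_def)
  show ?thesis
  proof (rule that[OF K])
    fix x1 x2 g :: 'a and r1 r2 h z :: real
    assume r: "0 \<le> r1" "0 \<le> r2" and h: "\<bar>h\<bar> \<le> 1" and pos: "0 \<le> 1 + h * \<Sigma> * z / 2" and z: "\<bar>z\<bar> \<le> B" and g: "norm g \<le> B"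
    define \<sigma> where "\<sigma> = csinc (sqrt (\<Sigma> / (4 * \<Lambda>)) * norm (x1 - x2))"
    define R where "R = r1\<^sup>2 + r2\<^sup>2"
    have "0 \<le> (r1 - r2)\<^sup>2" by simp
    then have "2 * (r1 * r2) \<le> R" by (simp add: R_def power2_diff)
    moreover have "0 \<le> r1 * r2" using r by simp
    ultimately have rr: "0 \<le> r1 * r2" "r1 * r2 \<le> R" "r1\<^sup>2 \<le> R" "0 \<le> R" by (auto simp: R_def)
    have z2: "z\<^sup>2 \<le> B\<^sup>2" and g2: "(norm g)\<^sup>2 \<le> B\<^sup>2" using z g abs_le_square_iff[of z B] B by (auto intro: power_mono)
    have "\<bar>\<sigma> * inner (x1 - x2) g\<bar> \<le> B / k * sin (min (k * norm (x1 - x2)) pi)"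
      using csinc_inner_bound[OF k g, of "x1 - x2"] by (simp add: \<sigma>_def k_def)
    also have "\<dots> \<le> B / k * 1" using B k by (intro mult_left_mono) auto
    finally have i: "\<bar>\<sigma> * inner (x1 - x2) g\<bar> \<le> B / k" by simp
    have 1: "\<Sigma> * z\<^sup>2 * r1\<^sup>2 \<le> \<Sigma> * B\<^sup>2 * R" using \<Sigma> z2 rr by (intro mult_mono) auto
    have 2: "\<Lambda> * (norm g)\<^sup>2 * (r1 * r2) \<le> \<Lambda> * B\<^sup>2 * R" using \<Lambda> g2 rr by (intro mult_mono) auto
    have "\<bar>\<Sigma> * z * (r1 * r2 * (\<sigma> * inner (x1 - x2) g))\<bar> = \<Sigma> * \<bar>z\<bar> * (\<bar>\<sigma> * inner (x1 - x2) g\<bar> * (r1 * r2))"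
      using \<Sigma> r by (simp add: abs_mult)
    also have "\<dots> \<le> \<Sigma> * B * (B / k * R)"
      using \<Sigma> z i rr B k by (intro mult_mono) auto
    finally have 3: "\<Sigma> * z * (r1 * r2 * (\<sigma> * inner (x1 - x2) g)) \<le> \<Sigma> * B * (B / k) * R" by (simp add: abs_le_iff mult.assoc)
    have "h ^ 3 * (\<Sigma> * \<Lambda> * z * (norm g)\<^sup>2 * (r1 * r2)) / 2 \<le> \<bar>h ^ 3 * (\<Sigma> * \<Lambda> * z * (norm g)\<^sup>2 * (r1 * r2)) / 2\<bar>" by simp
    also have "\<dots> = (\<bar>h\<bar> * h\<^sup>2) * ((\<Sigma> * \<Lambda> * \<bar>z\<bar> * (norm g)\<^sup>2) * (r1 * r2)) / 2"
      using \<Sigma> \<Lambda> r by (simp add: abs_mult power3_eq_cube power2_eq_square)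
    also have "\<dots> \<le> (1 * h\<^sup>2) * ((\<Sigma> * \<Lambda> * B * B\<^sup>2) * R) / 1"
      using \<Sigma> \<Lambda> h z g2 rr B r by (intro frac_le mult_mono mult_nonneg_nonneg) auto
    finally have 4: "h ^ 3 * (\<Sigma> * \<Lambda> * z * (norm g)\<^sup>2 * (r1 * r2)) / 2 \<le> h\<^sup>2 * ((\<Sigma> * \<Lambda> * B * B\<^sup>2) * R)" by simp
    have "h\<^sup>2 * (\<Sigma> * z\<^sup>2 * r1\<^sup>2 + \<Lambda> * (norm g)\<^sup>2 * (r1 * r2) + \<Sigma> * z * (r1 * r2 * (\<sigma> * inner (x1 - x2) g)))
      \<le> h\<^sup>2 * (\<Sigma> * B\<^sup>2 * R + \<Lambda> * B\<^sup>2 * R + \<Sigma> * B * (B / k) * R)"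
      by (intro mult_left_mono add_mono 1 2 3) auto
    with 4 have "h\<^sup>2 * (\<Sigma> * z\<^sup>2 * r1\<^sup>2 + \<Lambda> * (norm g)\<^sup>2 * (r1 * r2) + \<Sigma> * z * (r1 * r2 * (\<sigma> * inner (x1 - x2) g)))
        + h ^ 3 * (\<Sigma> * \<Lambda> * z * (norm g)\<^sup>2 * (r1 * r2)) / 2
      \<le> h\<^sup>2 * (\<Sigma> * B\<^sup>2 * R + \<Lambda> * B\<^sup>2 * R + \<Sigma> * B * (B / k) * R) + h\<^sup>2 * ((\<Sigma> * \<Lambda> * B * B\<^sup>2) * R)"
      by (rule add_mono[rotated])
    also have "\<dots> = K * h\<^sup>2 * R" by (simp add: K_def algebra_simps)
    finally show "(dC \<Lambda> \<Sigma> (x1 + (h * \<Lambda>) *\<^sub>R g, r1 * (1 + h * \<Sigma> * z / 2)) (x2, r2))\<^sup>2 \<le>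
      (dC \<Lambda> \<Sigma> (x1, r1) (x2, r2))\<^sup>2 + h * dC_var \<Lambda> \<Sigma> (x1, r1) (x2, r2) g z + K * h\<^sup>2 * (r1\<^sup>2 + r2\<^sup>2)"
      using dC_move[OF \<Lambda> \<Sigma> r pos, of x1 g x2] by (simp add: R_def \<sigma>_def)
  qed
qed

text \<open>The rescaled squared distance splits into a radial part (r1 - r2)^2 and an angular part
  2 r1 r2 (1 - C). The last two bounds let the angular defect carry the weight r2^2 instead of r1
  r2, and let r1 r2 be traded for r1^2.\<close>

lemma dC_lower_bounds:
  fixes x1 x2 :: "'a::euclidean_space" and \<Lambda> :: real
  assumes \<Sigma>: "\<Sigma> > 0" and r: "0 \<le> r1" "0 \<le> r2"
  defines "D \<equiv> \<Sigma> / 4 * (dC \<Lambda> \<Sigma> (x1, r1) (x2, r2))\<^sup>2" and "C \<equiv> ccos (sqrt (\<Sigma> / (4 * \<Lambda>)) * norm (x1 - x2))"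
  shows "D = (r1 - r2)\<^sup>2 + 2 * (r1 * r2) * (1 - C)" "(r1 - r2)\<^sup>2 \<le> D" "2 * (r1 * r2) * (1 - C) \<le> D"
    "r2\<^sup>2 * (1 - C) \<le> 2 * D" "r1 * r2 \<le> 2 * r1\<^sup>2 + D"
proof -
  have C: "0 \<le> 1 - C" "1 - C \<le> 2" using ccos_bounds[of "sqrt (\<Sigma> / (4 * \<Lambda>)) * norm (x1 - x2)"] by (auto simp: C_def)
  show D: "D = (r1 - r2)\<^sup>2 + 2 * (r1 * r2) * (1 - C)"
    using \<Sigma> unfolding D_def dC_sq[OF \<Sigma>] by (simp add: C_def power2_eq_square algebra_simps)
  then show 1: "(r1 - r2)\<^sup>2 \<le> D" and 2: "2 * (r1 * r2) * (1 - C) \<le> D" using r C by auto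
  have "0 \<le> r1\<^sup>2" by simp
  then have r2: "r2\<^sup>2 \<le> 2 * (r1 * r2) + (r1 - r2)\<^sup>2" by (simp add: power2_diff)
  then have "r2\<^sup>2 * (1 - C) \<le> (2 * (r1 * r2) + (r1 - r2)\<^sup>2) * (1 - C)" using C by (intro mult_right_mono) auto
  moreover have "(r1 - r2)\<^sup>2 * (1 - C) \<le> (r1 - r2)\<^sup>2 * 2" using C by (intro mult_left_mono) auto
  moreover have "(2 * (r1 * r2) + (r1 - r2)\<^sup>2) * (1 - C) = D + (r1 - r2)\<^sup>2 * (1 - C) - (r1 - r2)\<^sup>2" by (simp add: D algebra_simps)
  ultimately show "r2\<^sup>2 * (1 - C) \<le> 2 * D" using 1 by linarith
  have "0 \<le> (r1 - (r2 - r1))\<^sup>2" by simp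
  then have "2 * (r1 * (r2 - r1)) \<le> r1\<^sup>2 + (r1 - r2)\<^sup>2" by (simp add: power2_eq_square algebra_simps)
  moreover have "0 \<le> r1\<^sup>2 + (r1 - r2)\<^sup>2" by simp
  ultimately have "r1 * (r2 - r1) \<le> r1\<^sup>2 + (r1 - r2)\<^sup>2" by linarith
  then show "r1 * r2 \<le> 2 * r1\<^sup>2 + D" using 1 by (simp add: power2_eq_square algebra_simps)
qed

text \<open>For close pairs the first variation is minus twice the increment of r^2 \<zeta>(x), up
  to O(d^2). The h^2 coefficient is exactly the energy density of (grad \<zeta>, \<zeta>) at the
  first point, and everything else goes into K |h| (d^2 + h^2 r1^2). This precision is required
  because d^2 will integrate to order h^2.\<close>

lemma dC_move_test_function:
  fixes \<zeta> :: "'a::euclidean_space \<Rightarrow> real"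
  assumes \<Lambda>: "\<Lambda> > 0" and \<Sigma>: "\<Sigma> > 0" and \<zeta>: "\<zeta> \<in> Cc_inf"
  obtains K where "0 \<le> K" "\<And>x1 r1 x2 r2 h. \<lbrakk>0 \<le> r1; 0 \<le> r2; \<bar>h\<bar> \<le> 1; 0 \<le> 1 + h * \<Sigma> * \<zeta> x1 / 2\<rbrakk> \<Longrightarrow>
    (dC \<Lambda> \<Sigma> (x1 + (h * \<Lambda>) *\<^sub>R grad \<zeta> x1, r1 * (1 + h * \<Sigma> * \<zeta> x1 / 2)) (x2, r2))\<^sup>2 \<le>
    (dC \<Lambda> \<Sigma> (x1, r1) (x2, r2))\<^sup>2 - 2 * h * (r2\<^sup>2 * \<zeta> x2 - r1\<^sup>2 * \<zeta> x1)
      + h\<^sup>2 * (r1\<^sup>2 * (\<Lambda> * (norm (grad \<zeta> x1))\<^sup>2 + \<Sigma> * (\<zeta> x1)\<^sup>2))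
      + K * \<bar>h\<bar> * ((dC \<Lambda> \<Sigma> (x1, r1) (x2, r2))\<^sup>2 + h\<^sup>2 * r1\<^sup>2)"
proof -
  define k where "k = sqrt (\<Sigma> / (4 * \<Lambda>))"
  have k: "0 < k" using \<Lambda> \<Sigma> by (simp add: k_def)
  obtain B1 where B1: "0 \<le> B1" "\<And>x. \<bar>\<zeta> x\<bar> \<le> B1" using Cc_inf_bounded[OF \<zeta>] by blast
  obtain B2 where B2: "0 \<le> B2" "\<And>x. norm (grad \<zeta> x) \<le> B2" using Cc_inf_grad_bounded[OF \<zeta>] by blast
  obtain B3 where B3: "0 \<le> B3" "\<And>x y. \<bar>\<zeta> y - \<zeta> x - inner (grad \<zeta> x) (y - x)\<bar> \<le> B3 * (norm (y - x))\<^sup>2"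
    using Cc_inf_Taylor[OF \<zeta>] by blast
  define B where "B = B1 + B2"
  have B: "0 \<le> B" "\<And>x. \<bar>\<zeta> x\<bar> \<le> B" "\<And>x. norm (grad \<zeta> x) \<le> B"
    using B1 B2 unfolding B_def by (auto intro: add_increasing add_increasing2)
  define KQ where "KQ = B3 / k\<^sup>2 + 2 * B"
  \<comment> \<open>\<open>K1\<close> bounds the first-order discrepancy against D, and
    \<open>K2\<close> the higher-order terms against F = h^2 r1^2 + D. The factor \<Sigma> / 4 + 1
    in \<open>K\<close> returns from the rescaled D to the squared distance.\<close>
  define K1 where "K1 = 2 * B + 2 * KQ * pi\<^sup>2 + 2 * B / k * (3 * pi\<^sup>2 + 1)"
  define K2 where "K2 = \<Lambda> * B\<^sup>2 + \<Sigma> * B * (B / k) + \<Sigma> * \<Lambda> * B * B\<^sup>2"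
  have K0: "0 \<le> KQ" "0 \<le> K1" "0 \<le> K2" using \<Lambda> \<Sigma> B B3(1) k by (auto simp: KQ_def K1_def K2_def)
  define K where "K = (K1 + K2) * (\<Sigma> / 4 + 1)"
  have K: "0 \<le> K" using K0 \<Sigma> by (simp add: K_def)
  show ?thesis
  proof (rule that[OF K])
    fix x1 x2 :: 'a and r1 r2 h :: real
    assume r: "0 \<le> r1" "0 \<le> r2" and h: "\<bar>h\<bar> \<le> 1" and pos: "0 \<le> 1 + h * \<Sigma> * \<zeta> x1 / 2"
    define z where "z = \<zeta> x1"
    define g where "g = grad \<zeta> x1"
    define u where "u = x1 - x2"
    define a where "a = k * norm u"
    define s where "s = csinc a"
    define C where "C = ccos a"
    define D where "D = \<Sigma> / 4 * (dC \<Lambda> \<Sigma> (x1, r1) (x2, r2))\<^sup>2"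
    define m where "m = min a pi"
    note D = dC_lower_bounds[OF \<Sigma> r, of \<Lambda> x1 x2, folded k_def u_def, folded a_def, folded C_def D_def]
    have a0: "0 \<le> a" using k by (simp add: a_def)
    have D0: "0 \<le> D" using \<Sigma> by (simp add: D_def)
    have z: "\<bar>z\<bar> \<le> B" and g: "norm g \<le> B" using B by (auto simp: z_def g_def)
    have m2: "m\<^sup>2 \<le> pi\<^sup>2 / 2 * (1 - C)" using one_minus_ccos_ge[OF a0] by (simp add: m_def C_def)
    \<comment> \<open>The truncated angle weighted by the second radius is controlled by the
      distance; the Taylor error \<open>Q\<close> and the gradient error \<open>P\<close> below both
      rest on this bound.\<close>
    have "r2\<^sup>2 * m\<^sup>2 \<le> r2\<^sup>2 * (pi\<^sup>2 / 2 * (1 - C))" using m2 by (intro mult_left_mono) auto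
    also have "\<dots> = pi\<^sup>2 / 2 * (r2\<^sup>2 * (1 - C))" by simp
    also have "\<dots> \<le> pi\<^sup>2 / 2 * (2 * D)" using D(4) by (intro mult_left_mono) auto
    finally have rm: "r2\<^sup>2 * m\<^sup>2 \<le> pi\<^sup>2 * D" by simp
    have L: "dC_var \<Lambda> \<Sigma> (x1, r1) (x2, r2) g z = 4 * z * r1\<^sup>2 - 4 * z * r1 * r2 * C + 2 * r1 * r2 * s * inner u g"
      by (simp add: dC_var_def k_def u_def a_def s_def C_def)
    have DD: "D = r1\<^sup>2 + r2\<^sup>2 - 2 * r1 * r2 * C" unfolding D(1) by (simp add: power2_eq_square algebra_simps)

    \<comment> \<open>Taylor remainder of \<zeta> at x1, evaluated at x2. Beyond angle pi, where
      \<open>csinc\<close> removes the gradient term, no first-order part is subtracted; there m =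
      pi, and boundedness of \<zeta> suffices.\<close>
    define Q where "Q = \<zeta> x2 - z + (if a \<le> pi then inner u g else 0)"
    have Q: "\<bar>Q\<bar> \<le> KQ * m\<^sup>2"
    proof (cases "a \<le> pi")
      case True
      have "\<bar>Q\<bar> \<le> B3 * (norm u)\<^sup>2"
        using B3(2)[of x2 x1] True by (simp add: Q_def z_def g_def u_def inner_diff_right inner_diff_left inner_commute norm_minus_commute algebra_simps)
      also have "\<dots> = B3 / k\<^sup>2 * m\<^sup>2" using True k by (simp add: m_def a_def power_mult_distrib)
      also have "\<dots> \<le> KQ * m\<^sup>2" using B by (intro mult_right_mono) (auto simp: KQ_def)
      finally show ?thesis .
    next
      case False
      then have "\<bar>Q\<bar> \<le> 2 * B * 1" using B(2)[of x2] z by (simp add: Q_def)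
      also have "\<dots> \<le> KQ * m\<^sup>2"
      proof (rule mult_mono)
        have "1\<^sup>2 \<le> pi\<^sup>2" using pi_gt3 by (intro power_mono) auto
        then show "1 \<le> m\<^sup>2" using False by (simp add: m_def)
      qed (use B3 B in \<open>auto simp: KQ_def\<close>)
      finally show ?thesis .
    qed
    have rQ: "r2\<^sup>2 * \<bar>Q\<bar> \<le> KQ * pi\<^sup>2 * D"
    proof -
      have "r2\<^sup>2 * \<bar>Q\<bar> \<le> r2\<^sup>2 * (KQ * m\<^sup>2)" using Q by (intro mult_left_mono) auto
      also have "\<dots> = KQ * (r2\<^sup>2 * m\<^sup>2)" by simp
      also have "\<dots> \<le> KQ * (pi\<^sup>2 * D)" using rm K0 by (intro mult_left_mono) auto
      finally show ?thesis by (simp add: mult.assoc)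
    qed
    \<comment> \<open>Error of replacing the weight r1 r2 s by r2^2 in the gradient term. Up to
      angle pi it equals <u, g> r2 (s (r1 - r2) - r2 (1 - s)), where both r2 |<u, g>| and the
      bracket are of order sqrt D, so the product is O(D).\<close>
    define P where "P = r1 * r2 * s * inner u g - r2\<^sup>2 * (if a \<le> pi then inner u g else 0)"
    have P: "\<bar>P\<bar> \<le> B / k * (3 * pi\<^sup>2 + 1) * D"
    proof (cases "a \<le> pi")
      case False
      then have "P = 0" by (auto simp: P_def s_def csinc_def)
      then show ?thesis using B k D0 by simp
    next
      case True
      have s: "0 \<le> s" "s \<le> 1" "1 - s \<le> 2 * a" using csinc_nonneg csinc_le_1 csinc_ge a0 True by (auto simp: s_def)
      have "\<bar>inner u g\<bar> \<le> norm u * norm g" by (rule Cauchy_Schwarz_ineq2)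
      also have "\<dots> \<le> norm u * B" using g by (intro mult_left_mono) auto
      also have "\<dots> = B / k * a" using k by (simp add: a_def)
      finally have ug: "\<bar>inner u g\<bar> \<le> B / k * a" .
      have "\<bar>s * (r1 - r2) - r2 * (1 - s)\<bar> \<le> \<bar>s * (r1 - r2)\<bar> + \<bar>r2 * (1 - s)\<bar>" by (rule abs_triangle_ineq4)
      also have "\<dots> \<le> 1 * \<bar>r1 - r2\<bar> + r2 * (2 * a)"
        unfolding abs_mult using s r by (intro add_mono mult_mono) auto
      finally have t: "\<bar>s * (r1 - r2) - r2 * (1 - s)\<bar> \<le> \<bar>r1 - r2\<bar> + 2 * (r2 * a)" by simp
      have "\<bar>P\<bar> = \<bar>inner u g\<bar> * (r2 * \<bar>s * (r1 - r2) - r2 * (1 - s)\<bar>)"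
      proof -
        have "P = inner u g * (r2 * (s * (r1 - r2) - r2 * (1 - s)))" using True by (simp add: P_def power2_eq_square algebra_simps)
        then show ?thesis using r by (simp add: abs_mult)
      qed
      also have "\<dots> \<le> (B / k * a) * (r2 * (\<bar>r1 - r2\<bar> + 2 * (r2 * a)))"
        using ug t r B k a0 by (intro mult_mono) auto
      also have "\<dots> = B / k * ((r2 * a) * \<bar>r1 - r2\<bar> + 2 * (r2 * a)\<^sup>2)" by (simp add: power2_eq_square algebra_simps)
      also have "\<dots> \<le> B / k * (3 * (r2 * a)\<^sup>2 + (r1 - r2)\<^sup>2)"
      proof (intro mult_left_mono)
        have "0 \<le> (r2 * a - \<bar>r1 - r2\<bar>)\<^sup>2" "0 \<le> (r2 * a)\<^sup>2" "0 \<le> \<bar>r1 - r2\<bar>\<^sup>2" by simp_all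
        then have "(r2 * a) * \<bar>r1 - r2\<bar> \<le> (r2 * a)\<^sup>2 + \<bar>r1 - r2\<bar>\<^sup>2" unfolding power2_diff by linarith
        then show "(r2 * a) * \<bar>r1 - r2\<bar> + 2 * (r2 * a)\<^sup>2 \<le> 3 * (r2 * a)\<^sup>2 + (r1 - r2)\<^sup>2" by simp
      qed (use B k in auto)
      also have "\<dots> \<le> B / k * (3 * (pi\<^sup>2 * D) + D)"
        using rm D(2) B k True by (intro mult_left_mono add_mono) (auto simp: m_def power_mult_distrib)
      finally show ?thesis by (simp add: algebra_simps)
    qed
    \<comment> \<open>The cosine is eliminated through D: 4 z r1^2 - 4 z r1 r2 C = 2 z D + 2 z r1^2
      - 2 z r2^2.\<close>
    have "dC_var \<Lambda> \<Sigma> (x1, r1) (x2, r2) g z + 2 * (r2\<^sup>2 * \<zeta> x2 - r1\<^sup>2 * z) = 2 * z * D + 2 * (r2\<^sup>2 * Q) + 2 * P"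
      unfolding L DD Q_def P_def by (simp add: algebra_simps)
    then have "\<bar>dC_var \<Lambda> \<Sigma> (x1, r1) (x2, r2) g z + 2 * (r2\<^sup>2 * \<zeta> x2 - r1\<^sup>2 * z)\<bar> \<le> \<bar>2 * z * D\<bar> + \<bar>2 * (r2\<^sup>2 * Q)\<bar> + \<bar>2 * P\<bar>"
      by linarith
    also have "\<dots> = 2 * (\<bar>z\<bar> * D) + 2 * (r2\<^sup>2 * \<bar>Q\<bar>) + 2 * \<bar>P\<bar>" using D0 by (simp add: abs_mult)
    also have "\<dots> \<le> 2 * (B * D) + 2 * (KQ * pi\<^sup>2 * D) + 2 * (B / k * (3 * pi\<^sup>2 + 1) * D)"
      using z rQ P D0 by (intro add_mono mult_left_mono mult_right_mono) auto
    also have "\<dots> = K1 * D" by (simp add: K1_def algebra_simps)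
    finally have E1: "\<bar>dC_var \<Lambda> \<Sigma> (x1, r1) (x2, r2) g z + 2 * (r2\<^sup>2 * \<zeta> x2 - r1\<^sup>2 * z)\<bar> \<le> K1 * D" .
    have "h * dC_var \<Lambda> \<Sigma> (x1, r1) (x2, r2) g z + 2 * h * (r2\<^sup>2 * \<zeta> x2 - r1\<^sup>2 * z)
        \<le> \<bar>h * (dC_var \<Lambda> \<Sigma> (x1, r1) (x2, r2) g z + 2 * (r2\<^sup>2 * \<zeta> x2 - r1\<^sup>2 * z))\<bar>"
      using abs_ge_self[of "h * (dC_var \<Lambda> \<Sigma> (x1, r1) (x2, r2) g z + 2 * (r2\<^sup>2 * \<zeta> x2 - r1\<^sup>2 * z))"] by (simp add: algebra_simps)
    also have "\<dots> \<le> \<bar>h\<bar> * (K1 * D)" unfolding abs_mult by (intro mult_left_mono E1) auto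
    finally have E1': "h * dC_var \<Lambda> \<Sigma> (x1, r1) (x2, r2) g z \<le> - 2 * h * (r2\<^sup>2 * \<zeta> x2 - r1\<^sup>2 * z) + \<bar>h\<bar> * (K1 * D)" by simp

    define F where "F = h\<^sup>2 * r1\<^sup>2 + D"
    have F0: "0 \<le> F" using D0 by (simp add: F_def)
    have h2: "h\<^sup>2 \<le> 1" using h by (simp add: abs_square_le_1)
    have z2: "z\<^sup>2 \<le> B\<^sup>2" and g2: "(norm g)\<^sup>2 \<le> B\<^sup>2" using z g abs_le_square_iff[of z B] B by (auto intro: power_mono)
    have hD: "h\<^sup>2 * D \<le> D" using h2 D0 mult_right_mono[of "h\<^sup>2" 1 D] by simp
    have "h\<^sup>2 * (r1 * r2) \<le> h\<^sup>2 * (2 * r1\<^sup>2 + D)" using D(5) by (intro mult_left_mono) auto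
    then have hrr: "h\<^sup>2 * (r1 * r2) \<le> 2 * (h\<^sup>2 * r1\<^sup>2) + D" using hD by (simp add: algebra_simps)
    \<comment> \<open>One power of h pays for replacing r1 r2 by r1^2 with error F; this leaves the
      exact weight r1^2 in the h^2 coefficient.\<close>
    have T1: "\<bar>h\<bar> * (r1 * r2) \<le> \<bar>h\<bar> * r1\<^sup>2 + F"
    proof -
      have "0 \<le> (\<bar>h\<bar> * r1 - (r2 - r1))\<^sup>2" "0 \<le> (\<bar>h\<bar> * r1)\<^sup>2" "0 \<le> (r2 - r1)\<^sup>2" by simp_all
      then have "\<bar>h\<bar> * r1 * (r2 - r1) \<le> (\<bar>h\<bar> * r1)\<^sup>2 + (r2 - r1)\<^sup>2" unfolding power2_diff[of "\<bar>h\<bar> * r1"] by linarith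
      also have "\<dots> \<le> F" using D(2) by (simp add: F_def power_mult_distrib power2_commute)
      finally show ?thesis by (simp add: power2_eq_square algebra_simps)
    qed
    \<comment> \<open>For w = sin m, w^2 = (1 - C) (1 + C) <= 2 (1 - C). Splitting 2 |h| w <= h^2 +
      w^2, the angular part of D absorbs r1 r2 w^2.\<close>
    have T2: "\<bar>h\<bar> * (r1 * r2 * sin m) \<le> F"
    proof -
      define w where "w = sin m"
      have "w\<^sup>2 = (1 - C) * (1 + C)"
        unfolding w_def C_def ccos_def m_def[symmetric] by (simp add: sin_squared_eq power2_eq_square algebra_simps)
      also have "\<dots> \<le> (1 - C) * 2" using ccos_bounds[of a] by (intro mult_left_mono) (auto simp: C_def)
      finally have "r1 * r2 * w\<^sup>2 \<le> r1 * r2 * ((1 - C) * 2)" using r by (intro mult_left_mono) auto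
      also have "\<dots> \<le> D" using D(3) by (simp add: mult_ac)
      finally have w: "r1 * r2 * w\<^sup>2 \<le> D" .
      have "0 \<le> (\<bar>h\<bar> - w)\<^sup>2" by simp
      then have "2 * (\<bar>h\<bar> * w) \<le> h\<^sup>2 + w\<^sup>2" by (simp add: power2_diff)
      then have "r1 * r2 * (2 * (\<bar>h\<bar> * w)) \<le> r1 * r2 * (h\<^sup>2 + w\<^sup>2)" using r by (intro mult_left_mono) auto
      also have "\<dots> = h\<^sup>2 * (r1 * r2) + r1 * r2 * w\<^sup>2" by (simp add: algebra_simps)
      also have "\<dots> \<le> 2 * F" using hrr w by (simp add: F_def)
      finally show ?thesis by (simp add: w_def mult_ac)
    qed
    have 2: "h\<^sup>2 * (\<Lambda> * (norm g)\<^sup>2 * (r1 * r2)) \<le> h\<^sup>2 * (\<Lambda> * (norm g)\<^sup>2 * r1\<^sup>2) + \<bar>h\<bar> * (\<Lambda> * B\<^sup>2 * F)"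
    proof -
      have "\<bar>h\<bar> * (\<Lambda> * (norm g)\<^sup>2 * (\<bar>h\<bar> * (r1 * r2))) \<le> \<bar>h\<bar> * (\<Lambda> * (norm g)\<^sup>2 * (\<bar>h\<bar> * r1\<^sup>2 + F))"
        using T1 \<Lambda> by (intro mult_left_mono) auto
      also have "\<dots> = \<bar>h\<bar>\<^sup>2 * (\<Lambda> * (norm g)\<^sup>2 * r1\<^sup>2) + \<bar>h\<bar> * (\<Lambda> * (norm g)\<^sup>2 * F)" unfolding power2_eq_square by (simp add: algebra_simps)
      also have "\<dots> \<le> \<bar>h\<bar>\<^sup>2 * (\<Lambda> * (norm g)\<^sup>2 * r1\<^sup>2) + \<bar>h\<bar> * (\<Lambda> * B\<^sup>2 * F)"
        using g2 \<Lambda> F0 by (intro add_left_mono mult_left_mono mult_right_mono) auto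
      also have "\<bar>h\<bar> * (\<Lambda> * (norm g)\<^sup>2 * (\<bar>h\<bar> * (r1 * r2))) = \<bar>h\<bar>\<^sup>2 * (\<Lambda> * (norm g)\<^sup>2 * (r1 * r2))" unfolding power2_eq_square by (simp add: algebra_simps)
      finally show ?thesis by simp
    qed
    have 3: "h\<^sup>2 * (\<Sigma> * z * (r1 * r2 * (s * inner u g))) \<le> \<bar>h\<bar> * (\<Sigma> * B * (B / k) * F)"
    proof -
      have i: "\<bar>s * inner u g\<bar> \<le> B / k * sin m"
        using csinc_inner_bound[OF k g, of u] by (simp add: s_def a_def m_def)
      have "h\<^sup>2 * (\<Sigma> * z * (r1 * r2 * (s * inner u g))) \<le> \<bar>h\<^sup>2 * (\<Sigma> * z * (r1 * r2 * (s * inner u g)))\<bar>" by simp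
      also have "\<dots> = \<bar>h\<bar> * (\<bar>h\<bar> * (\<Sigma> * \<bar>z\<bar> * (r1 * r2 * \<bar>s * inner u g\<bar>)))"
        using \<Sigma> r by (simp add: abs_mult power2_eq_square)
      also have "\<dots> \<le> \<bar>h\<bar> * (\<bar>h\<bar> * (\<Sigma> * B * (r1 * r2 * (B / k * sin m))))"
        using \<Sigma> z i r B by (intro mult_left_mono mult_mono) auto
      also have "\<dots> = \<bar>h\<bar> * (\<Sigma> * B * (B / k) * (\<bar>h\<bar> * (r1 * r2 * sin m)))" by (simp add: mult_ac)
      also have "\<dots> \<le> \<bar>h\<bar> * (\<Sigma> * B * (B / k) * F)" using T2 \<Sigma> B k by (intro mult_left_mono) auto
      finally show ?thesis .
    qed
    have 4: "h ^ 3 * (\<Sigma> * \<Lambda> * z * (norm g)\<^sup>2 * (r1 * r2)) / 2 \<le> \<bar>h\<bar> * (\<Sigma> * \<Lambda> * B * B\<^sup>2 * F)"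
    proof -
      have "h ^ 3 * (\<Sigma> * \<Lambda> * z * (norm g)\<^sup>2 * (r1 * r2)) / 2 \<le> \<bar>h ^ 3 * (\<Sigma> * \<Lambda> * z * (norm g)\<^sup>2 * (r1 * r2)) / 2\<bar>" by simp
      also have "\<dots> = \<bar>h\<bar> * ((\<Sigma> * \<Lambda> * \<bar>z\<bar> * (norm g)\<^sup>2) * (h\<^sup>2 * (r1 * r2))) / 2"
        using \<Sigma> \<Lambda> r by (simp add: abs_mult power3_eq_cube power2_eq_square mult_ac)
      also have "\<dots> \<le> \<bar>h\<bar> * ((\<Sigma> * \<Lambda> * B * B\<^sup>2) * (2 * F)) / 2"
      proof (intro divide_right_mono mult_left_mono)
        have a: "\<Sigma> * \<Lambda> * \<bar>z\<bar> * (norm g)\<^sup>2 \<le> \<Sigma> * \<Lambda> * B * B\<^sup>2"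
          using \<Sigma> \<Lambda> z g2 B by (intro mult_mono) auto
        have "h\<^sup>2 * (r1 * r2) \<le> 2 * F" using hrr D0 by (simp add: F_def)
        then show "\<Sigma> * \<Lambda> * \<bar>z\<bar> * (norm g)\<^sup>2 * (h\<^sup>2 * (r1 * r2)) \<le> \<Sigma> * \<Lambda> * B * B\<^sup>2 * (2 * F)"
          using \<Sigma> \<Lambda> B r by (intro mult_mono[OF a]) auto
      qed auto
      finally show ?thesis by simp
    qed
    have "(dC \<Lambda> \<Sigma> (x1 + (h * \<Lambda>) *\<^sub>R g, r1 * (1 + h * \<Sigma> * z / 2)) (x2, r2))\<^sup>2 \<le>
      (dC \<Lambda> \<Sigma> (x1, r1) (x2, r2))\<^sup>2 + h * dC_var \<Lambda> \<Sigma> (x1, r1) (x2, r2) g z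
      + h\<^sup>2 * (\<Sigma> * z\<^sup>2 * r1\<^sup>2 + \<Lambda> * (norm g)\<^sup>2 * (r1 * r2) + \<Sigma> * z * (r1 * r2 * (s * inner u g)))
      + h ^ 3 * (\<Sigma> * \<Lambda> * z * (norm g)\<^sup>2 * (r1 * r2)) / 2"
      using dC_move[OF \<Lambda> \<Sigma> r pos[folded z_def], of x1 g x2] by (simp add: s_def a_def k_def u_def)
    also have "\<dots> \<le> (dC \<Lambda> \<Sigma> (x1, r1) (x2, r2))\<^sup>2 - 2 * h * (r2\<^sup>2 * \<zeta> x2 - r1\<^sup>2 * z)
        + h\<^sup>2 * (r1\<^sup>2 * (\<Lambda> * (norm g)\<^sup>2 + \<Sigma> * z\<^sup>2)) + \<bar>h\<bar> * (K1 * D + K2 * F)"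
      using E1' 2 3 4 by (simp add: K2_def algebra_simps)
    also have "\<bar>h\<bar> * (K1 * D + K2 * F) \<le> K * \<bar>h\<bar> * ((dC \<Lambda> \<Sigma> (x1, r1) (x2, r2))\<^sup>2 + h\<^sup>2 * r1\<^sup>2)"
    proof -
      have "F \<le> (\<Sigma> / 4 + 1) * ((dC \<Lambda> \<Sigma> (x1, r1) (x2, r2))\<^sup>2 + h\<^sup>2 * r1\<^sup>2)" "D \<le> F"
        using \<Sigma> by (auto simp: F_def D_def algebra_simps)
      then have "K1 * D + K2 * F \<le> K1 * ((\<Sigma> / 4 + 1) * ((dC \<Lambda> \<Sigma> (x1, r1) (x2, r2))\<^sup>2 + h\<^sup>2 * r1\<^sup>2)) +
          K2 * ((\<Sigma> / 4 + 1) * ((dC \<Lambda> \<Sigma> (x1, r1) (x2, r2))\<^sup>2 + h\<^sup>2 * r1\<^sup>2))"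
        using K0 by (intro add_mono mult_left_mono) auto
      then have "\<bar>h\<bar> * (K1 * D + K2 * F) \<le> \<bar>h\<bar> * (K1 * ((\<Sigma> / 4 + 1) * ((dC \<Lambda> \<Sigma> (x1, r1) (x2, r2))\<^sup>2 + h\<^sup>2 * r1\<^sup>2)) +
          K2 * ((\<Sigma> / 4 + 1) * ((dC \<Lambda> \<Sigma> (x1, r1) (x2, r2))\<^sup>2 + h\<^sup>2 * r1\<^sup>2)))"
        by (intro mult_left_mono) auto
      also have "\<dots> = K * \<bar>h\<bar> * ((dC \<Lambda> \<Sigma> (x1, r1) (x2, r2))\<^sup>2 + h\<^sup>2 * r1\<^sup>2)"
        unfolding K_def by (simp only: distrib_left distrib_right mult_ac)
      finally show ?thesis .
    qed
    finally show "(dC \<Lambda> \<Sigma> (x1 + (h * \<Lambda>) *\<^sub>R grad \<zeta> x1, r1 * (1 + h * \<Sigma> * \<zeta> x1 / 2)) (x2, r2))\<^sup>2 \<le>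
      (dC \<Lambda> \<Sigma> (x1, r1) (x2, r2))\<^sup>2 - 2 * h * (r2\<^sup>2 * \<zeta> x2 - r1\<^sup>2 * \<zeta> x1)
        + h\<^sup>2 * (r1\<^sup>2 * (\<Lambda> * (norm (grad \<zeta> x1))\<^sup>2 + \<Sigma> * (\<zeta> x1)\<^sup>2))
        + K * \<bar>h\<bar> * ((dC \<Lambda> \<Sigma> (x1, r1) (x2, r2))\<^sup>2 + h\<^sup>2 * r1\<^sup>2)"
      by (simp add: z_def g_def)
  qed
qed

text \<open>The first variation is linear in (g, z), so Young with weight \<epsilon> separates the
  radii from the energy r1^2 (\<Lambda> |g|^2 + \<Sigma> z^2). With \<epsilon> equal to the L^2 size
  of the direction the integrated bound becomes linear in that size.\<close>

lemma dC_var_bound: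
  assumes \<Lambda>: "\<Lambda> > 0" and \<Sigma>: "\<Sigma> > 0"
  obtains K where "0 \<le> K" "\<And>(x1::'a::euclidean_space) r1 x2 r2 z g \<epsilon>. \<lbrakk>0 \<le> r1; 0 \<le> r2; 0 < \<epsilon>\<rbrakk> \<Longrightarrow>
    \<bar>dC_var \<Lambda> \<Sigma> (x1, r1) (x2, r2) g z\<bar> \<le> K * (\<epsilon> * (r1\<^sup>2 + r2\<^sup>2) + r1\<^sup>2 * (\<Lambda> * (norm g)\<^sup>2 + \<Sigma> * z\<^sup>2) / \<epsilon>)"
proof -
  define k where "k = sqrt (\<Sigma> / (4 * \<Lambda>))"
  have k: "0 < k" using \<Lambda> \<Sigma> by (simp add: k_def)
  define K where "K = 2 + 1 / k + 4 / \<Sigma> + 1 / (k * \<Lambda>)"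
  have K: "0 \<le> K" using k \<Lambda> \<Sigma> by (simp add: K_def)
  show ?thesis
  proof (rule that[OF K])
    fix x1 x2 g :: 'a and r1 r2 z \<epsilon> :: real
    assume r: "0 \<le> r1" "0 \<le> r2" and \<epsilon>: "0 < \<epsilon>"
    define s where "s = csinc (k * norm (x1 - x2))"
    define C where "C = ccos (k * norm (x1 - x2))"
    have young: "2 * (a * b) \<le> \<epsilon> * a\<^sup>2 + b\<^sup>2 / \<epsilon>" for a b :: real
    proof -
      have "0 \<le> (\<epsilon> * a - b)\<^sup>2 / \<epsilon>" using \<epsilon> by simp
      also have "\<dots> = \<epsilon> * a\<^sup>2 - 2 * (a * b) + b\<^sup>2 / \<epsilon>" using \<epsilon> by (simp add: power2_eq_square field_simps)
      finally show ?thesis by simp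
    qed
    have i: "\<bar>s * inner (x1 - x2) g\<bar> \<le> norm g / k"
    proof -
      have "\<bar>s * inner (x1 - x2) g\<bar> \<le> norm g / k * sin (min (k * norm (x1 - x2)) pi)"
        unfolding s_def by (rule csinc_inner_bound[OF k]) simp
      also have "\<dots> \<le> norm g / k * 1" using k by (intro mult_left_mono) auto
      finally show ?thesis by simp
    qed
    have "\<bar>C\<bar> \<le> 1" using ccos_bounds by (simp add: C_def abs_le_iff minus_le_iff)
    then have c: "\<bar>z * r1 * r2 * C\<bar> \<le> \<bar>z\<bar> * r1 * r2" using r by (simp add: abs_mult mult_left_le)
    have "dC_var \<Lambda> \<Sigma> (x1, r1) (x2, r2) g z = 4 * (z * r1\<^sup>2) - 4 * (z * r1 * r2 * C) + 2 * (r1 * r2 * (s * inner (x1 - x2) g))"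
      by (simp add: dC_var_def k_def s_def C_def)
    then have "\<bar>dC_var \<Lambda> \<Sigma> (x1, r1) (x2, r2) g z\<bar> \<le> 4 * \<bar>z * r1\<^sup>2\<bar> + 4 * \<bar>z * r1 * r2 * C\<bar> + 2 * \<bar>r1 * r2 * (s * inner (x1 - x2) g)\<bar>"
      by linarith
    also have "\<dots> \<le> 4 * (\<bar>z\<bar> * r1\<^sup>2) + 4 * (\<bar>z\<bar> * r1 * r2) + 2 * (r1 * r2 * (norm g / k))"
    proof -
      have "\<bar>r1 * r2 * (s * inner (x1 - x2) g)\<bar> = r1 * r2 * \<bar>s * inner (x1 - x2) g\<bar>" using r by (simp add: abs_mult)
      also have "\<dots> \<le> r1 * r2 * (norm g / k)" using i r by (intro mult_left_mono) auto
      finally show ?thesis using c by (simp add: abs_mult)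
    qed
    also have "\<dots> = 2 * (2 * (r1 * (r1 * \<bar>z\<bar>))) + 2 * (2 * (r2 * (r1 * \<bar>z\<bar>))) + 1 / k * (2 * (r2 * (r1 * norm g)))"
      by (simp add: power2_eq_square algebra_simps)
    also have "\<dots> \<le> 2 * (\<epsilon> * r1\<^sup>2 + (r1 * \<bar>z\<bar>)\<^sup>2 / \<epsilon>) + 2 * (\<epsilon> * r2\<^sup>2 + (r1 * \<bar>z\<bar>)\<^sup>2 / \<epsilon>) + 1 / k * (\<epsilon> * r2\<^sup>2 + (r1 * norm g)\<^sup>2 / \<epsilon>)"
      using k by (intro add_mono mult_left_mono young) auto
    also have "\<dots> = 2 * (\<epsilon> * (r1\<^sup>2 + r2\<^sup>2)) + 1 / k * (\<epsilon> * r2\<^sup>2) + 4 / \<Sigma> * (r1\<^sup>2 * (\<Sigma> * z\<^sup>2) / \<epsilon>) + 1 / (k * \<Lambda>) * (r1\<^sup>2 * (\<Lambda> * (norm g)\<^sup>2) / \<epsilon>)"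
      using \<Lambda> \<Sigma> k \<epsilon> by (simp add: power_mult_distrib field_simps)
    also have "\<dots> \<le> 2 * (\<epsilon> * (r1\<^sup>2 + r2\<^sup>2) + r1\<^sup>2 * (\<Lambda> * (norm g)\<^sup>2 + \<Sigma> * z\<^sup>2) / \<epsilon>) + 1 / k * (\<epsilon> * (r1\<^sup>2 + r2\<^sup>2) + r1\<^sup>2 * (\<Lambda> * (norm g)\<^sup>2 + \<Sigma> * z\<^sup>2) / \<epsilon>)
      + 4 / \<Sigma> * (\<epsilon> * (r1\<^sup>2 + r2\<^sup>2) + r1\<^sup>2 * (\<Lambda> * (norm g)\<^sup>2 + \<Sigma> * z\<^sup>2) / \<epsilon>) + 1 / (k * \<Lambda>) * (\<epsilon> * (r1\<^sup>2 + r2\<^sup>2) + r1\<^sup>2 * (\<Lambda> * (norm g)\<^sup>2 + \<Sigma> * z\<^sup>2) / \<epsilon>)"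
    proof -
      have p: "0 \<le> \<epsilon> * (r1\<^sup>2 + r2\<^sup>2)" "0 \<le> r1\<^sup>2 * (\<Lambda> * (norm g)\<^sup>2) / \<epsilon>" "0 \<le> r1\<^sup>2 * (\<Sigma> * z\<^sup>2) / \<epsilon>" "0 \<le> \<epsilon> * r1\<^sup>2"
        using \<epsilon> \<Lambda> \<Sigma> by auto
      have e: "r1\<^sup>2 * (\<Lambda> * (norm g)\<^sup>2 + \<Sigma> * z\<^sup>2) / \<epsilon> = r1\<^sup>2 * (\<Lambda> * (norm g)\<^sup>2) / \<epsilon> + r1\<^sup>2 * (\<Sigma> * z\<^sup>2) / \<epsilon>"
        by (simp add: distrib_left add_divide_distrib)
      have "\<epsilon> * r2\<^sup>2 \<le> \<epsilon> * (r1\<^sup>2 + r2\<^sup>2)" using p(4) by (simp add: distrib_left)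
      then show ?thesis unfolding e using p k \<Lambda> \<Sigma> by (intro add_mono mult_left_mono) auto
    qed
    also have "\<dots> = K * (\<epsilon> * (r1\<^sup>2 + r2\<^sup>2) + r1\<^sup>2 * (\<Lambda> * (norm g)\<^sup>2 + \<Sigma> * z\<^sup>2) / \<epsilon>)" by (simp add: K_def distrib_right)
    finally show "\<bar>dC_var \<Lambda> \<Sigma> (x1, r1) (x2, r2) g z\<bar> \<le> K * (\<epsilon> * (r1\<^sup>2 + r2\<^sup>2) + r1\<^sup>2 * (\<Lambda> * (norm g)\<^sup>2 + \<Sigma> * z\<^sup>2) / \<epsilon>)" .
  qed
qed

lemma dC_var_diff: "dC_var \<Lambda> \<Sigma> p q (g - g') (z - z') = dC_var \<Lambda> \<Sigma> p q g z - dC_var \<Lambda> \<Sigma> p q g' z'"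
  by (simp add: dC_var_def inner_diff_right algebra_simps)

lemma dC_var_measurable:
  assumes [measurable]: "g \<in> borel_measurable borel" "z \<in> borel_measurable borel"
  shows "(\<lambda>p. dC_var \<Lambda> \<Sigma> (fst p) (snd p) (g (fst (fst p))) (z (fst (fst p)))) \<in> borel_measurable borel"
  unfolding dC_var_def by measurable

section \<open>Moving a measure along a test function\<close>

text \<open>Homogeneous projection of the moved cone points: mass is the square of the radius, hence
  the squared radial factor as density.\<close>

definition moved :: "real \<Rightarrow> real \<Rightarrow> 'a::euclidean_space measure \<Rightarrow> ('a \<Rightarrow> real) \<Rightarrow> real \<Rightarrow> 'a measure" where
  "moved \<Lambda> \<Sigma> \<mu> \<zeta> h = distr (density \<mu> (\<lambda>x. ennreal ((1 + h * \<Sigma> * \<zeta> x / 2)\<^sup>2))) borel (\<lambda>x. x + (h * \<Lambda>) *\<^sub>R grad \<zeta> x)"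

lemma fin_meas_moved:
  assumes "fin_meas \<mu>" and \<zeta>: "\<zeta> \<in> Cc_inf"
  shows "fin_meas (moved \<Lambda> \<Sigma> \<mu> \<zeta> h)"
proof -
  note [measurable] = Cc_inf_measurable[OF \<zeta>] Cc_inf_grad_measurable[OF \<zeta>] and [measurable_cong] = sets_fin_meas[OF assms(1)]
  interpret finite_measure \<mu> using assms by (simp add: fin_meas_def)
  obtain B where B: "0 \<le> B" "\<And>x. \<bar>\<zeta> x\<bar> \<le> B" using Cc_inf_bounded[OF \<zeta>] by blast
  have "(1 + h * \<Sigma> * \<zeta> x / 2)\<^sup>2 \<le> (1 + \<bar>h * \<Sigma>\<bar> * B)\<^sup>2" for x
  proof -
    have "\<bar>h * \<Sigma> * \<zeta> x\<bar> \<le> \<bar>h * \<Sigma>\<bar> * B" unfolding abs_mult[of "h * \<Sigma>"] using B by (intro mult_left_mono) auto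
    then have "\<bar>1 + h * \<Sigma> * \<zeta> x / 2\<bar> \<le> \<bar>1 + \<bar>h * \<Sigma>\<bar> * B\<bar>" using B(1) by (simp add: abs_if split: if_splits)
    then show ?thesis by (rule abs_le_square_iff[THEN iffD1])
  qed
  then have "(\<integral>\<^sup>+x. ennreal ((1 + h * \<Sigma> * \<zeta> x / 2)\<^sup>2) \<partial>\<mu>) \<le> (\<integral>\<^sup>+x. ennreal ((1 + \<bar>h * \<Sigma>\<bar> * B)\<^sup>2) \<partial>\<mu>)"
    by (intro nn_integral_mono ennreal_leI)
  also have "\<dots> < \<infinity>" by (simp add: less_top[symmetric] ennreal_mult_eq_top_iff)
  finally have "finite_measure (density \<mu> (\<lambda>x. ennreal ((1 + h * \<Sigma> * \<zeta> x / 2)\<^sup>2)))"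
    by (intro finite_measureI) (auto simp: emeasure_density cong: nn_integral_cong)
  then have "finite_measure (moved \<Lambda> \<Sigma> \<mu> \<zeta> h)"
    unfolding moved_def by (rule finite_measure.finite_measure_distr) measurable
  then show ?thesis by (simp add: fin_meas_def moved_def)
qed

text \<open>The plan itself parametrises the competitor: only its first point is moved, and the
  first homogeneous marginal becomes \<open>moved\<close>. An integrable pointwise bound of the new
  cost is then integrated against the old plan.\<close>

lemma HK_moved_le:
  fixes \<mu> \<nu> :: "'a::euclidean_space measure"
  assumes \<Sigma>: "\<Sigma> > 0" and fin: "fin_meas \<mu>" "fin_meas \<nu>" and \<zeta>: "\<zeta> \<in> Cc_inf"
    and \<gamma>: "hplan \<gamma> \<mu> \<nu>" and pos: "\<And>x. 0 \<le> 1 + h * \<Sigma> * \<zeta> x / 2"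
    and f: "integrable \<gamma> f"
    and le: "\<And>x1 r1 x2 r2. 0 \<le> r1 \<Longrightarrow> 0 \<le> r2 \<Longrightarrow>
      (dC \<Lambda> \<Sigma> (x1 + (h * \<Lambda>) *\<^sub>R grad \<zeta> x1, r1 * (1 + h * \<Sigma> * \<zeta> x1 / 2)) (x2, r2))\<^sup>2 \<le> f ((x1, r1), (x2, r2))"
  shows "(HK \<Lambda> \<Sigma> (moved \<Lambda> \<Sigma> \<mu> \<zeta> h) \<nu>)\<^sup>2 \<le> (\<integral>p. f p \<partial>\<gamma>)"
proof -
  have g: "fin_meas \<gamma>" using \<gamma> by (simp add: hplan_def)
  note [measurable] = Cc_inf_measurable[OF \<zeta>] Cc_inf_grad_measurable[OF \<zeta>]
    and [measurable_cong] = sets_fin_meas[OF fin(1)] sets_fin_meas[OF g]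
  let ?X = "\<lambda>p::('a \<times> real) \<times> ('a \<times> real). fst (fst p) + (h * \<Lambda>) *\<^sub>R grad \<zeta> (fst (fst p))"
  let ?R = "\<lambda>p::('a \<times> real) \<times> ('a \<times> real). snd (fst p) * (1 + h * \<Sigma> * \<zeta> (fst (fst p)) / 2)"
  note fm = fin_meas_moved[OF fin(1) \<zeta>, of \<Lambda> \<Sigma> h]
  have m: "distr (density \<gamma> (\<lambda>p. ennreal ((?R p)\<^sup>2))) borel ?X = moved \<Lambda> \<Sigma> \<mu> \<zeta> h"
    unfolding moved_def
  proof (rule homogeneous_marginal_cong)
    fix A :: "'a set" assume [measurable]: "A \<in> sets borel"
    have "(\<integral>\<^sup>+p. ennreal ((?R p)\<^sup>2) * indicator A (?X p) \<partial>\<gamma>) =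
        (\<integral>\<^sup>+p. ennreal ((snd (fst p))\<^sup>2) * (ennreal ((1 + h * \<Sigma> * \<zeta> (fst (fst p)) / 2)\<^sup>2) * indicator A (?X p)) \<partial>\<gamma>)"
      by (simp add: power_mult_distrib ennreal_mult mult.assoc)
    also have "\<dots> = (\<integral>\<^sup>+x. ennreal ((1 + h * \<Sigma> * \<zeta> x / 2)\<^sup>2) * indicator A (x + (h * \<Lambda>) *\<^sub>R grad \<zeta> x) \<partial>\<mu>)"
      by (rule hplan_nn_integral1[OF \<gamma>]) measurable
    finally show "(\<integral>\<^sup>+p. ennreal ((?R p)\<^sup>2) * indicator A (?X p) \<partial>\<gamma>) =
        (\<integral>\<^sup>+x. ennreal ((1 + h * \<Sigma> * \<zeta> x / 2)\<^sup>2) * indicator A (x + (h * \<Lambda>) *\<^sub>R grad \<zeta> x) \<partial>\<mu>)" .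
  qed measurable
  have AE: "AE p in \<gamma>. (dC \<Lambda> \<Sigma> (?X p, ?R p) (fst (snd p), snd (snd p)))\<^sup>2 \<le> f p"
    using hplanD(3,4)[OF \<gamma>]
  proof eventually_elim
    case (elim p)
    then show ?case using le[of "snd (fst p)" "snd (snd p)" "fst (fst p)" "fst (snd p)"] by simp
  qed
  have "ennreal ((HK \<Lambda> \<Sigma> (moved \<Lambda> \<Sigma> \<mu> \<zeta> h) \<nu>)\<^sup>2) = HK2 \<Lambda> \<Sigma> (moved \<Lambda> \<Sigma> \<mu> \<zeta> h) \<nu>"
    by (rule HK_sq[OF \<Sigma> fm fin(2)])
  also have "\<dots> \<le> (\<integral>\<^sup>+p. ennreal ((dC \<Lambda> \<Sigma> (?X p, ?R p) (fst (snd p), snd (snd p)))\<^sup>2) \<partial>\<gamma>)"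
  proof (rule HK2_le_param[OF \<Sigma> _ _ _ _ _ _ m])
    show "AE p in \<gamma>. 0 \<le> ?R p" using hplanD(3)[OF \<gamma>] by eventually_elim (intro mult_nonneg_nonneg pos)
  qed (use \<gamma> fm fin in \<open>auto simp: hplan_def fin_meas_def\<close>)
  also have "\<dots> \<le> (\<integral>\<^sup>+p. ennreal (f p) \<partial>\<gamma>)"
    using AE by (intro nn_integral_mono_AE) (auto elim!: eventually_mono intro: ennreal_leI)
  also have "\<dots> = ennreal (\<integral>p. f p \<partial>\<gamma>)"
    using AE by (intro nn_integral_eq_integral[OF f]) (auto elim!: eventually_mono intro: order_trans[OF zero_le_power2])
  finally show ?thesis
    using AE by (subst (asm) ennreal_le_iff) (auto intro!: integral_nonneg_AE elim!: eventually_mono intro: order_trans[OF zero_le_power2])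
qed

lemma test_function_small_time:
  assumes "\<Sigma> > 0" "\<zeta> \<in> Cc_inf"
  obtains \<eta> where "0 < \<eta>" "\<eta> \<le> 1" "\<And>h x. \<bar>h\<bar> \<le> \<eta> \<Longrightarrow> 0 \<le> 1 + h * \<Sigma> * \<zeta> x / 2"
proof -
  obtain B where B: "0 \<le> B" "\<And>x. \<bar>\<zeta> x\<bar> \<le> B" using Cc_inf_bounded[OF assms(2)] by blast
  define \<eta> where "\<eta> = 1 / (\<Sigma> * B + 1)"
  have p: "0 < \<Sigma> * B + 1" using assms B by (simp add: add_nonneg_pos)
  show ?thesis
  proof (rule that)
    show "0 < \<eta>" "\<eta> \<le> 1" using p assms B by (auto simp: \<eta>_def)
    fix h x assume h: "\<bar>h\<bar> \<le> \<eta>"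
    have "\<bar>h * \<Sigma> * \<zeta> x\<bar> = \<bar>h\<bar> * (\<Sigma> * \<bar>\<zeta> x\<bar>)" using assms by (simp add: abs_mult)
    also have "\<dots> \<le> \<eta> * (\<Sigma> * B)" using h assms B by (intro mult_mono) auto
    also have "\<dots> \<le> 1" using p by (simp add: \<eta>_def)
    finally show "0 \<le> 1 + h * \<Sigma> * \<zeta> x / 2" by linarith
  qed
qed

lemma Cc_inf_integrable:
  assumes "fin_meas \<mu>" and \<zeta>: "\<zeta> \<in> Cc_inf"
  shows "integrable \<mu> \<zeta>" "integrable \<mu> (\<lambda>x. \<Lambda> * (norm (grad \<zeta> x))\<^sup>2 + \<Sigma> * (\<zeta> x)\<^sup>2)"
proof -
  note [measurable] = Cc_inf_measurable[OF \<zeta>] Cc_inf_grad_measurable[OF \<zeta>] and [measurable_cong] = sets_fin_meas[OF assms(1)]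
  interpret finite_measure \<mu> using assms by (simp add: fin_meas_def)
  obtain B where B: "0 \<le> B" "\<And>x. \<bar>\<zeta> x\<bar> \<le> B" using Cc_inf_bounded[OF \<zeta>] by blast
  obtain B2 where B2: "0 \<le> B2" "\<And>x. norm (grad \<zeta> x) \<le> B2" using Cc_inf_grad_bounded[OF \<zeta>] by blast
  show "integrable \<mu> \<zeta>" by (rule integrable_const_bound[of _ B]) (use B in auto)
  have "integrable \<mu> (\<lambda>x. (norm (grad \<zeta> x))\<^sup>2)"
    by (rule integrable_const_bound[of _ "B2\<^sup>2"]) (use B2 in \<open>auto intro!: power_mono\<close>)
  moreover have "integrable \<mu> (\<lambda>x. (\<zeta> x)\<^sup>2)"
    by (rule integrable_const_bound[of _ "B\<^sup>2"]) (use B abs_le_square_iff[of _ B] in auto)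
  ultimately show "integrable \<mu> (\<lambda>x. \<Lambda> * (norm (grad \<zeta> x))\<^sup>2 + \<Sigma> * (\<zeta> x)\<^sup>2)" by auto
qed

text \<open>\<open>dC_move_test_function\<close> is integrated along near-optimal plans, where
  increments of r^2 \<zeta> become differences of integrals of \<zeta>. \<open>K\<close> and
  \<open>\<eta>\<close> are fixed before \<open>\<mu>'\<close>, since \<open>\<mu>'\<close> will be
  the point of the curve at time t + h.\<close>

lemma HK_moved_other_le:
  fixes \<mu> :: "'a::euclidean_space measure"
  assumes \<Lambda>: "\<Lambda> > 0" and \<Sigma>: "\<Sigma> > 0" and fin: "fin_meas \<mu>" and \<zeta>: "\<zeta> \<in> Cc_inf"
  obtains K \<eta> where "0 \<le> K" "0 < \<eta>" "\<And>h \<mu>'. \<bar>h\<bar> \<le> \<eta> \<Longrightarrow> fin_meas \<mu>' \<Longrightarrow>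
    (HK \<Lambda> \<Sigma> (moved \<Lambda> \<Sigma> \<mu> \<zeta> h) \<mu>')\<^sup>2 \<le> (HK \<Lambda> \<Sigma> \<mu> \<mu>')\<^sup>2 - 2 * h * ((\<integral>x. \<zeta> x \<partial>\<mu>') - (\<integral>x. \<zeta> x \<partial>\<mu>))
      + h\<^sup>2 * (\<integral>x. \<Lambda> * (norm (grad \<zeta> x))\<^sup>2 + \<Sigma> * (\<zeta> x)\<^sup>2 \<partial>\<mu>)
      + K * \<bar>h\<bar> * ((HK \<Lambda> \<Sigma> \<mu> \<mu>')\<^sup>2 + h\<^sup>2 * measure \<mu> UNIV)"
proof -
  obtain \<eta> where \<eta>: "0 < \<eta>" "\<eta> \<le> 1" "\<And>h x. \<bar>h\<bar> \<le> \<eta> \<Longrightarrow> 0 \<le> 1 + h * \<Sigma> * \<zeta> x / 2"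
    using test_function_small_time[OF \<Sigma> \<zeta>] by blast
  obtain K where K: "0 \<le> K" "\<And>x1 r1 x2 r2 h. \<lbrakk>0 \<le> r1; 0 \<le> r2; \<bar>h\<bar> \<le> 1; 0 \<le> 1 + h * \<Sigma> * \<zeta> x1 / 2\<rbrakk> \<Longrightarrow>
    (dC \<Lambda> \<Sigma> (x1 + (h * \<Lambda>) *\<^sub>R grad \<zeta> x1, r1 * (1 + h * \<Sigma> * \<zeta> x1 / 2)) (x2, r2))\<^sup>2 \<le>
    (dC \<Lambda> \<Sigma> (x1, r1) (x2, r2))\<^sup>2 - 2 * h * (r2\<^sup>2 * \<zeta> x2 - r1\<^sup>2 * \<zeta> x1)
      + h\<^sup>2 * (r1\<^sup>2 * (\<Lambda> * (norm (grad \<zeta> x1))\<^sup>2 + \<Sigma> * (\<zeta> x1)\<^sup>2))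
      + K * \<bar>h\<bar> * ((dC \<Lambda> \<Sigma> (x1, r1) (x2, r2))\<^sup>2 + h\<^sup>2 * r1\<^sup>2)"
    using dC_move_test_function[OF \<Lambda> \<Sigma> \<zeta>] by blast
  note [measurable] = Cc_inf_measurable[OF \<zeta>] Cc_inf_grad_measurable[OF \<zeta>]
  show ?thesis
  proof (rule that[OF K(1) \<eta>(1)])
    fix h :: real and \<mu>' :: "'a measure"
    assume h: "\<bar>h\<bar> \<le> \<eta>" and fin': "fin_meas \<mu>'"
    define c where "c = (HK \<Lambda> \<Sigma> \<mu> \<mu>')\<^sup>2"
    have c0: "0 \<le> c" by (simp add: c_def)
    define I where "I = (\<integral>x. \<Lambda> * (norm (grad \<zeta> x))\<^sup>2 + \<Sigma> * (\<zeta> x)\<^sup>2 \<partial>\<mu>)"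
    let ?rhs = "\<lambda>c. c - 2 * h * ((\<integral>x. \<zeta> x \<partial>\<mu>') - (\<integral>x. \<zeta> x \<partial>\<mu>)) + h\<^sup>2 * I + K * \<bar>h\<bar> * (c + h\<^sup>2 * measure \<mu> UNIV)"
    have main: "(HK \<Lambda> \<Sigma> (moved \<Lambda> \<Sigma> \<mu> \<zeta> h) \<mu>')\<^sup>2 \<le> ?rhs (c + \<epsilon>)" if \<epsilon>: "\<epsilon> > 0" for \<epsilon>
    proof -
      have "HK2 \<Lambda> \<Sigma> \<mu> \<mu>' < ennreal (c + \<epsilon>)"
        using \<epsilon> by (simp add: c_def ennreal_less_iff flip: HK_sq[OF \<Sigma> fin fin'])
      then obtain \<gamma> where \<gamma>: "hplan \<gamma> \<mu> \<mu>'" "cost \<Lambda> \<Sigma> \<gamma> < ennreal (c + \<epsilon>)" by (rule HK2_less_plan)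
      note i = hplan_cost_finite(1,2)[OF \<Sigma> \<gamma>(1) fin fin'] hplan_cost_finite(3,4)[OF \<Sigma> \<gamma>(1) fin fin', of \<Lambda>]
      define d where "d = (\<integral>p. (dC \<Lambda> \<Sigma> (fst p) (snd p))\<^sup>2 \<partial>\<gamma>)"
      have "d < c + \<epsilon>" using \<gamma>(2) unfolding i(4) d_def[symmetric] by (subst (asm) ennreal_less_iff) (auto simp: d_def)
      note ci = Cc_inf_integrable[OF fin \<zeta>] Cc_inf_integrable[OF fin' \<zeta>]
      have j1: "integrable \<gamma> (\<lambda>p. (snd (fst p))\<^sup>2 * \<zeta> (fst (fst p)))"
        using hplan_integrable1[OF \<gamma>(1), of \<zeta>] ci by simp
      have j2: "integrable \<gamma> (\<lambda>p. (snd (snd p))\<^sup>2 * \<zeta> (fst (snd p)))"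
        using hplan_integrable2[OF \<gamma>(1), of \<zeta>] ci by simp
      have j3: "integrable \<gamma> (\<lambda>p. (snd (fst p))\<^sup>2 * (\<Lambda> * (norm (grad \<zeta> (fst (fst p))))\<^sup>2 + \<Sigma> * (\<zeta> (fst (fst p)))\<^sup>2))"
        using hplan_integrable1[OF \<gamma>(1), of "\<lambda>x. \<Lambda> * (norm (grad \<zeta> x))\<^sup>2 + \<Sigma> * (\<zeta> x)\<^sup>2"] ci by simp
      let ?f = "\<lambda>p. (dC \<Lambda> \<Sigma> (fst p) (snd p))\<^sup>2 - 2 * h * ((snd (snd p))\<^sup>2 * \<zeta> (fst (snd p)) - (snd (fst p))\<^sup>2 * \<zeta> (fst (fst p)))
        + h\<^sup>2 * ((snd (fst p))\<^sup>2 * (\<Lambda> * (norm (grad \<zeta> (fst (fst p))))\<^sup>2 + \<Sigma> * (\<zeta> (fst (fst p)))\<^sup>2))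
        + K * \<bar>h\<bar> * ((dC \<Lambda> \<Sigma> (fst p) (snd p))\<^sup>2 + h\<^sup>2 * (snd (fst p))\<^sup>2)"
      have "(HK \<Lambda> \<Sigma> (moved \<Lambda> \<Sigma> \<mu> \<zeta> h) \<mu>')\<^sup>2 \<le> (\<integral>p. ?f p \<partial>\<gamma>)"
      proof (rule HK_moved_le[OF \<Sigma> fin fin' \<zeta> \<gamma>(1)])
        show "0 \<le> 1 + h * \<Sigma> * \<zeta> x / 2" for x using \<eta>(3)[OF h] .
        show "integrable \<gamma> ?f"
          by (intro Bochner_Integration.integrable_add Bochner_Integration.integrable_diff integrable_mult_right i j1 j2 j3)
        show "(dC \<Lambda> \<Sigma> (x1 + (h * \<Lambda>) *\<^sub>R grad \<zeta> x1, r1 * (1 + h * \<Sigma> * \<zeta> x1 / 2)) (x2, r2))\<^sup>2 \<le> ?f ((x1, r1), (x2, r2))"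
          if "0 \<le> r1" "0 \<le> r2" for x1 r1 x2 r2
          using K(2)[OF that, of h x1 x2] h \<eta>(2,3) by simp
      qed
      also have "(\<integral>p. ?f p \<partial>\<gamma>) = d - 2 * h * ((\<integral>p. (snd (snd p))\<^sup>2 * \<zeta> (fst (snd p)) \<partial>\<gamma>) - (\<integral>p. (snd (fst p))\<^sup>2 * \<zeta> (fst (fst p)) \<partial>\<gamma>))
          + h\<^sup>2 * (\<integral>p. (snd (fst p))\<^sup>2 * (\<Lambda> * (norm (grad \<zeta> (fst (fst p))))\<^sup>2 + \<Sigma> * (\<zeta> (fst (fst p)))\<^sup>2) \<partial>\<gamma>)
          + K * \<bar>h\<bar> * (d + h\<^sup>2 * (\<integral>p. (snd (fst p))\<^sup>2 \<partial>\<gamma>))"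
        unfolding d_def using i(1,3) j1 j2 j3 by (simp add: Bochner_Integration.integral_add Bochner_Integration.integral_diff)
      also have "(\<integral>p. (snd (snd p))\<^sup>2 * \<zeta> (fst (snd p)) \<partial>\<gamma>) = (\<integral>x. \<zeta> x \<partial>\<mu>')" by (rule hplan_integral2[OF \<gamma>(1)]) simp
      also have "(\<integral>p. (snd (fst p))\<^sup>2 * \<zeta> (fst (fst p)) \<partial>\<gamma>) = (\<integral>x. \<zeta> x \<partial>\<mu>)" by (rule hplan_integral1[OF \<gamma>(1)]) simp
      also have "(\<integral>p. (snd (fst p))\<^sup>2 * (\<Lambda> * (norm (grad \<zeta> (fst (fst p))))\<^sup>2 + \<Sigma> * (\<zeta> (fst (fst p)))\<^sup>2) \<partial>\<gamma>) = I"
        unfolding I_def by (rule hplan_integral1[OF \<gamma>(1)]) simp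
      also have "(\<integral>p. (snd (fst p))\<^sup>2 \<partial>\<gamma>) = measure \<mu> UNIV"
        using hplan_integral1[OF \<gamma>(1), of "\<lambda>_. 1"] sets_eq_imp_space_eq[OF sets_fin_meas[OF fin]] by simp
      finally have "(HK \<Lambda> \<Sigma> (moved \<Lambda> \<Sigma> \<mu> \<zeta> h) \<mu>')\<^sup>2 \<le> ?rhs d" .
      also have "\<dots> \<le> ?rhs (c + \<epsilon>)"
        using \<open>d < c + \<epsilon>\<close> K(1) by (intro add_mono diff_mono mult_left_mono order_refl) auto
      finally show ?thesis .
    qed
    have "((\<lambda>\<epsilon>. ?rhs (c + \<epsilon>)) \<longlongrightarrow> ?rhs (c + 0)) (at_right 0)" by (intro tendsto_intros)
    moreover have "\<forall>\<^sub>F \<epsilon> in at_right 0. (HK \<Lambda> \<Sigma> (moved \<Lambda> \<Sigma> \<mu> \<zeta> h) \<mu>')\<^sup>2 \<le> ?rhs (c + \<epsilon>)"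
      using main by (auto simp: eventually_at_right_field intro!: exI[of _ 1])
    ultimately have "(HK \<Lambda> \<Sigma> (moved \<Lambda> \<Sigma> \<mu> \<zeta> h) \<mu>')\<^sup>2 \<le> ?rhs (c + 0)"
      by (rule tendsto_lowerbound) simp
    then show "(HK \<Lambda> \<Sigma> (moved \<Lambda> \<Sigma> \<mu> \<zeta> h) \<mu>')\<^sup>2 \<le> (HK \<Lambda> \<Sigma> \<mu> \<mu>')\<^sup>2 - 2 * h * ((\<integral>x. \<zeta> x \<partial>\<mu>') - (\<integral>x. \<zeta> x \<partial>\<mu>))
      + h\<^sup>2 * (\<integral>x. \<Lambda> * (norm (grad \<zeta> x))\<^sup>2 + \<Sigma> * (\<zeta> x)\<^sup>2 \<partial>\<mu>)
      + K * \<bar>h\<bar> * ((HK \<Lambda> \<Sigma> \<mu> \<mu>')\<^sup>2 + h\<^sup>2 * measure \<mu> UNIV)"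
      by (simp add: c_def I_def)
  qed
qed

section \<open>The first variation integrated along a plan\<close>

lemma integrable_dC_var:
  fixes \<mu> \<nu> :: "'a::euclidean_space measure"
  assumes \<Lambda>: "\<Lambda> > 0" and \<Sigma>: "\<Sigma> > 0" and fin: "fin_meas \<mu>" "fin_meas \<nu>" and \<gamma>: "hplan \<gamma> \<mu> \<nu>"
    and [measurable]: "g \<in> borel_measurable borel" "z \<in> borel_measurable borel"
    and int: "integrable \<mu> (\<lambda>x. \<Lambda> * (norm (g x))\<^sup>2 + \<Sigma> * (z x)\<^sup>2)"
  shows "integrable \<gamma> (\<lambda>p. dC_var \<Lambda> \<Sigma> (fst p) (snd p) (g (fst (fst p))) (z (fst (fst p))))"
proof -
  have gm: "fin_meas \<gamma>" using \<gamma> by (simp add: hplan_def)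
  note [measurable_cong] = sets_fin_meas[OF gm] and [measurable] = dC_var_measurable
  obtain K where K: "0 \<le> K" "\<And>(x1::'a) r1 x2 r2 z g \<epsilon>. \<lbrakk>0 \<le> r1; 0 \<le> r2; 0 < \<epsilon>\<rbrakk> \<Longrightarrow>
    \<bar>dC_var \<Lambda> \<Sigma> (x1, r1) (x2, r2) g z\<bar> \<le> K * (\<epsilon> * (r1\<^sup>2 + r2\<^sup>2) + r1\<^sup>2 * (\<Lambda> * (norm g)\<^sup>2 + \<Sigma> * z\<^sup>2) / \<epsilon>)"
    using dC_var_bound[OF \<Lambda> \<Sigma>] by blast
  note i = hplan_cost_finite(1,2)[OF \<Sigma> \<gamma> fin]
  have j: "integrable \<gamma> (\<lambda>p. (snd (fst p))\<^sup>2 * (\<Lambda> * (norm (g (fst (fst p))))\<^sup>2 + \<Sigma> * (z (fst (fst p)))\<^sup>2))"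
    using hplan_integrable1[OF \<gamma>, of "\<lambda>x. \<Lambda> * (norm (g x))\<^sup>2 + \<Sigma> * (z x)\<^sup>2"] int by simp
  show ?thesis
  proof (rule Bochner_Integration.integrable_bound)
    show "integrable \<gamma> (\<lambda>p. K * (1 * ((snd (fst p))\<^sup>2 + (snd (snd p))\<^sup>2) + (snd (fst p))\<^sup>2 * (\<Lambda> * (norm (g (fst (fst p))))\<^sup>2 + \<Sigma> * (z (fst (fst p)))\<^sup>2) / 1))"
      using i j by simp
    show "AE p in \<gamma>. norm (dC_var \<Lambda> \<Sigma> (fst p) (snd p) (g (fst (fst p))) (z (fst (fst p))))
      \<le> norm (K * (1 * ((snd (fst p))\<^sup>2 + (snd (snd p))\<^sup>2) + (snd (fst p))\<^sup>2 * (\<Lambda> * (norm (g (fst (fst p))))\<^sup>2 + \<Sigma> * (z (fst (fst p)))\<^sup>2) / 1))"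
      using hplanD(3,4)[OF \<gamma>]
    proof eventually_elim
      case (elim p)
      from order_trans[OF K(2)[OF this, of 1 "fst (fst p)" "fst (snd p)"] abs_ge_self] show ?case by simp
    qed
  qed measurable
qed

text \<open>Continuity of the integrated first variation in the L^2 norm. Young's weight is taken
  equal to the L^2 radius \<epsilon>, so that energy / \<epsilon> is at most \<epsilon>.\<close>

lemma dC_var_integral_bound:
  fixes \<mu> \<nu> :: "'a::euclidean_space measure"
  assumes \<Lambda>: "\<Lambda> > 0" and \<Sigma>: "\<Sigma> > 0" and fin: "fin_meas \<mu>" "fin_meas \<nu>" and \<gamma>: "hplan \<gamma> \<mu> \<nu>"
  obtains K where "0 \<le> K" "\<And>g z \<epsilon>. \<lbrakk>g \<in> borel_measurable borel; z \<in> borel_measurable borel; 0 < \<epsilon>;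
      integrable \<mu> (\<lambda>x. \<Lambda> * (norm (g x))\<^sup>2 + \<Sigma> * (z x)\<^sup>2);
      (\<integral>x. \<Lambda> * (norm (g x))\<^sup>2 + \<Sigma> * (z x)\<^sup>2 \<partial>\<mu>) \<le> \<epsilon>\<^sup>2\<rbrakk> \<Longrightarrow>
    \<bar>\<integral>p. dC_var \<Lambda> \<Sigma> (fst p) (snd p) (g (fst (fst p))) (z (fst (fst p))) \<partial>\<gamma>\<bar> \<le> K * \<epsilon>"
proof -
  obtain K where K: "0 \<le> K" "\<And>(x1::'a) r1 x2 r2 z g \<epsilon>. \<lbrakk>0 \<le> r1; 0 \<le> r2; 0 < \<epsilon>\<rbrakk> \<Longrightarrow>
    \<bar>dC_var \<Lambda> \<Sigma> (x1, r1) (x2, r2) g z\<bar> \<le> K * (\<epsilon> * (r1\<^sup>2 + r2\<^sup>2) + r1\<^sup>2 * (\<Lambda> * (norm g)\<^sup>2 + \<Sigma> * z\<^sup>2) / \<epsilon>)"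
    using dC_var_bound[OF \<Lambda> \<Sigma>] by blast
  note i = hplan_cost_finite(1,2)[OF \<Sigma> \<gamma> fin]
  define R where "R = (\<integral>p. (snd (fst p))\<^sup>2 + (snd (snd p))\<^sup>2 \<partial>\<gamma>)"
  have R: "0 \<le> R" by (simp add: R_def)
  show ?thesis
  proof (rule that)
    show "0 \<le> K * (R + 1)" using K R by simp
    fix g :: "'a \<Rightarrow> 'a" and z :: "'a \<Rightarrow> real" and \<epsilon> :: real
    assume [measurable]: "g \<in> borel_measurable borel" "z \<in> borel_measurable borel" and \<epsilon>: "0 < \<epsilon>"
      and int: "integrable \<mu> (\<lambda>x. \<Lambda> * (norm (g x))\<^sup>2 + \<Sigma> * (z x)\<^sup>2)"
      and le: "(\<integral>x. \<Lambda> * (norm (g x))\<^sup>2 + \<Sigma> * (z x)\<^sup>2 \<partial>\<mu>) \<le> \<epsilon>\<^sup>2"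
    let ?e = "\<lambda>p. (snd (fst p))\<^sup>2 * (\<Lambda> * (norm (g (fst (fst p))))\<^sup>2 + \<Sigma> * (z (fst (fst p)))\<^sup>2)"
    have j: "integrable \<gamma> ?e"
      using hplan_integrable1[OF \<gamma>, of "\<lambda>x. \<Lambda> * (norm (g x))\<^sup>2 + \<Sigma> * (z x)\<^sup>2"] int by simp
    have je: "(\<integral>p. ?e p \<partial>\<gamma>) = (\<integral>x. \<Lambda> * (norm (g x))\<^sup>2 + \<Sigma> * (z x)\<^sup>2 \<partial>\<mu>)"
      by (rule hplan_integral1[OF \<gamma>]) simp
    note iv = integrable_dC_var[OF \<Lambda> \<Sigma> fin \<gamma> _ _ int]
    have "\<bar>\<integral>p. dC_var \<Lambda> \<Sigma> (fst p) (snd p) (g (fst (fst p))) (z (fst (fst p))) \<partial>\<gamma>\<bar>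
      \<le> (\<integral>p. \<bar>dC_var \<Lambda> \<Sigma> (fst p) (snd p) (g (fst (fst p))) (z (fst (fst p)))\<bar> \<partial>\<gamma>)" by (rule integral_abs_bound)
    also have "\<dots> \<le> (\<integral>p. K * (\<epsilon> * ((snd (fst p))\<^sup>2 + (snd (snd p))\<^sup>2) + ?e p / \<epsilon>) \<partial>\<gamma>)"
    proof (rule integral_mono_AE)
      show "AE p in \<gamma>. \<bar>dC_var \<Lambda> \<Sigma> (fst p) (snd p) (g (fst (fst p))) (z (fst (fst p)))\<bar> \<le> K * (\<epsilon> * ((snd (fst p))\<^sup>2 + (snd (snd p))\<^sup>2) + ?e p / \<epsilon>)"
        using hplanD(3,4)[OF \<gamma>]
      proof eventually_elim
        case (elim p)
        from K(2)[OF this \<epsilon>, of "fst (fst p)" "fst (snd p)"] show ?case by simp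
      qed
    qed (use iv i j in auto)
    also have "\<dots> = K * (\<epsilon> * R + (\<integral>p. ?e p \<partial>\<gamma>) / \<epsilon>)"
      unfolding R_def using i j by simp
    also have "\<dots> \<le> K * (\<epsilon> * R + \<epsilon>)"
      unfolding je using le K \<epsilon> by (intro mult_left_mono add_left_mono) (auto simp: divide_le_eq power2_eq_square)
    finally show "\<bar>\<integral>p. dC_var \<Lambda> \<Sigma> (fst p) (snd p) (g (fst (fst p))) (z (fst (fst p))) \<partial>\<gamma>\<bar> \<le> K * (R + 1) * \<epsilon>"
      by (simp add: algebra_simps)
  qed
qed

text \<open>The plan is fixed here, so the uniform remainder of \<open>dC_move_le\<close> integrates
  to a constant times h^2.\<close>

lemma HK_moved_var_le:
  fixes \<mu> \<nu> :: "'a::euclidean_space measure"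
  assumes \<Lambda>: "\<Lambda> > 0" and \<Sigma>: "\<Sigma> > 0" and fin: "fin_meas \<mu>" "fin_meas \<nu>" and \<gamma>: "hplan \<gamma> \<mu> \<nu>" and \<zeta>: "\<zeta> \<in> Cc_inf"
  obtains K \<eta> where "0 \<le> K" "0 < \<eta>" "\<And>h. \<bar>h\<bar> \<le> \<eta> \<Longrightarrow>
    (HK \<Lambda> \<Sigma> (moved \<Lambda> \<Sigma> \<mu> \<zeta> h) \<nu>)\<^sup>2 \<le> (\<integral>p. (dC \<Lambda> \<Sigma> (fst p) (snd p))\<^sup>2 \<partial>\<gamma>)
      + h * (\<integral>p. dC_var \<Lambda> \<Sigma> (fst p) (snd p) (grad \<zeta> (fst (fst p))) (\<zeta> (fst (fst p))) \<partial>\<gamma>) + K * h\<^sup>2"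
proof -
  obtain \<eta> where \<eta>: "0 < \<eta>" "\<eta> \<le> 1" "\<And>h x. \<bar>h\<bar> \<le> \<eta> \<Longrightarrow> 0 \<le> 1 + h * \<Sigma> * \<zeta> x / 2"
    using test_function_small_time[OF \<Sigma> \<zeta>] by blast
  obtain B1 where B1: "0 \<le> B1" "\<And>x. \<bar>\<zeta> x\<bar> \<le> B1" using Cc_inf_bounded[OF \<zeta>] by blast
  obtain B2 where B2: "0 \<le> B2" "\<And>x. norm (grad \<zeta> x) \<le> B2" using Cc_inf_grad_bounded[OF \<zeta>] by blast
  define B where "B = B1 + B2"
  have B: "0 \<le> B" "\<And>x. \<bar>\<zeta> x\<bar> \<le> B" "\<And>x. norm (grad \<zeta> x) \<le> B"
    using B1 B2 unfolding B_def by (auto intro: add_increasing add_increasing2)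
  obtain K where K: "0 \<le> K" "\<And>(x1::'a) r1 x2 r2 h z g. \<lbrakk>0 \<le> r1; 0 \<le> r2; \<bar>h\<bar> \<le> 1; 0 \<le> 1 + h * \<Sigma> * z / 2; \<bar>z\<bar> \<le> B; norm g \<le> B\<rbrakk> \<Longrightarrow>
    (dC \<Lambda> \<Sigma> (x1 + (h * \<Lambda>) *\<^sub>R g, r1 * (1 + h * \<Sigma> * z / 2)) (x2, r2))\<^sup>2 \<le>
    (dC \<Lambda> \<Sigma> (x1, r1) (x2, r2))\<^sup>2 + h * dC_var \<Lambda> \<Sigma> (x1, r1) (x2, r2) g z + K * h\<^sup>2 * (r1\<^sup>2 + r2\<^sup>2)"
    using dC_move_le[OF \<Lambda> \<Sigma> B(1)] by blast
  note [measurable] = Cc_inf_measurable[OF \<zeta>] Cc_inf_grad_measurable[OF \<zeta>]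
  note i = hplan_cost_finite(1,2)[OF \<Sigma> \<gamma> fin] hplan_cost_finite(3)[OF \<Sigma> \<gamma> fin, of \<Lambda>]
  note iv = integrable_dC_var[OF \<Lambda> \<Sigma> fin \<gamma> _ _ Cc_inf_integrable(2)[OF fin(1) \<zeta>]]
  define R where "R = (\<integral>p. (snd (fst p))\<^sup>2 + (snd (snd p))\<^sup>2 \<partial>\<gamma>)"
  have R: "0 \<le> R" by (simp add: R_def)
  show ?thesis
  proof (rule that[OF _ \<eta>(1)])
    show "0 \<le> K * R" using K R by simp
    fix h :: real assume h: "\<bar>h\<bar> \<le> \<eta>"
    let ?f = "\<lambda>p. (dC \<Lambda> \<Sigma> (fst p) (snd p))\<^sup>2 + h * dC_var \<Lambda> \<Sigma> (fst p) (snd p) (grad \<zeta> (fst (fst p))) (\<zeta> (fst (fst p)))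
      + K * h\<^sup>2 * ((snd (fst p))\<^sup>2 + (snd (snd p))\<^sup>2)"
    have "(HK \<Lambda> \<Sigma> (moved \<Lambda> \<Sigma> \<mu> \<zeta> h) \<nu>)\<^sup>2 \<le> (\<integral>p. ?f p \<partial>\<gamma>)"
    proof (rule HK_moved_le[OF \<Sigma> fin \<zeta> \<gamma>])
      show "0 \<le> 1 + h * \<Sigma> * \<zeta> x / 2" for x using \<eta>(3)[OF h] .
      show "integrable \<gamma> ?f" using i iv by simp
      show "(dC \<Lambda> \<Sigma> (x1 + (h * \<Lambda>) *\<^sub>R grad \<zeta> x1, r1 * (1 + h * \<Sigma> * \<zeta> x1 / 2)) (x2, r2))\<^sup>2 \<le> ?f ((x1, r1), (x2, r2))"
        if "0 \<le> r1" "0 \<le> r2" for x1 r1 x2 r2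
        using K(2)[OF that _ \<eta>(3)[OF h] B(2) B(3), of x1 x1 x1 x2] h \<eta>(2) by simp
    qed
    also have "(\<integral>p. ?f p \<partial>\<gamma>) = (\<integral>p. (dC \<Lambda> \<Sigma> (fst p) (snd p))\<^sup>2 \<partial>\<gamma>)
      + h * (\<integral>p. dC_var \<Lambda> \<Sigma> (fst p) (snd p) (grad \<zeta> (fst (fst p))) (\<zeta> (fst (fst p))) \<partial>\<gamma>) + K * h\<^sup>2 * R"
      unfolding R_def using i iv by simp
    finally show "(HK \<Lambda> \<Sigma> (moved \<Lambda> \<Sigma> \<mu> \<zeta> h) \<nu>)\<^sup>2 \<le> (\<integral>p. (dC \<Lambda> \<Sigma> (fst p) (snd p))\<^sup>2 \<partial>\<gamma>)
      + h * (\<integral>p. dC_var \<Lambda> \<Sigma> (fst p) (snd p) (grad \<zeta> (fst (fst p))) (\<zeta> (fst (fst p))) \<partial>\<gamma>) + K * R * h\<^sup>2" by (simp add: mult_ac)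
  qed
qed

lemma HK_commute:
  assumes "\<Sigma> > 0" "fin_meas \<mu>" "fin_meas \<nu>"
  shows "HK \<Lambda> \<Sigma> \<mu> \<nu> = HK \<Lambda> \<Sigma> \<nu> \<mu>"
  unfolding HK_def using antisym[OF HK2_commute_le[OF assms(1,3,2)] HK2_commute_le[OF assms(1,2,3)], of \<Lambda>] by simp

lemma L2norm2_finite:
  assumes "fin_meas \<mu>" "\<Lambda> > 0" "\<Sigma> > 0" and [measurable]: "v \<in> borel_measurable borel" "w \<in> borel_measurable borel"
    and "L2norm2 \<Lambda> \<Sigma> \<mu> v w < \<infinity>"
  shows "integrable \<mu> (\<lambda>x. \<Lambda> * (norm (v x))\<^sup>2 + \<Sigma> * (w x)\<^sup>2)"
    "L2norm2 \<Lambda> \<Sigma> \<mu> v w = ennreal (\<integral>x. \<Lambda> * (norm (v x))\<^sup>2 + \<Sigma> * (w x)\<^sup>2 \<partial>\<mu>)"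
proof -
  note [measurable_cong] = sets_fin_meas[OF assms(1)]
  show i: "integrable \<mu> (\<lambda>x. \<Lambda> * (norm (v x))\<^sup>2 + \<Sigma> * (w x)\<^sup>2)"
    using assms by (intro integrableI_nonneg) (auto simp: L2norm2_def)
  show "L2norm2 \<Lambda> \<Sigma> \<mu> v w = ennreal (\<integral>x. \<Lambda> * (norm (v x))\<^sup>2 + \<Sigma> * (w x)\<^sup>2 \<partial>\<mu>)"
    unfolding L2norm2_def using assms by (intro nn_integral_eq_integral[OF i]) auto
qed

section \<open>The derivative along the curve\<close>

text \<open>Divided by $h^2$, the bound on the moved measure tends to
  $|\mu_t'|^2 - 2\langle(\nabla\psi,\psi),(v,w)\rangle + |(\nabla\psi,\psi)|^2$, which is a squared $L^2$-distance
  because $|\mu_t'| = |(v,w)|$.\<close>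
lemma HK_moved_curve_le:
  fixes \<mu> :: "real \<Rightarrow> 'a::euclidean_space measure"
  assumes \<Lambda>: "\<Lambda> > 0" and \<Sigma>: "\<Sigma> > 0" and fin: "\<And>s. s \<in> {0..1} \<Longrightarrow> fin_meas (\<mu> s)" and t: "t \<in> {0<..<1}"
    and md: "((\<lambda>h. HK \<Lambda> \<Sigma> (\<mu> (t + h)) (\<mu> t) / \<bar>h\<bar>) \<longlongrightarrow> L) (at 0)"
    and vm[measurable]: "v \<in> borel_measurable borel" and wm[measurable]: "w \<in> borel_measurable borel"
    and nrm: "L2norm2 \<Lambda> \<Sigma> (\<mu> t) v w = ennreal (L\<^sup>2)"
    and \<psi>: "\<psi> \<in> Cc_inf"
    and ce: "((\<lambda>h. ((\<integral>x. \<psi> x \<partial>\<mu> (t + h)) - (\<integral>x. \<psi> x \<partial>\<mu> t)) / h) \<longlongrightarrow>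
        (\<integral>x. \<Lambda> * inner (grad \<psi> x) (v x) + \<Sigma> * \<psi> x * w x \<partial>\<mu> t)) (at 0)"
    and int: "integrable (\<mu> t) (\<lambda>x. \<Lambda> * (norm (v x - grad \<psi> x))\<^sup>2 + \<Sigma> * (w x - \<psi> x)\<^sup>2)"
    and less: "(\<integral>x. \<Lambda> * (norm (v x - grad \<psi> x))\<^sup>2 + \<Sigma> * (w x - \<psi> x)\<^sup>2 \<partial>\<mu> t) < c"
  shows "\<forall>\<^sub>F h in at 0. (HK \<Lambda> \<Sigma> (moved \<Lambda> \<Sigma> (\<mu> t) \<psi> h) (\<mu> (t + h)))\<^sup>2 \<le> c * h\<^sup>2"
proof -
  have ft: "fin_meas (\<mu> t)" using fin t by auto
  let ?q = "\<lambda>x. \<Lambda> * (norm (v x))\<^sup>2 + \<Sigma> * (w x)\<^sup>2"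
  let ?i = "\<lambda>x. \<Lambda> * (norm (grad \<psi> x))\<^sup>2 + \<Sigma> * (\<psi> x)\<^sup>2"
  let ?n = "\<lambda>x. \<Lambda> * (norm (v x - grad \<psi> x))\<^sup>2 + \<Sigma> * (w x - \<psi> x)\<^sup>2"
  let ?x = "\<lambda>x. \<Lambda> * inner (grad \<psi> x) (v x) + \<Sigma> * \<psi> x * w x"
  have q: "integrable (\<mu> t) ?q" "ennreal (L\<^sup>2) = ennreal (\<integral>x. ?q x \<partial>\<mu> t)"
    using L2norm2_finite[OF ft \<Lambda> \<Sigma> vm wm] nrm by auto
  have "0 \<le> (\<integral>x. ?q x \<partial>\<mu> t)" using \<Lambda> \<Sigma> by (intro integral_nonneg_AE) auto
  then have qL: "(\<integral>x. ?q x \<partial>\<mu> t) = L\<^sup>2" using q(2) by simp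
  have i: "integrable (\<mu> t) ?i" by (rule Cc_inf_integrable(2)[OF ft \<psi>])
  define I where "I = (\<integral>x. ?i x \<partial>\<mu> t)"
  \<comment> \<open>Polarisation: the pairing from the continuity equation is expressed by three
    squared norms.\<close>
  have "?x x = (?q x + ?i x - ?n x) / 2" for x
    unfolding power2_norm_eq_inner by (simp add: power2_eq_square inner_diff inner_commute algebra_simps)
  then have "(\<integral>x. ?x x \<partial>\<mu> t) = (\<integral>x. (?q x + ?i x - ?n x) / 2 \<partial>\<mu> t)" by (simp only:)
  also have "\<dots> = (L\<^sup>2 + I - (\<integral>x. ?n x \<partial>\<mu> t)) / 2"
    using q(1) i int by (simp only: integral_divide_zero Bochner_Integration.integral_add Bochner_Integration.integral_diff
        Bochner_Integration.integrable_add qL I_def)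
  finally have X: "(\<integral>x. ?x x \<partial>\<mu> t) = (L\<^sup>2 + I - (\<integral>x. ?n x \<partial>\<mu> t)) / 2" .
  obtain K \<eta> where K: "0 \<le> K" "0 < \<eta>" "\<And>h \<mu>'. \<bar>h\<bar> \<le> \<eta> \<Longrightarrow> fin_meas \<mu>' \<Longrightarrow>
    (HK \<Lambda> \<Sigma> (moved \<Lambda> \<Sigma> (\<mu> t) \<psi> h) \<mu>')\<^sup>2 \<le> (HK \<Lambda> \<Sigma> (\<mu> t) \<mu>')\<^sup>2 - 2 * h * ((\<integral>x. \<psi> x \<partial>\<mu>') - (\<integral>x. \<psi> x \<partial>\<mu> t))
      + h\<^sup>2 * (\<integral>x. ?i x \<partial>\<mu> t) + K * \<bar>h\<bar> * ((HK \<Lambda> \<Sigma> (\<mu> t) \<mu>')\<^sup>2 + h\<^sup>2 * measure (\<mu> t) UNIV)"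
    using HK_moved_other_le[OF \<Lambda> \<Sigma> ft \<psi>] by blast
  define m where "m = measure (\<mu> t) UNIV"
  define q where "q = (\<lambda>h. HK \<Lambda> \<Sigma> (\<mu> (t + h)) (\<mu> t) / \<bar>h\<bar>)"
  define e where "e = (\<lambda>h. ((\<integral>x. \<psi> x \<partial>\<mu> (t + h)) - (\<integral>x. \<psi> x \<partial>\<mu> t)) / h)"
  \<comment> \<open>In this quotient the error term keeps a factor |h| in front of a bounded
    quantity, because q h converges to L, and therefore disappears.\<close>
  define A where "A = (\<lambda>h. (q h)\<^sup>2 - 2 * e h + I + K * \<bar>h\<bar> * ((q h)\<^sup>2 + m))"
  have "(A \<longlongrightarrow> L\<^sup>2 - 2 * (\<integral>x. ?x x \<partial>\<mu> t) + I + K * \<bar>0\<bar> * (L\<^sup>2 + m)) (at 0)"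
    unfolding A_def using md ce by (intro tendsto_intros) (simp_all add: q_def e_def)
  then have "(A \<longlongrightarrow> (\<integral>x. ?n x \<partial>\<mu> t)) (at 0)" unfolding X by (simp add: field_simps)
  then have evA: "\<forall>\<^sub>F h in at 0. A h < c" using less by (rule order_tendstoD(2))
  have ev1: "\<forall>\<^sub>F h in at 0. \<bar>h\<bar> < min \<eta> (min t (1 - t)) \<and> h \<noteq> (0::real)"
    using K(2) t by (auto simp: eventually_at dist_real_def intro!: exI[of _ "min \<eta> (min t (1 - t))"])
  show ?thesis using evA ev1
  proof eventually_elim
    case (elim h)
    then have h: "\<bar>h\<bar> \<le> \<eta>" "h \<noteq> 0" "t + h \<in> {0..1}" by auto
    have fh: "fin_meas (\<mu> (t + h))" using fin h by auto
    have "(HK \<Lambda> \<Sigma> (\<mu> t) (\<mu> (t + h)))\<^sup>2 = h\<^sup>2 * (q h)\<^sup>2"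
      using h HK_commute[OF \<Sigma> ft fh, of \<Lambda>] by (simp add: q_def power_divide)
    moreover have "(\<integral>x. \<psi> x \<partial>\<mu> (t + h)) - (\<integral>x. \<psi> x \<partial>\<mu> t) = h * e h" using h by (simp add: e_def)
    ultimately have "(HK \<Lambda> \<Sigma> (moved \<Lambda> \<Sigma> (\<mu> t) \<psi> h) (\<mu> (t + h)))\<^sup>2
      \<le> h\<^sup>2 * (q h)\<^sup>2 - 2 * h * (h * e h) + h\<^sup>2 * I + K * \<bar>h\<bar> * (h\<^sup>2 * (q h)\<^sup>2 + h\<^sup>2 * m)"
      using K(3)[OF h(1) fh] by (simp only: m_def I_def)
    also have "\<dots> = h\<^sup>2 * A h" unfolding A_def power2_eq_square by (simp add: algebra_simps)
    also have "\<dots> \<le> c * h\<^sup>2" using elim by (simp add: mult.commute mult_left_mono)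
    finally show ?case .
  qed
qed

text \<open>Since the derivative is known to exist, one upper bound for F(t + h) - F(t) valid for
  both signs of h encloses it: h > 0 bounds it from above, h < 0 from below. The slope V found this
  way belongs to a test function and is compared with that of (v, w) at the end.\<close>

lemma HK_derivative_of_plan:
  fixes \<mu> :: "real \<Rightarrow> 'a::euclidean_space measure"
  assumes \<Lambda>: "\<Lambda> > 0" and \<Sigma>: "\<Sigma> > 0" and fin: "\<And>s. s \<in> {0..1} \<Longrightarrow> fin_meas (\<mu> s)" and fin\<nu>: "fin_meas \<nu>" and t: "t \<in> {0<..<1}"
    and md: "((\<lambda>h. HK \<Lambda> \<Sigma> (\<mu> (t + h)) (\<mu> t) / \<bar>h\<bar>) \<longlongrightarrow> L) (at 0)"
    and vm[measurable]: "v \<in> borel_measurable borel" and wm[measurable]: "w \<in> borel_measurable borel"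
    and nrm: "L2norm2 \<Lambda> \<Sigma> (\<mu> t) v w = ennreal (L\<^sup>2)"
    and D: "D \<subseteq> Cc_inf"
    and approx: "\<And>\<epsilon>. \<epsilon> > 0 \<Longrightarrow> \<exists>\<psi>\<in>D. L2norm2 \<Lambda> \<Sigma> (\<mu> t) (\<lambda>x. v x - grad \<psi> x) (\<lambda>x. w x - \<psi> x) < ennreal \<epsilon>"
    and ce: "\<And>\<psi>. \<psi> \<in> D \<Longrightarrow> ((\<lambda>h. ((\<integral>x. \<psi> x \<partial>\<mu> (t + h)) - (\<integral>x. \<psi> x \<partial>\<mu> t)) / h) \<longlongrightarrow>
        (\<integral>x. \<Lambda> * inner (grad \<psi> x) (v x) + \<Sigma> * \<psi> x * w x \<partial>\<mu> t)) (at 0)"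
    and diff: "(\<lambda>\<tau>. (HK \<Lambda> \<Sigma> (\<mu> \<tau>) \<nu>)\<^sup>2 / 2) differentiable (at t)"
    and \<gamma>: "hplan \<gamma> (\<mu> t) \<nu>" and opt: "(\<integral>p. (dC \<Lambda> \<Sigma> (fst p) (snd p))\<^sup>2 \<partial>\<gamma>) \<le> (HK \<Lambda> \<Sigma> (\<mu> t) \<nu>)\<^sup>2"
  shows "((\<lambda>\<tau>. (HK \<Lambda> \<Sigma> (\<mu> \<tau>) \<nu>)\<^sup>2 / 2) has_real_derivative
    (\<integral>p. dC_var \<Lambda> \<Sigma> (fst p) (snd p) (v (fst (fst p))) (w (fst (fst p))) \<partial>\<gamma>) / 2) (at t)"
proof -
  have ft: "fin_meas (\<mu> t)" using fin t by auto
  define F where "F = (\<lambda>\<tau>. (HK \<Lambda> \<Sigma> (\<mu> \<tau>) \<nu>)\<^sup>2)"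
  obtain l where l: "((\<lambda>\<tau>. (HK \<Lambda> \<Sigma> (\<mu> \<tau>) \<nu>)\<^sup>2 / 2) has_real_derivative l) (at t)"
    using diff real_differentiable_def by blast
  then have "((\<lambda>h. (F (t + h) / 2 - F t / 2) / h) \<longlongrightarrow> l) (at 0)" by (simp add: DERIV_def F_def)
  then have "((\<lambda>h. 2 * ((F (t + h) / 2 - F t / 2) / h)) \<longlongrightarrow> 2 * l) (at 0)" by (intro tendsto_intros)
  moreover have "2 * ((F (t + h) / 2 - F t / 2) / h) = (F (t + h) - F t) / h" for h by (simp add: diff_divide_distrib)
  ultimately have lim: "((\<lambda>h. (F (t + h) - F t) / h) \<longlongrightarrow> 2 * l) (at 0)" by simp
  let ?V = "\<lambda>g z. (\<integral>p. dC_var \<Lambda> \<Sigma> (fst p) (snd p) (g (fst (fst p))) (z (fst (fst p))) \<partial>\<gamma>)"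
  obtain K0 where K0: "0 \<le> K0" "\<And>g z \<epsilon>. \<lbrakk>g \<in> borel_measurable borel; z \<in> borel_measurable borel; 0 < \<epsilon>;
      integrable (\<mu> t) (\<lambda>x. \<Lambda> * (norm (g x))\<^sup>2 + \<Sigma> * (z x)\<^sup>2);
      (\<integral>x. \<Lambda> * (norm (g x))\<^sup>2 + \<Sigma> * (z x)\<^sup>2 \<partial>\<mu> t) \<le> \<epsilon>\<^sup>2\<rbrakk> \<Longrightarrow> \<bar>?V g z\<bar> \<le> K0 * \<epsilon>"
    using dC_var_integral_bound[OF \<Lambda> \<Sigma> ft fin\<nu> \<gamma>] by blast
  have F0: "0 \<le> F t" by (simp add: F_def)
  have main: "\<bar>2 * l - ?V v w\<bar> \<le> \<epsilon> * (1 + F t + K0)" if \<epsilon>: "0 < \<epsilon>" "\<epsilon> \<le> 1" for \<epsilon>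
  proof -
    \<comment> \<open>\<open>L2norm2\<close> is a squared norm; the bound \<epsilon>^2 makes
      \<epsilon> the L^2 radius.\<close>
    obtain \<psi> where \<psi>D: "\<psi> \<in> D" and l2: "L2norm2 \<Lambda> \<Sigma> (\<mu> t) (\<lambda>x. v x - grad \<psi> x) (\<lambda>x. w x - \<psi> x) < ennreal (\<epsilon>\<^sup>2)"
      using approx[of "\<epsilon>\<^sup>2"] \<epsilon> by auto
    have \<psi>: "\<psi> \<in> Cc_inf" using D \<psi>D by auto
    note [measurable] = Cc_inf_measurable[OF \<psi>] Cc_inf_grad_measurable[OF \<psi>]
    let ?n = "\<lambda>x. \<Lambda> * (norm (v x - grad \<psi> x))\<^sup>2 + \<Sigma> * (w x - \<psi> x)\<^sup>2"
    have n: "integrable (\<mu> t) ?n" "L2norm2 \<Lambda> \<Sigma> (\<mu> t) (\<lambda>x. v x - grad \<psi> x) (\<lambda>x. w x - \<psi> x) = ennreal (\<integral>x. ?n x \<partial>\<mu> t)"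
      by (rule L2norm2_finite[OF ft \<Lambda> \<Sigma>]; use l2 in \<open>auto simp: order_less_imp_le intro: less_trans[OF _ ennreal_less_top]\<close>)+
    have "0 \<le> (\<integral>x. ?n x \<partial>\<mu> t)" using \<Lambda> \<Sigma> by (intro integral_nonneg_AE) auto
    then have less: "(\<integral>x. ?n x \<partial>\<mu> t) < \<epsilon>\<^sup>2" using l2 unfolding n(2) by (simp add: ennreal_less_iff)
    have ev2: "\<forall>\<^sub>F h in at 0. (HK \<Lambda> \<Sigma> (moved \<Lambda> \<Sigma> (\<mu> t) \<psi> h) (\<mu> (t + h)))\<^sup>2 \<le> \<epsilon>\<^sup>2 * h\<^sup>2"
      by (rule HK_moved_curve_le[OF \<Lambda> \<Sigma> fin t md vm wm nrm \<psi> ce[OF \<psi>D] n(1) less])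
    define V where "V = ?V (grad \<psi>) \<psi>"
    obtain K \<eta> where K: "0 \<le> K" "0 < \<eta>" "\<And>h. \<bar>h\<bar> \<le> \<eta> \<Longrightarrow>
      (HK \<Lambda> \<Sigma> (moved \<Lambda> \<Sigma> (\<mu> t) \<psi> h) \<nu>)\<^sup>2 \<le> (\<integral>p. (dC \<Lambda> \<Sigma> (fst p) (snd p))\<^sup>2 \<partial>\<gamma>) + h * V + K * h\<^sup>2"
      unfolding V_def using HK_moved_var_le[OF \<Lambda> \<Sigma> ft fin\<nu> \<gamma> \<psi>] by blast
    define M where "M = 1 + 2 * K + \<bar>V\<bar>"
    define \<eta>' where "\<eta>' = min (min \<eta> 1) (min t (1 - t))"
    have \<eta>': "0 < \<eta>'" using K(2) t by (auto simp: \<eta>'_def)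
    have ev1: "\<forall>\<^sub>F h in at 0. \<bar>h\<bar> < \<eta>' \<and> h \<noteq> (0::real)"
      using \<eta>' by (auto simp: eventually_at dist_real_def intro!: exI[of _ \<eta>'])
    have ev: "\<forall>\<^sub>F h in at 0. h \<noteq> 0 \<and> F (t + h) - F t \<le> h * V + \<bar>h\<bar> * (\<epsilon> * (1 + F t)) + h\<^sup>2 * M"
      using ev1 ev2
    proof eventually_elim
      case (elim h)
      then have h: "\<bar>h\<bar> \<le> \<eta>" "\<bar>h\<bar> \<le> 1" "h \<noteq> 0" "t + h \<in> {0..1}" by (auto simp: \<eta>'_def)
      have fh: "fin_meas (\<mu> (t + h))" using fin h by auto
      have fm: "fin_meas (moved \<Lambda> \<Sigma> (\<mu> t) \<psi> h)" by (rule fin_meas_moved[OF ft \<psi>])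
      define a where "a = (HK \<Lambda> \<Sigma> (\<mu> (t + h)) (moved \<Lambda> \<Sigma> (\<mu> t) \<psi> h))\<^sup>2"
      define b where "b = (HK \<Lambda> \<Sigma> (moved \<Lambda> \<Sigma> (\<mu> t) \<psi> h) \<nu>)\<^sup>2"
      have a: "0 \<le> a" "a \<le> \<epsilon>\<^sup>2 * h\<^sup>2" using elim HK_commute[OF \<Sigma> fh fm, of \<Lambda>] by (simp_all add: a_def)
      have b: "b \<le> F t + h * V + K * h\<^sup>2" using K(3)[OF h(1)] opt by (simp add: b_def F_def)
      \<comment> \<open>Chosen to balance the losses: a <= \<epsilon>^2 h^2 = \<delta>^2, so a /
        \<delta> is at most |h| \<epsilon>, while \<delta> b contributes |h| \<epsilon> F(t) to
        first order. For this \<open>HK2_glue\<close> is applied with the weight 1 /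
        \<delta>.\<close>
      define \<delta> where "\<delta> = \<bar>h\<bar> * \<epsilon>"
      have \<delta>: "0 < \<delta>" using \<epsilon> h by (simp add: \<delta>_def)
      have "F (t + h) \<le> (1 + 1 / \<delta>) * a + (1 + 1 / (1 / \<delta>)) * b"
        unfolding F_def a_def b_def using \<delta> by (intro HK2_glue[OF \<Lambda> \<Sigma> _ fh fm fin\<nu>]) auto
      also have "\<dots> \<le> (1 + 1 / \<delta>) * (\<epsilon>\<^sup>2 * h\<^sup>2) + (1 + \<delta>) * (F t + h * V + K * h\<^sup>2)"
        using a b \<delta> by (intro add_mono mult_mono) (auto simp: b_def intro: order_trans[OF zero_le_power2])
      also have "(1 + 1 / \<delta>) * (\<epsilon>\<^sup>2 * h\<^sup>2) = \<epsilon>\<^sup>2 * h\<^sup>2 + \<bar>h\<bar> * \<epsilon>"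
      proof -
        have e: "\<epsilon>\<^sup>2 * h\<^sup>2 = \<delta>\<^sup>2" by (simp add: \<delta>_def power_mult_distrib)
        have "(1 + 1 / \<delta>) * \<delta>\<^sup>2 = \<delta>\<^sup>2 + \<delta>" using \<delta> by (simp add: power2_eq_square field_simps)
        then show ?thesis unfolding e \<delta>_def[symmetric] .
      qed
      finally have "F (t + h) \<le> \<epsilon>\<^sup>2 * h\<^sup>2 + \<bar>h\<bar> * \<epsilon> + (1 + \<bar>h\<bar> * \<epsilon>) * (F t + h * V + K * h\<^sup>2)" by (simp add: \<delta>_def)
      also have "\<dots> = F t + h * V + \<bar>h\<bar> * (\<epsilon> * (1 + F t)) + (\<epsilon>\<^sup>2 * h\<^sup>2 + K * h\<^sup>2 + \<epsilon> * (\<bar>h\<bar> * h * V) + \<bar>h\<bar> * \<epsilon> * (K * h\<^sup>2))"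
        by (simp add: algebra_simps)
      also have "\<epsilon>\<^sup>2 * h\<^sup>2 + K * h\<^sup>2 + \<epsilon> * (\<bar>h\<bar> * h * V) + \<bar>h\<bar> * \<epsilon> * (K * h\<^sup>2) \<le> 1 * h\<^sup>2 + K * h\<^sup>2 + 1 * (h\<^sup>2 * \<bar>V\<bar>) + 1 * (K * h\<^sup>2)"
      proof -
        have p1: "\<epsilon>\<^sup>2 * h\<^sup>2 \<le> 1 * h\<^sup>2" using \<epsilon> by (intro mult_right_mono) (auto simp: power_le_one)
        have "\<bar>h\<bar> * \<epsilon> \<le> 1 * 1" using h \<epsilon> by (intro mult_mono) auto
        then have p4: "\<bar>h\<bar> * \<epsilon> * (K * h\<^sup>2) \<le> 1 * (K * h\<^sup>2)" using K(1) by (intro mult_right_mono) auto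
        have "\<epsilon> * (\<bar>h\<bar> * h * V) \<le> \<epsilon> * \<bar>\<bar>h\<bar> * h * V\<bar>" using \<epsilon> by (intro mult_left_mono) auto
        also have "\<dots> \<le> 1 * \<bar>\<bar>h\<bar> * h * V\<bar>" using \<epsilon> by (intro mult_right_mono) auto
        also have "\<dots> = 1 * (h\<^sup>2 * \<bar>V\<bar>)" by (simp add: abs_mult power2_eq_square)
        finally have p3: "\<epsilon> * (\<bar>h\<bar> * h * V) \<le> 1 * (h\<^sup>2 * \<bar>V\<bar>)" .
        show ?thesis using p1 p3 p4 by (intro add_mono order_refl)
      qed
      also have "1 * h\<^sup>2 + K * h\<^sup>2 + 1 * (h\<^sup>2 * \<bar>V\<bar>) + 1 * (K * h\<^sup>2) = h\<^sup>2 * M" by (simp add: M_def algebra_simps)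
      finally show ?case using h by simp
    qed
    have evR: "\<forall>\<^sub>F h in at_right 0. h \<noteq> 0 \<and> F (t + h) - F t \<le> h * V + \<bar>h\<bar> * (\<epsilon> * (1 + F t)) + h\<^sup>2 * M"
      and evL: "\<forall>\<^sub>F h in at_left 0. h \<noteq> 0 \<and> F (t + h) - F t \<le> h * V + \<bar>h\<bar> * (\<epsilon> * (1 + F t)) + h\<^sup>2 * M"
      using ev unfolding eventually_at_split by blast+
    have up: "2 * l \<le> V + \<epsilon> * (1 + F t)"
    proof -
      have lim1: "((\<lambda>h. (F (t + h) - F t) / h) \<longlongrightarrow> 2 * l) (at_right 0)"
        using lim by (rule filterlim_mono) (auto simp: at_le)
      have "((\<lambda>h. V + \<epsilon> * (1 + F t) + h * M) \<longlongrightarrow> V + \<epsilon> * (1 + F t) + 0 * M) (at_right 0)" by (intro tendsto_intros)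
      moreover have "\<forall>\<^sub>F h in at_right 0. (F (t + h) - F t) / h \<le> V + \<epsilon> * (1 + F t) + h * M"
        using evR eventually_at_right_less[of 0]
      proof eventually_elim
        case (elim h)
        then have "(F (t + h) - F t) / h \<le> (h * V + \<bar>h\<bar> * (\<epsilon> * (1 + F t)) + h\<^sup>2 * M) / h" by (intro divide_right_mono) auto
        also have "\<dots> = V + \<epsilon> * (1 + F t) + h * M" using elim by (simp add: field_simps power2_eq_square)
        finally show ?case .
      qed
      ultimately have "2 * l \<le> V + \<epsilon> * (1 + F t) + 0 * M" using lim1 by (intro tendsto_le[OF _ _ lim1]) auto
      then show ?thesis by simp
    qed
    \<comment> \<open>Dividing by h < 0 reverses the inequality and turns |h| / h into -1.\<close>
    have lo: "V - \<epsilon> * (1 + F t) \<le> 2 * l"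
    proof -
      have lim1: "((\<lambda>h. (F (t + h) - F t) / h) \<longlongrightarrow> 2 * l) (at_left 0)"
        using lim by (rule filterlim_mono) (auto simp: at_le)
      have "((\<lambda>h. V - \<epsilon> * (1 + F t) + h * M) \<longlongrightarrow> V - \<epsilon> * (1 + F t) + 0 * M) (at_left 0)" by (intro tendsto_intros)
      moreover have "\<forall>\<^sub>F h in at_left 0. V - \<epsilon> * (1 + F t) + h * M \<le> (F (t + h) - F t) / h"
      proof -
        have "\<forall>\<^sub>F h in at_left 0. h < (0::real)" by (auto simp: eventually_at_left_field intro: exI[of _ "-1"])
        with evL show ?thesis
        proof eventually_elim
          case (elim h)
          then have "(h * V + \<bar>h\<bar> * (\<epsilon> * (1 + F t)) + h\<^sup>2 * M) / h \<le> (F (t + h) - F t) / h" by (intro divide_right_mono_neg) auto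
          moreover have "(h * V + \<bar>h\<bar> * (\<epsilon> * (1 + F t)) + h\<^sup>2 * M) / h = V - \<epsilon> * (1 + F t) + h * M"
            using elim by (simp add: field_simps power2_eq_square)
          ultimately show ?case by simp
        qed
      qed
      ultimately have "V - \<epsilon> * (1 + F t) + 0 * M \<le> 2 * l" using lim1 by (intro tendsto_le[OF _ lim1]) auto
      then show ?thesis by simp
    qed
    have iv: "integrable \<gamma> (\<lambda>p. dC_var \<Lambda> \<Sigma> (fst p) (snd p) (v (fst (fst p))) (w (fst (fst p))))"
      by (rule integrable_dC_var[OF \<Lambda> \<Sigma> ft fin\<nu> \<gamma> vm wm]) (rule L2norm2_finite(1)[OF ft \<Lambda> \<Sigma> vm wm], simp add: nrm)
    have i\<psi>: "integrable \<gamma> (\<lambda>p. dC_var \<Lambda> \<Sigma> (fst p) (snd p) (grad \<psi> (fst (fst p))) (\<psi> (fst (fst p))))"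
      by (rule integrable_dC_var[OF \<Lambda> \<Sigma> ft fin\<nu> \<gamma> _ _ Cc_inf_integrable(2)[OF ft \<psi>]]) auto
    have "?V v w - V = ?V (\<lambda>x. v x - grad \<psi> x) (\<lambda>x. w x - \<psi> x)"
      unfolding V_def dC_var_diff using iv i\<psi> by simp
    moreover have "\<bar>?V (\<lambda>x. v x - grad \<psi> x) (\<lambda>x. w x - \<psi> x)\<bar> \<le> K0 * \<epsilon>"
      using less n(1) \<epsilon> by (intro K0(2)) auto
    ultimately have "\<bar>?V v w - V\<bar> \<le> K0 * \<epsilon>" by simp
    with up lo show ?thesis by (simp add: abs_le_iff algebra_simps)
  qed
  have "\<bar>2 * l - ?V v w\<bar> \<le> 0"
  proof -
    have "((\<lambda>\<epsilon>. \<epsilon> * (1 + F t + K0)) \<longlongrightarrow> 0 * (1 + F t + K0)) (at_right 0)" by (intro tendsto_intros)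
    moreover have "\<forall>\<^sub>F \<epsilon> in at_right 0. \<bar>2 * l - ?V v w\<bar> \<le> \<epsilon> * (1 + F t + K0)"
      using main by (auto simp: eventually_at_right_field intro!: exI[of _ 1])
    ultimately have "\<bar>2 * l - ?V v w\<bar> \<le> 0 * (1 + F t + K0)" by (rule tendsto_lowerbound) simp
    then show ?thesis by simp
  qed
  then have "l = ?V v w / 2" by simp
  with l show ?thesis by simp
qed

section \<open>Optimal plans\<close>

lemma AE_add_measureD:
  assumes "sets N = sets M" "AE x in add_measure M N. P x"
  shows "AE x in M. P x"
proof -
  obtain A where A: "{x \<in> space M. \<not> P x} \<subseteq> A" "A \<in> sets M" "emeasure (add_measure M N) A = 0"
    using assms(2) by (auto elim!: AE_E)
  then have "A \<in> null_sets M" using assms(1) by (auto simp: null_sets_def emeasure_add_measure)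
  then show ?thesis by (rule AE_I') (use A in auto)
qed

lemma integrable_add_measureD:
  fixes f :: "'a \<Rightarrow> real"
  assumes "sets N = sets M" "integrable (add_measure M N) f"
  shows "integrable M f" "integrable N f"
proof -
  have m: "f \<in> borel_measurable M" "f \<in> borel_measurable N"
    using assms borel_measurable_integrable[OF assms(2)] by (simp_all cong: measurable_cong_sets)
  then have "(\<integral>\<^sup>+x. ennreal (norm (f x)) \<partial>M) + (\<integral>\<^sup>+x. ennreal (norm (f x)) \<partial>N) < \<infinity>"
    using assms nn_integral_add_measure[OF assms(1), of "\<lambda>x. ennreal (norm (f x))"] by (auto simp: integrable_iff_bounded)
  then show "integrable M f" "integrable N f" using m by (auto simp: integrable_iff_bounded)
qed

text \<open>Sending a pair at angle larger than $\pi/2$ to the vertex separately is strictly cheaper than transporting it.\<close>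
lemma optimal_plan_angle:
  fixes \<mu> \<nu> :: "'a::euclidean_space measure"
  assumes \<Sigma>: "\<Sigma> > 0" and fin: "fin_meas \<mu>" "fin_meas \<nu>" and \<gamma>: "hplan \<gamma> \<mu> \<nu>" and opt: "cost \<Lambda> \<Sigma> \<gamma> \<le> HK2 \<Lambda> \<Sigma> \<mu> \<nu>"
  shows "AE p in \<gamma>. 0 < snd (fst p) \<longrightarrow> 0 < snd (snd p) \<longrightarrow> sqrt (\<Sigma> / (4 * \<Lambda>)) * norm (fst (fst p) - fst (snd p)) \<le> pi / 2"
proof -
  have gm: "fin_meas \<gamma>" using \<gamma> by (simp add: hplan_def)
  note [measurable_cong] = sets_fin_meas[OF gm]
  define k where "k = sqrt (\<Sigma> / (4 * \<Lambda>))"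
  define bad where "bad = (\<lambda>p::('a \<times> real) \<times> ('a \<times> real). 0 < snd (fst p) \<and> 0 < snd (snd p) \<and> pi / 2 < k * norm (fst (fst p) - fst (snd p)))"
  define b where "b = (\<lambda>p. if bad p then 1 else 0 :: ennreal)"
  define g where "g = (\<lambda>p. if bad p then 0 else 1 :: ennreal)"
  have [measurable]: "Measurable.pred borel bad" unfolding bad_def by measurable
  have [measurable]: "b \<in> borel_measurable borel" "g \<in> borel_measurable borel" unfolding b_def g_def by measurable
  have gb: "g p + b p = 1" for p by (simp add: g_def b_def)
  let ?\<Psi>1 = "\<lambda>p :: ('a \<times> real) \<times> ('a \<times> real). (fst p, (0::'a, 0::real))"
  let ?\<Psi>2 = "\<lambda>p :: ('a \<times> real) \<times> ('a \<times> real). ((0::'a, 0::real), snd p)"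
  have [measurable]: "?\<Psi>1 \<in> borel_measurable borel" "?\<Psi>2 \<in> borel_measurable borel" by measurable
  define A where "A = density \<gamma> g"
  define B where "B = distr (density \<gamma> b) borel ?\<Psi>1"
  define C where "C = distr (density \<gamma> b) borel ?\<Psi>2"
  \<comment> \<open>The competitor: pairs that are not \<open>bad\<close> are kept, and each
    \<open>bad\<close> pair is replaced by two pairs with the vertex, one for each end. Homogeneous
    marginals do not change.\<close>
  define Q where "Q = add_measure A (add_measure B C)"
  have sABC: "sets A = sets borel" "sets B = sets borel" "sets C = sets borel"
    using sets_fin_meas[OF gm] by (auto simp: A_def B_def C_def)
  have sQ[measurable_cong]: "sets Q = sets borel" using sABC by (simp add: Q_def)
  have intQ: "(\<integral>\<^sup>+z. f z \<partial>Q) = (\<integral>\<^sup>+p. g p * f p \<partial>\<gamma>) + ((\<integral>\<^sup>+p. b p * f (?\<Psi>1 p) \<partial>\<gamma>) + (\<integral>\<^sup>+p. b p * f (?\<Psi>2 p) \<partial>\<gamma>))"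
    if [measurable]: "f \<in> borel_measurable borel" for f
  proof -
    have 1: "(\<integral>\<^sup>+z. f z \<partial>A) = (\<integral>\<^sup>+p. g p * f p \<partial>\<gamma>)"
      unfolding A_def by (subst nn_integral_density) measurable
    have 2: "(\<integral>\<^sup>+z. f z \<partial>B) = (\<integral>\<^sup>+p. b p * f (?\<Psi>1 p) \<partial>\<gamma>)"
      unfolding B_def by (subst nn_integral_distr, measurable, subst nn_integral_density) measurable
    have 3: "(\<integral>\<^sup>+z. f z \<partial>C) = (\<integral>\<^sup>+p. b p * f (?\<Psi>2 p) \<partial>\<gamma>)"
      unfolding C_def by (subst nn_integral_distr, measurable, subst nn_integral_density) measurable
    have mA: "f \<in> borel_measurable A" "f \<in> borel_measurable B"
      using that sABC by (simp_all cong: measurable_cong_sets)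
    show ?thesis unfolding Q_def using mA sABC by (simp add: nn_integral_add_measure 1 2 3)
  qed
  have nn: "AE z in Q. 0 \<le> snd (fst z)" "AE z in Q. 0 \<le> snd (snd z)"
  proof -
    have nn\<gamma>: "AE z in \<gamma>. 0 \<le> snd (fst z) \<and> 0 \<le> snd (snd z)" using hplanD(3,4)[OF \<gamma>] by auto
    have "AE z in A. 0 \<le> snd (fst z) \<and> 0 \<le> snd (snd z)"
      unfolding A_def using nn\<gamma> by (subst AE_density) auto
    moreover have "AE z in B. 0 \<le> snd (fst z) \<and> 0 \<le> snd (snd z)"
      unfolding B_def using nn\<gamma> by (subst AE_distr_iff; simp add: AE_density) auto
    moreover have "AE z in C. 0 \<le> snd (fst z) \<and> 0 \<le> snd (snd z)"
      unfolding C_def using nn\<gamma> by (subst AE_distr_iff; simp add: AE_density) auto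
    ultimately have "AE z in Q. 0 \<le> snd (fst z) \<and> 0 \<le> snd (snd z)"
      unfolding Q_def using sABC by (intro AE_add_measure) auto
    then show "AE z in Q. 0 \<le> snd (fst z)" "AE z in Q. 0 \<le> snd (snd z)" by auto
  qed
  have split: "(\<integral>\<^sup>+p. g p * f p \<partial>\<gamma>) + (\<integral>\<^sup>+p. b p * f p \<partial>\<gamma>) = (\<integral>\<^sup>+p. f p \<partial>\<gamma>)"
    if [measurable]: "f \<in> borel_measurable borel" for f
    by (subst nn_integral_add[symmetric]) (auto simp: distrib_right[symmetric] gb)
  have m1: "distr (density Q (\<lambda>z. ennreal ((snd (fst z))\<^sup>2))) borel (\<lambda>z. fst (fst z)) = \<mu>"
  proof -
    have "distr (density Q (\<lambda>z. ennreal ((snd (fst z))\<^sup>2))) borel (\<lambda>z. fst (fst z))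
        = distr (density \<gamma> (\<lambda>z. ennreal ((snd (fst z))\<^sup>2))) borel (\<lambda>z. fst (fst z))"
    proof (rule homogeneous_marginal_cong)
      fix E :: "'a set" assume [measurable]: "E \<in> sets borel"
      show "(\<integral>\<^sup>+p. ennreal ((snd (fst p))\<^sup>2) * indicator E (fst (fst p)) \<partial>Q) = (\<integral>\<^sup>+p. ennreal ((snd (fst p))\<^sup>2) * indicator E (fst (fst p)) \<partial>\<gamma>)"
        using split[of "\<lambda>p. ennreal ((snd (fst p))\<^sup>2) * indicator E (fst (fst p))"] by (subst intQ) auto
    qed measurable
    then show ?thesis using \<gamma> by (simp add: hplan_def)
  qed
  have m2: "distr (density Q (\<lambda>z. ennreal ((snd (snd z))\<^sup>2))) borel (\<lambda>z. fst (snd z)) = \<nu>"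
  proof -
    have "distr (density Q (\<lambda>z. ennreal ((snd (snd z))\<^sup>2))) borel (\<lambda>z. fst (snd z))
        = distr (density \<gamma> (\<lambda>z. ennreal ((snd (snd z))\<^sup>2))) borel (\<lambda>z. fst (snd z))"
    proof (rule homogeneous_marginal_cong)
      fix E :: "'a set" assume [measurable]: "E \<in> sets borel"
      show "(\<integral>\<^sup>+p. ennreal ((snd (snd p))\<^sup>2) * indicator E (fst (snd p)) \<partial>Q) = (\<integral>\<^sup>+p. ennreal ((snd (snd p))\<^sup>2) * indicator E (fst (snd p)) \<partial>\<gamma>)"
        using split[of "\<lambda>p. ennreal ((snd (snd p))\<^sup>2) * indicator E (fst (snd p))"] by (subst intQ) auto
    qed measurable
    then show ?thesis using \<gamma> by (simp add: hplan_def)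
  qed
  let ?d = "\<lambda>p. ennreal ((dC \<Lambda> \<Sigma> (fst p) (snd p))\<^sup>2)"
  let ?e = "\<lambda>p. ennreal (4 / \<Sigma> * ((snd (fst p))\<^sup>2 + (snd (snd p))\<^sup>2))"
  \<comment> \<open>Excess of transporting a \<open>bad\<close> pair over sending both ends to the
    vertex; it is positive because the cosine of such a pair is negative.\<close>
  let ?w = "\<lambda>p. ennreal (- 8 / \<Sigma> * (snd (fst p) * snd (snd p) * ccos (k * norm (fst (fst p) - fst (snd p)))))"
  have cpos: "snd (fst p) * snd (snd p) * ccos (k * norm (fst (fst p) - fst (snd p))) < 0" if "bad p" for p
  proof -
    let ?m = "min (k * norm (fst (fst p) - fst (snd p))) pi"
    have "cos ?m < cos (pi / 2)" using that by (intro cos_monotone_0_pi) (auto simp: bad_def)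
    then have "ccos (k * norm (fst (fst p) - fst (snd p))) < 0" by (simp add: ccos_def)
    then show ?thesis using that by (auto simp: bad_def intro!: mult_pos_neg)
  qed
  have bd: "b p * ?d p = b p * ?e p + b p * ?w p" for p
  proof (cases "bad p")
    case True
    have "(dC \<Lambda> \<Sigma> (fst p) (snd p))\<^sup>2 = 4 / \<Sigma> * ((snd (fst p))\<^sup>2 + (snd (snd p))\<^sup>2)
        + (- 8 / \<Sigma> * (snd (fst p) * snd (snd p) * ccos (k * norm (fst (fst p) - fst (snd p)))))"
      unfolding dC_sq[OF \<Sigma>] k_def[symmetric] by (simp add: algebra_simps diff_divide_distrib)
    moreover have "0 \<le> - 8 / \<Sigma> * (snd (fst p) * snd (snd p) * ccos (k * norm (fst (fst p) - fst (snd p))))"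
      using cpos[OF True] \<Sigma> by (intro mult_nonpos_nonpos) auto
    ultimately show ?thesis using \<Sigma> True by (simp add: b_def ennreal_plus[symmetric] del: ennreal_plus)
  qed (simp add: b_def)
  have "(\<integral>\<^sup>+p. ?d p \<partial>\<gamma>) \<le> HK2 \<Lambda> \<Sigma> \<mu> \<nu>" using opt by (simp add: cost_def)
  also have "\<dots> \<le> (\<integral>\<^sup>+z. ennreal ((dC \<Lambda> \<Sigma> (fst (fst z), snd (fst z)) (fst (snd z), snd (snd z)))\<^sup>2) \<partial>Q)"
    using fin by (intro HK2_le_param[OF \<Sigma>] nn m1 m2) (auto simp: fin_meas_def)
  also have "\<dots> = (\<integral>\<^sup>+z. ?d z \<partial>Q)" by simp
  also have "\<dots> = (\<integral>\<^sup>+p. g p * ?d p \<partial>\<gamma>) + ((\<integral>\<^sup>+p. b p * ?d (?\<Psi>1 p) \<partial>\<gamma>) + (\<integral>\<^sup>+p. b p * ?d (?\<Psi>2 p) \<partial>\<gamma>))"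
    by (rule intQ) measurable
  also have "(\<integral>\<^sup>+p. b p * ?d (?\<Psi>1 p) \<partial>\<gamma>) + (\<integral>\<^sup>+p. b p * ?d (?\<Psi>2 p) \<partial>\<gamma>) = (\<integral>\<^sup>+p. b p * ?d (?\<Psi>1 p) + b p * ?d (?\<Psi>2 p) \<partial>\<gamma>)"
    by (rule nn_integral_add[symmetric]) measurable
  also have "\<dots> = (\<integral>\<^sup>+p. b p * ?e p \<partial>\<gamma>)"
  proof (rule nn_integral_cong)
    fix p :: "('a \<times> real) \<times> ('a \<times> real)"
    have "?d (?\<Psi>1 p) = ennreal (4 / \<Sigma> * (snd (fst p))\<^sup>2)" "?d (?\<Psi>2 p) = ennreal (4 / \<Sigma> * (snd (snd p))\<^sup>2)"
      by (simp_all add: dC_sq[OF \<Sigma>])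
    then have "?d (?\<Psi>1 p) + ?d (?\<Psi>2 p) = ?e p"
      using \<Sigma> by (simp only: distrib_left[of "4 / \<Sigma>"]) (subst ennreal_plus, auto)
    then show "b p * ?d (?\<Psi>1 p) + b p * ?d (?\<Psi>2 p) = b p * ?e p" by (simp only: distrib_left[symmetric])
  qed
  finally have le: "(\<integral>\<^sup>+p. ?d p \<partial>\<gamma>) \<le> (\<integral>\<^sup>+p. g p * ?d p \<partial>\<gamma>) + (\<integral>\<^sup>+p. b p * ?e p \<partial>\<gamma>)" .
  have "(\<integral>\<^sup>+p. ?d p \<partial>\<gamma>) = (\<integral>\<^sup>+p. g p * ?d p \<partial>\<gamma>) + (\<integral>\<^sup>+p. b p * ?e p + b p * ?w p \<partial>\<gamma>)"
    unfolding bd[symmetric] by (rule split[symmetric]) measurable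
  also have "\<dots> = ((\<integral>\<^sup>+p. g p * ?d p \<partial>\<gamma>) + (\<integral>\<^sup>+p. b p * ?e p \<partial>\<gamma>)) + (\<integral>\<^sup>+p. b p * ?w p \<partial>\<gamma>)"
    by (subst nn_integral_add) (auto simp: add.assoc)
  finally have eq: "(\<integral>\<^sup>+p. ?d p \<partial>\<gamma>) = ((\<integral>\<^sup>+p. g p * ?d p \<partial>\<gamma>) + (\<integral>\<^sup>+p. b p * ?e p \<partial>\<gamma>)) + (\<integral>\<^sup>+p. b p * ?w p \<partial>\<gamma>)" .
  have "(\<integral>\<^sup>+p. ?d p \<partial>\<gamma>) < \<infinity>" using hplan_cost_finite(4)[OF \<Sigma> \<gamma> fin, of \<Lambda>] by (simp add: cost_def)
  then have "(\<integral>\<^sup>+p. g p * ?d p \<partial>\<gamma>) + (\<integral>\<^sup>+p. b p * ?e p \<partial>\<gamma>) \<noteq> \<infinity>" unfolding eq by auto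
  \<comment> \<open>Optimality forces the integrated excess to vanish; this cancellation in
    \<open>ennreal\<close> relies on the finite cost.\<close>
  moreover have "y = 0" if "x + y \<le> x" "x \<noteq> \<infinity>" for x y :: ennreal
    using that ennreal_add_left_cancel_le[of x y 0] by simp
  ultimately have "(\<integral>\<^sup>+p. b p * ?w p \<partial>\<gamma>) = 0" using le[unfolded eq] by blast
  then have "AE p in \<gamma>. b p * ?w p = 0" by (subst (asm) nn_integral_0_iff_AE) measurable
  then show ?thesis
  proof eventually_elim
    case (elim p)
    have "\<not> bad p"
    proof
      assume bad: "bad p"
      then have "0 < - 8 / \<Sigma> * (snd (fst p) * snd (snd p) * ccos (k * norm (fst (fst p) - fst (snd p))))"
        using cpos[OF bad] \<Sigma> by (intro mult_neg_neg) auto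
      then have "?w p \<noteq> 0" by (metis ennreal_eq_0_iff not_less)
      then show False using elim bad by (simp add: b_def)
    qed
    then show ?case by (auto simp: bad_def k_def not_less)
  qed
qed

text \<open>Lifts with full homogeneous marginals are admissible with zero residual mass, and there
  the objective is just \<open>WC2\<close>. So the minimum with residual masses lies below
  \<open>HK2\<close>, which makes the plan completed by vertex pairs optimal.\<close>

lemma HK_obj_le_HK2:
  assumes opt: "\<And>\<alpha>1 \<alpha>2. HK_admissible \<mu> \<nu> \<alpha>1 \<alpha>2 \<Longrightarrow> HK_obj \<Lambda> \<Sigma> \<mu> \<nu> \<alpha>t \<alpha>s \<le> HK_obj \<Lambda> \<Sigma> \<mu> \<nu> \<alpha>1 \<alpha>2"
  shows "HK_obj \<Lambda> \<Sigma> \<mu> \<nu> \<alpha>t \<alpha>s \<le> HK2 \<Lambda> \<Sigma> \<mu> \<nu>"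
  unfolding HK2_def
proof (rule INF_greatest)
  fix a assume a: "a \<in> {(\<alpha>1, \<alpha>2). M2C \<alpha>1 \<and> M2C \<alpha>2 \<and> hmap \<alpha>1 = \<mu> \<and> hmap \<alpha>2 = \<nu>}"
  then have "HK_admissible \<mu> \<nu> (fst a) (snd a)" by (auto simp: HK_admissible_def meas_le_def)
  from opt[OF this] a show "HK_obj \<Lambda> \<Sigma> \<mu> \<nu> \<alpha>t \<alpha>s \<le> WC2 \<Lambda> \<Sigma> (fst a) (snd a)" by (auto simp: HK_obj_def)
qed

lemma residual_measure:
  assumes fin: "fin_meas \<mu>" and \<alpha>: "fin_meas \<alpha>" and le: "meas_le \<alpha> \<mu>"
  shows "fin_meas (diff_measure \<mu> \<alpha>)" "add_measure \<alpha> (diff_measure \<mu> \<alpha>) = \<mu>"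
    "measure (diff_measure \<mu> \<alpha>) UNIV = measure \<mu> UNIV - measure \<alpha> UNIV"
proof -
  have s: "sets \<mu> = sets borel" "sets \<alpha> = sets borel" using fin \<alpha> by (auto simp: fin_meas_def)
  interpret \<mu>: finite_measure \<mu> using fin by (simp add: fin_meas_def)
  interpret \<alpha>: finite_measure \<alpha> using \<alpha> by (simp add: fin_meas_def)
  have e: "emeasure (diff_measure \<mu> \<alpha>) A = emeasure \<mu> A - emeasure \<alpha> A" if "A \<in> sets borel" for A
    using that le s by (intro emeasure_diff_measure \<mu>.finite_measure_axioms \<alpha>.finite_measure_axioms) (auto simp: meas_le_def)
  have U: "emeasure \<alpha> UNIV \<le> emeasure \<mu> UNIV" using le s by (auto simp: meas_le_def)
  have e': "emeasure (diff_measure \<mu> \<alpha>) UNIV = ennreal (measure \<mu> UNIV - measure \<alpha> UNIV)"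
    using e[of UNIV] by (simp add: \<mu>.emeasure_eq_measure \<alpha>.emeasure_eq_measure ennreal_minus)
  then have "finite_measure (diff_measure \<mu> \<alpha>)"
    using sets_eq_imp_space_eq[OF s(1)] by (intro finite_measureI) auto
  then show "fin_meas (diff_measure \<mu> \<alpha>)" using s by (simp add: fin_meas_def)
  show "measure (diff_measure \<mu> \<alpha>) UNIV = measure \<mu> UNIV - measure \<alpha> UNIV"
    using e' U by (simp add: measure_def[of "diff_measure \<mu> \<alpha>"] \<mu>.emeasure_eq_measure \<alpha>.emeasure_eq_measure)
  show "add_measure \<alpha> (diff_measure \<mu> \<alpha>) = \<mu>"
  proof (rule measure_eqI)
    fix A assume "A \<in> sets (add_measure \<alpha> (diff_measure \<mu> \<alpha>))"
    then have A: "A \<in> sets borel" using s by simp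
    then have "emeasure \<alpha> A \<le> emeasure \<mu> A" using le s by (auto simp: meas_le_def)
    then show "emeasure (add_measure \<alpha> (diff_measure \<mu> \<alpha>)) A = emeasure \<mu> A"
      using A s by (simp add: emeasure_add_measure e)
  qed (use s in simp)
qed

text \<open>The continuity equation at the time t is given for functions of \<open>D\<close>, so
  approximants have to be found there. Uniform C^1 closeness \<delta> adds at most 2 (\<Lambda> +
  \<Sigma>) \<delta>^2 per unit mass to twice the old error, and the mass is finite.\<close>

lemma L2_approx_dense:
  fixes \<mu> :: "'a::euclidean_space measure"
  assumes \<Lambda>: "\<Lambda> > 0" and \<Sigma>: "\<Sigma> > 0" and fin: "fin_meas \<mu>" and D: "C1_dense_countable D"
    and [measurable]: "v \<in> borel_measurable borel" "w \<in> borel_measurable borel"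
    and ap: "\<forall>\<epsilon>>0. \<exists>\<zeta>\<in>Cc_inf. L2norm2 \<Lambda> \<Sigma> \<mu> (\<lambda>x. v x - grad \<zeta> x) (\<lambda>x. w x - \<zeta> x) < ennreal \<epsilon>"
    and \<epsilon>: "\<epsilon> > 0"
  shows "\<exists>\<psi>\<in>D. L2norm2 \<Lambda> \<Sigma> \<mu> (\<lambda>x. v x - grad \<psi> x) (\<lambda>x. w x - \<psi> x) < ennreal \<epsilon>"
proof -
  note [measurable_cong] = sets_fin_meas[OF fin]
  interpret finite_measure \<mu> using fin by (simp add: fin_meas_def)
  obtain \<zeta> where \<zeta>: "\<zeta> \<in> Cc_inf" and l2: "L2norm2 \<Lambda> \<Sigma> \<mu> (\<lambda>x. v x - grad \<zeta> x) (\<lambda>x. w x - \<zeta> x) < ennreal (\<epsilon> / 4)"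
    using ap[rule_format, of "\<epsilon> / 4"] \<epsilon> by auto
  note [measurable] = Cc_inf_measurable[OF \<zeta>] Cc_inf_grad_measurable[OF \<zeta>]
  let ?n = "\<lambda>x. \<Lambda> * (norm (v x - grad \<zeta> x))\<^sup>2 + \<Sigma> * (w x - \<zeta> x)\<^sup>2"
  have n: "integrable \<mu> ?n" "L2norm2 \<Lambda> \<Sigma> \<mu> (\<lambda>x. v x - grad \<zeta> x) (\<lambda>x. w x - \<zeta> x) = ennreal (\<integral>x. ?n x \<partial>\<mu>)"
    by (rule L2norm2_finite[OF fin \<Lambda> \<Sigma>]; use l2 in \<open>auto simp: order_less_imp_le intro: less_trans[OF _ ennreal_less_top]\<close>)+
  have n0: "0 \<le> (\<integral>x. ?n x \<partial>\<mu>)" using \<Lambda> \<Sigma> by (intro integral_nonneg_AE) auto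
  then have less: "(\<integral>x. ?n x \<partial>\<mu>) < \<epsilon> / 4" using l2 unfolding n(2) by (simp add: ennreal_less_iff)
  define m where "m = measure \<mu> (space \<mu>)"
  \<comment> \<open>Error budget: twice the bound \<epsilon> / 4 for \<zeta>, plus \<epsilon> / 2
    for the uniform closeness, through \<delta>^2 <= \<delta> <= \<epsilon> / k. Using m + 1 keeps k
    positive for the zero measure.\<close>
  define k where "k = 4 * (\<Lambda> + \<Sigma>) * (m + 1)"
  have m0: "0 \<le> m" by (simp add: m_def)
  have k: "0 < k" using \<Lambda> \<Sigma> m0 by (simp add: k_def)
  define \<delta> where "\<delta> = min 1 (\<epsilon> / k)"
  have \<delta>: "0 < \<delta>" "\<delta> \<le> 1" "\<delta> \<le> \<epsilon> / k" using \<epsilon> k by (auto simp: \<delta>_def)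
  have "\<delta>\<^sup>2 \<le> \<delta>" using \<delta> by (simp add: power2_eq_square mult_left_le)
  also have "\<dots> \<le> \<epsilon> / k" by (rule \<delta>)
  finally have "\<delta>\<^sup>2 * k \<le> \<epsilon>" using k by (simp add: le_divide_eq)
  moreover have "2 * (\<Lambda> + \<Sigma>) * \<delta>\<^sup>2 * m \<le> 2 * (\<Lambda> + \<Sigma>) * \<delta>\<^sup>2 * (m + 1)" using \<Lambda> \<Sigma> by (intro mult_left_mono) auto
  ultimately have \<delta>m: "2 * (\<Lambda> + \<Sigma>) * \<delta>\<^sup>2 * m \<le> \<epsilon> / 2" by (simp add: k_def algebra_simps)
  obtain \<psi> where \<psi>: "\<psi> \<in> D" "\<And>x. \<bar>\<zeta> x - \<psi> x\<bar> \<le> \<delta> \<and> norm (grad \<zeta> x - grad \<psi> x) \<le> \<delta>"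
    using D \<zeta> \<delta>(1) unfolding C1_dense_countable_def by blast
  have sq: "(norm (a + b))\<^sup>2 \<le> 2 * (norm a)\<^sup>2 + 2 * (norm b)\<^sup>2" for a b :: "'b::real_inner"
  proof -
    have "(norm (a + b))\<^sup>2 \<le> (norm a + norm b)\<^sup>2" by (intro power_mono norm_triangle_ineq) auto
    also have "\<dots> \<le> 2 * (norm a)\<^sup>2 + 2 * (norm b)\<^sup>2" using young_square[of 1 "norm a" "norm b"] by simp
    finally show ?thesis .
  qed
  have pt: "\<Lambda> * (norm (v x - grad \<psi> x))\<^sup>2 + \<Sigma> * (w x - \<psi> x)\<^sup>2 \<le> 2 * ?n x + 2 * (\<Lambda> + \<Sigma>) * \<delta>\<^sup>2" for x
  proof -
    have "(norm (v x - grad \<psi> x))\<^sup>2 \<le> 2 * (norm (v x - grad \<zeta> x))\<^sup>2 + 2 * (norm (grad \<zeta> x - grad \<psi> x))\<^sup>2"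
      using sq[of "v x - grad \<zeta> x" "grad \<zeta> x - grad \<psi> x"] by simp
    also have "(norm (grad \<zeta> x - grad \<psi> x))\<^sup>2 \<le> \<delta>\<^sup>2" using \<psi>(2)[of x] by (intro power_mono) auto
    finally have 1: "(norm (v x - grad \<psi> x))\<^sup>2 \<le> 2 * (norm (v x - grad \<zeta> x))\<^sup>2 + 2 * \<delta>\<^sup>2" by simp
    have "(w x - \<psi> x)\<^sup>2 \<le> 2 * (w x - \<zeta> x)\<^sup>2 + 2 * (\<zeta> x - \<psi> x)\<^sup>2"
      using sq[of "w x - \<zeta> x" "\<zeta> x - \<psi> x"] by simp
    also have "(\<zeta> x - \<psi> x)\<^sup>2 \<le> \<delta>\<^sup>2" using \<psi>(2)[of x] \<delta>(1) by (simp add: abs_le_square_iff[symmetric])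
    finally have 2: "(w x - \<psi> x)\<^sup>2 \<le> 2 * (w x - \<zeta> x)\<^sup>2 + 2 * \<delta>\<^sup>2" by simp
    have "\<Lambda> * (norm (v x - grad \<psi> x))\<^sup>2 + \<Sigma> * (w x - \<psi> x)\<^sup>2
      \<le> \<Lambda> * (2 * (norm (v x - grad \<zeta> x))\<^sup>2 + 2 * \<delta>\<^sup>2) + \<Sigma> * (2 * (w x - \<zeta> x)\<^sup>2 + 2 * \<delta>\<^sup>2)"
      using 1 2 \<Lambda> \<Sigma> by (intro add_mono mult_left_mono) auto
    then show ?thesis by (simp add: algebra_simps)
  qed
  have "L2norm2 \<Lambda> \<Sigma> \<mu> (\<lambda>x. v x - grad \<psi> x) (\<lambda>x. w x - \<psi> x) \<le> (\<integral>\<^sup>+x. ennreal (2 * ?n x + 2 * (\<Lambda> + \<Sigma>) * \<delta>\<^sup>2) \<partial>\<mu>)"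
    unfolding L2norm2_def using pt by (intro nn_integral_mono ennreal_leI)
  also have "\<dots> = ennreal (\<integral>x. 2 * ?n x + 2 * (\<Lambda> + \<Sigma>) * \<delta>\<^sup>2 \<partial>\<mu>)"
    using \<Lambda> \<Sigma> by (intro nn_integral_eq_integral Bochner_Integration.integrable_add[OF integrable_mult_right[OF n(1)] integrable_const]) auto
  also have "(\<integral>x. 2 * ?n x + 2 * (\<Lambda> + \<Sigma>) * \<delta>\<^sup>2 \<partial>\<mu>) = (\<integral>x. 2 * ?n x \<partial>\<mu>) + (\<integral>x. 2 * (\<Lambda> + \<Sigma>) * \<delta>\<^sup>2 \<partial>\<mu>)"
    by (rule Bochner_Integration.integral_add[OF integrable_mult_right[OF n(1)] integrable_const])
  also have "\<dots> = 2 * (\<integral>x. ?n x \<partial>\<mu>) + 2 * (\<Lambda> + \<Sigma>) * \<delta>\<^sup>2 * m"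
    by (simp only: integral_mult_right_zero) (simp add: m_def mult_ac)
  also have "ennreal \<dots> < ennreal \<epsilon>" using less \<delta>m \<epsilon> by (intro ennreal_lessI) auto
  finally show ?thesis using \<psi>(1) by blast
qed

text \<open>Up to angle pi the truncations are inactive and \<open>S_fun\<close> equals -k csinc (k
  |u|) u with u = x1 - x2; the identity sqrt (\<Lambda>/\<Sigma>) k = 1/2 then matches the
  coefficients. If a radius is 0, both sides reduce to 4 z r1^2.\<close>

lemma dC_var_eq_of_angle:
  fixes x1 x2 g :: "'a::euclidean_space"
  assumes \<Lambda>: "\<Lambda> > 0" and \<Sigma>: "\<Sigma> > 0" and r: "0 \<le> r1" "0 \<le> r2"
    and a: "0 < r1 \<Longrightarrow> 0 < r2 \<Longrightarrow> sqrt (\<Sigma> / (4 * \<Lambda>)) * norm (x1 - x2) \<le> pi / 2"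
  shows "dC_var \<Lambda> \<Sigma> (x1, r1) (x2, r2) g z = 4 * (r1\<^sup>2 * z - r1 * r2 * z * cos (sqrt (\<Sigma> / (4 * \<Lambda>)) * norm (x1 - x2))
       - r1 * r2 * sqrt (\<Lambda> / \<Sigma>) * inner (S_fun \<Lambda> \<Sigma> x1 x2) g)"
proof (cases "r1 = 0 \<or> r2 = 0")
  case True
  then show ?thesis by (auto simp: dC_var_def)
next
  case False
  define k where "k = sqrt (\<Sigma> / (4 * \<Lambda>))"
  define u where "u = x1 - x2"
  have k: "0 < k" using \<Lambda> \<Sigma> by (simp add: k_def)
  have "k * norm u \<le> pi / 2" using False r a by (simp add: k_def u_def)
  then have a': "k * norm u \<le> pi" using pi_ge_zero by linarith
  have C: "ccos (k * norm u) = cos (k * norm u)" using a' by (simp add: ccos_def)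
  have k2: "sqrt (\<Lambda> / \<Sigma>) * k = 1 / 2"
  proof -
    have "sqrt (\<Lambda> / \<Sigma>) * k = sqrt (\<Lambda> / \<Sigma> * (\<Sigma> / (4 * \<Lambda>)))" by (simp only: k_def real_sqrt_mult)
    also have "\<Lambda> / \<Sigma> * (\<Sigma> / (4 * \<Lambda>)) = (1 / 2)\<^sup>2" using \<Lambda> \<Sigma> by (simp add: power2_eq_square)
    finally show ?thesis by simp
  qed
  have S: "sqrt (\<Lambda> / \<Sigma>) * inner (S_fun \<Lambda> \<Sigma> x1 x2) g = - (csinc (k * norm u) * inner u g) / 2"
  proof (cases "x1 = x2")
    case True
    then show ?thesis by (simp add: S_fun_def u_def)
  next
    case neq: False
    then have u0: "norm u \<noteq> 0" by (simp add: u_def)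
    have "S_fun \<Lambda> \<Sigma> x1 x2 = (sin (k * norm u) / norm u) *\<^sub>R (x2 - x1)" using neq by (simp add: S_fun_def k_def u_def)
    moreover have "x2 - x1 = - u" by (simp add: u_def)
    moreover have "sin (k * norm u) / norm u = k * csinc (k * norm u)" using u0 k a' by (simp add: csinc_def)
    ultimately have "S_fun \<Lambda> \<Sigma> x1 x2 = (k * csinc (k * norm u)) *\<^sub>R (- u)" by simp
    then have "sqrt (\<Lambda> / \<Sigma>) * inner (S_fun \<Lambda> \<Sigma> x1 x2) g = - (sqrt (\<Lambda> / \<Sigma>) * k) * (csinc (k * norm u) * inner u g)" by simp
    then show ?thesis unfolding k2 by simp
  qed
  have "r1 * r2 * sqrt (\<Lambda> / \<Sigma>) * inner (S_fun \<Lambda> \<Sigma> x1 x2) g = r1 * r2 * (- (csinc (k * norm u) * inner u g) / 2)"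
    unfolding S[symmetric] by simp
  then show ?thesis
    unfolding dC_var_def fst_conv snd_conv k_def[symmetric] u_def[symmetric] C by (simp add: algebra_simps)
qed

text \<open>The integral against the residual measure is encoded as a difference of two integrals.
  Both exist: \<open>w t\<close> is square integrable for the finite measure \<open>\<mu> t\<close>,
  and \<open>hmap \<alpha>t\<close> lies below \<open>\<mu> t\<close>.\<close>

theorem theorem3p4:
  fixes \<Lambda> \<Sigma> :: real
    and \<nu> :: "'a::euclidean_space measure"
    and \<mu> :: "real \<Rightarrow> 'a measure"
    and v :: "real \<Rightarrow> 'a \<Rightarrow> 'a" and w :: "real \<Rightarrow> 'a \<Rightarrow> real"
    and D :: "('a \<Rightarrow> real) set"
    and t :: real
    and \<alpha>t \<alpha>s :: "('a \<times> real) measure"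
    and \<beta> :: "(('a \<times> real) \<times> ('a \<times> real)) measure"
  assumes "\<Lambda> > 0" and "\<Sigma> > 0"
    and "fin_meas \<nu>"
    and "AC2_curve \<Lambda> \<Sigma> \<mu>"
    and "tangent_field \<Lambda> \<Sigma> \<mu> v w"
    and "C1_dense_countable D"
    and "t \<in> good_times \<Lambda> \<Sigma> \<mu> v w \<nu> D"
    and "HK_admissible (\<mu> t) \<nu> \<alpha>t \<alpha>s"
    and "\<forall>\<alpha>1 \<alpha>2. HK_admissible (\<mu> t) \<nu> \<alpha>1 \<alpha>2 \<longrightarrow>
           HK_obj \<Lambda> \<Sigma> (\<mu> t) \<nu> \<alpha>t \<alpha>s \<le> HK_obj \<Lambda> \<Sigma> (\<mu> t) \<nu> \<alpha>1 \<alpha>2"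
    and "coupling \<beta> \<alpha>t \<alpha>s"
    and "\<forall>\<beta>'. coupling \<beta>' \<alpha>t \<alpha>s \<longrightarrow> cost \<Lambda> \<Sigma> \<beta> \<le> cost \<Lambda> \<Sigma> \<beta>'"
  shows "((\<lambda>\<tau>. (HK \<Lambda> \<Sigma> (\<mu> \<tau>) \<nu>)\<^sup>2 / 2) has_real_derivative
           (F_term \<Lambda> \<Sigma> (v t) (w t) \<beta>
            + 2 * ((LINT x|\<mu> t. w t x) - (LINT x|hmap \<alpha>t. w t x)))) (at t)"
proof -
  note \<Lambda> = assms(1) and \<Sigma> = assms(2) and fin\<nu> = assms(3)
  have fin: "fin_meas (\<mu> s)" if "s \<in> {0..1}" for s using assms(4) that by (auto simp: AC2_curve_def)
  note good = assms(7)[unfolded good_times_def mem_Collect_eq]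
  have t: "t \<in> {0<..<1}" using good by blast
  have ft: "fin_meas (\<mu> t)" using fin t by auto
  have vm: "v t \<in> borel_measurable borel" and wm: "w t \<in> borel_measurable borel"
  proof -
    have p: "(\<lambda>x::'a. (t, x)) \<in> borel_measurable borel" by measurable
    have "(\<lambda>p. v (fst p) (snd p)) \<in> borel_measurable borel" "(\<lambda>p. w (fst p) (snd p)) \<in> borel_measurable borel"
      using assms(5) by (auto simp: tangent_field_def)
    from measurable_compose[OF p this(1)] measurable_compose[OF p this(2)]
    show "v t \<in> borel_measurable borel" "w t \<in> borel_measurable borel" by simp_all
  qed
  note [measurable] = vm wm
  obtain L where md: "((\<lambda>h. HK \<Lambda> \<Sigma> (\<mu> (t + h)) (\<mu> t) / \<bar>h\<bar>) \<longlongrightarrow> L) (at 0)"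
    using good unfolding metric_deriv_exists_def by blast
  then have "metric_deriv \<Lambda> \<Sigma> \<mu> t = L" unfolding metric_deriv_def by (intro tendsto_Lim) auto
  then have nrm: "L2norm2 \<Lambda> \<Sigma> (\<mu> t) (v t) (w t) = ennreal (L\<^sup>2)" using good by simp
  have D: "D \<subseteq> Cc_inf" using assms(6) by (simp add: C1_dense_countable_def)
  have approx: "\<exists>\<psi>\<in>D. L2norm2 \<Lambda> \<Sigma> (\<mu> t) (\<lambda>x. v t x - grad \<psi> x) (\<lambda>x. w t x - \<psi> x) < ennreal \<epsilon>" if "\<epsilon> > 0" for \<epsilon>
    using good by (intro L2_approx_dense[OF \<Lambda> \<Sigma> ft assms(6) vm wm _ that]) blast
  have ce: "((\<lambda>h. ((\<integral>x. \<psi> x \<partial>\<mu> (t + h)) - (\<integral>x. \<psi> x \<partial>\<mu> t)) / h) \<longlongrightarrow>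
        (\<integral>x. \<Lambda> * inner (grad \<psi> x) (v t x) + \<Sigma> * \<psi> x * w t x \<partial>\<mu> t)) (at 0)" if "\<psi> \<in> D" for \<psi>
    using good that by blast
  have diff: "(\<lambda>\<tau>. (HK \<Lambda> \<Sigma> (\<mu> \<tau>) \<nu>)\<^sup>2 / 2) differentiable (at t)" using good by blast

  have adm: "M2C \<alpha>t" "M2C \<alpha>s" "meas_le (hmap \<alpha>t) (\<mu> t)" "meas_le (hmap \<alpha>s) \<nu>"
    using assms(8) by (auto simp: HK_admissible_def)
  have fin_hmap: "fin_meas (hmap \<alpha>)" if "meas_le (hmap \<alpha>) M" "fin_meas M" for \<alpha> :: "('a \<times> real) measure" and M
  proof -
    have "emeasure (hmap \<alpha>) UNIV \<le> emeasure M UNIV" using that by (auto simp: meas_le_def hmap_def)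
    also have "\<dots> < \<infinity>" using that by (auto simp: fin_meas_def less_top[symmetric] finite_measure.emeasure_finite)
    finally have "finite_measure (hmap \<alpha>)" by (intro finite_measureI) (auto simp: hmap_def)
    then show ?thesis by (simp add: fin_meas_def hmap_def)
  qed
  have fh: "fin_meas (hmap \<alpha>t)" "fin_meas (hmap \<alpha>s)" using fin_hmap adm ft fin\<nu> by auto
  define \<rho>1 where "\<rho>1 = diff_measure (\<mu> t) (hmap \<alpha>t)"
  define \<rho>2 where "\<rho>2 = diff_measure \<nu> (hmap \<alpha>s)"
  note \<rho>1 = residual_measure[OF ft fh(1) adm(3), folded \<rho>1_def]
  note \<rho>2 = residual_measure[OF fin\<nu> fh(2) adm(4), folded \<rho>2_def]
  note [measurable_cong] = sets_fin_meas[OF \<rho>1(1)] sets_fin_meas[OF \<rho>2(1)] sets_fin_meas[OF ft]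
  let ?J1 = "\<lambda>x::'a. ((x, 1::real), (0::'a, 0::real))"
  let ?J2 = "\<lambda>x::'a. ((0::'a, 0::real), (x, 1::real))"
  have [measurable]: "?J1 \<in> borel_measurable borel" "?J2 \<in> borel_measurable borel" by measurable
  define N1 where "N1 = distr \<rho>1 borel ?J1"
  define N2 where "N2 = distr \<rho>2 borel ?J2"
  define \<gamma> where "\<gamma> = add_measure \<beta> (add_measure N1 N2)"
  have h\<beta>: "hplan \<beta> (hmap \<alpha>t) (hmap \<alpha>s)" by (rule hplan_coupling[OF assms(10) adm(1,2)])
  have hN: "hplan N1 \<rho>1 (null_measure borel)" "hplan N2 (null_measure borel) \<rho>2"
    unfolding N1_def N2_def by (rule hplan_to_vertex[OF \<rho>1(1)] hplan_to_vertex[OF \<rho>2(1)])+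
  have "hplan (add_measure N1 N2) \<rho>1 \<rho>2"
    using hplan_add[OF hN] sets_fin_meas[OF \<rho>1(1)] sets_fin_meas[OF \<rho>2(1)] by (simp add: add_null_measure)
  then have \<gamma>: "hplan \<gamma> (\<mu> t) \<nu>" unfolding \<gamma>_def using hplan_add[OF h\<beta>] \<rho>1(2) \<rho>2(2) by metis
  have s: "sets \<beta> = sets borel" "sets N1 = sets borel" "sets N2 = sets borel"
    using hplanD(1)[OF h\<beta>] by (auto simp: N1_def N2_def)
  note [measurable_cong] = s
  have sets_add: "sets (add_measure N1 N2) = sets \<beta>" "sets N2 = sets N1" using s by auto

  have "cost \<Lambda> \<Sigma> \<gamma> = cost \<Lambda> \<Sigma> \<beta> + (cost \<Lambda> \<Sigma> N1 + cost \<Lambda> \<Sigma> N2)"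
    unfolding cost_def \<gamma>_def by (simp add: nn_integral_add_measure[OF sets_add(1)] nn_integral_add_measure[OF sets_add(2)])
  also have "cost \<Lambda> \<Sigma> N1 = ennreal (4 / \<Sigma> * measure \<rho>1 UNIV)"
  proof -
    have "cost \<Lambda> \<Sigma> N1 = ennreal (4 / \<Sigma>) * emeasure \<rho>1 UNIV"
      using sets_eq_imp_space_eq[OF sets_fin_meas[OF \<rho>1(1)]] unfolding cost_def N1_def
      by (subst nn_integral_distr, measurable, simp add: dC_sq[OF \<Sigma>])
    then show ?thesis
      using \<rho>1(1) \<Sigma> by (simp add: fin_meas_def finite_measure.emeasure_eq_measure ennreal_mult[symmetric])
  qed
  also have "cost \<Lambda> \<Sigma> N2 = ennreal (4 / \<Sigma> * measure \<rho>2 UNIV)"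
  proof -
    have "cost \<Lambda> \<Sigma> N2 = ennreal (4 / \<Sigma>) * emeasure \<rho>2 UNIV"
      using sets_eq_imp_space_eq[OF sets_fin_meas[OF \<rho>2(1)]] unfolding cost_def N2_def
      by (subst nn_integral_distr, measurable, simp add: dC_sq[OF \<Sigma>])
    then show ?thesis
      using \<rho>2(1) \<Sigma> by (simp add: fin_meas_def finite_measure.emeasure_eq_measure ennreal_mult[symmetric])
  qed
  also have "ennreal (4 / \<Sigma> * measure \<rho>1 UNIV) + ennreal (4 / \<Sigma> * measure \<rho>2 UNIV)
      = ennreal (4 / \<Sigma> * (measure \<rho>1 UNIV + measure \<rho>2 UNIV))"
    unfolding distrib_left using \<Sigma> by (intro ennreal_plus[symmetric]) auto
  also have "cost \<Lambda> \<Sigma> \<beta> = WC2 \<Lambda> \<Sigma> \<alpha>t \<alpha>s"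
    unfolding WC2_def using assms(10,11) by (intro antisym INF_greatest INF_lower) auto
  finally have "cost \<Lambda> \<Sigma> \<gamma> = HK_obj \<Lambda> \<Sigma> (\<mu> t) \<nu> \<alpha>t \<alpha>s" by (simp add: HK_obj_def \<rho>1(3) \<rho>2(3))
  also have "\<dots> \<le> HK2 \<Lambda> \<Sigma> (\<mu> t) \<nu>" by (rule HK_obj_le_HK2) (use assms(9) in blast)
  finally have opt: "cost \<Lambda> \<Sigma> \<gamma> \<le> HK2 \<Lambda> \<Sigma> (\<mu> t) \<nu>" .
  then have opt': "(\<integral>p. (dC \<Lambda> \<Sigma> (fst p) (snd p))\<^sup>2 \<partial>\<gamma>) \<le> (HK \<Lambda> \<Sigma> (\<mu> t) \<nu>)\<^sup>2"
    unfolding hplan_cost_finite(4)[OF \<Sigma> \<gamma> ft fin\<nu>] HK_sq[OF \<Sigma> ft fin\<nu>, symmetric] by (subst (asm) ennreal_le_iff) auto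
  let ?f = "\<lambda>p. dC_var \<Lambda> \<Sigma> (fst p) (snd p) (v t (fst (fst p))) (w t (fst (fst p)))"
  have der: "((\<lambda>\<tau>. (HK \<Lambda> \<Sigma> (\<mu> \<tau>) \<nu>)\<^sup>2 / 2) has_real_derivative (\<integral>p. ?f p \<partial>\<gamma>) / 2) (at t)"
    by (rule HK_derivative_of_plan[OF \<Lambda> \<Sigma> fin fin\<nu> t md vm wm nrm D approx ce diff \<gamma> opt'])

  have q: "integrable (\<mu> t) (\<lambda>x. \<Lambda> * (norm (v t x))\<^sup>2 + \<Sigma> * (w t x)\<^sup>2)"
    by (rule L2norm2_finite(1)[OF ft \<Lambda> \<Sigma> vm wm]) (simp add: nrm)
  have "integrable \<gamma> ?f" by (rule integrable_dC_var[OF \<Lambda> \<Sigma> ft fin\<nu> \<gamma> vm wm q])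
  then have i\<beta>: "integrable \<beta> ?f" and iN: "integrable (add_measure N1 N2) ?f"
    unfolding \<gamma>_def by (rule integrable_add_measureD[OF sets_add(1)])+
  note iN12 = integrable_add_measureD[OF sets_add(2) iN]
  have "(\<integral>p. ?f p \<partial>\<gamma>) = (\<integral>p. ?f p \<partial>\<beta>) + ((\<integral>p. ?f p \<partial>N1) + (\<integral>p. ?f p \<partial>N2))"
    unfolding \<gamma>_def integral_add_measure[OF sets_add(1) i\<beta> iN] integral_add_measure[OF sets_add(2) iN12] ..
  \<comment> \<open>Against the vertex only the radial term of \<open>dC_var\<close> survives: 4 w
    at radius 1 for the residual mass of \<open>\<mu> t\<close>, and 0 on \<open>N2\<close>, where
    the first point is itself the vertex.\<close>
  also have "(\<integral>p. ?f p \<partial>N1) = 4 * (\<integral>x. w t x \<partial>\<rho>1)"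
    unfolding N1_def by (subst integral_distr[OF _ dC_var_measurable[OF vm wm]]) (auto simp: dC_var_def)
  also have "(\<integral>p. ?f p \<partial>N2) = 0"
    unfolding N2_def by (subst integral_distr[OF _ dC_var_measurable[OF vm wm]]) (auto simp: dC_var_def)
  also have "(\<integral>x. w t x \<partial>\<rho>1) = (\<integral>x. w t x \<partial>\<mu> t) - (\<integral>x. w t x \<partial>hmap \<alpha>t)"
  proof -
    have "integrable (\<mu> t) (w t)"
    proof (rule Bochner_Integration.integrable_bound)
      \<comment> \<open>Square integrability gives integrability for a finite measure through |w| <=
        1 + w^2.\<close>
      show "integrable (\<mu> t) (\<lambda>x. 1 + 1 / \<Sigma> * (\<Lambda> * (norm (v t x))\<^sup>2 + \<Sigma> * (w t x)\<^sup>2))"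
        using ft by (intro Bochner_Integration.integrable_add[OF _ integrable_mult_right[OF q]] finite_measure.integrable_const)
          (simp add: fin_meas_def)
      have "norm (w t x) \<le> norm (1 + 1 / \<Sigma> * (\<Lambda> * (norm (v t x))\<^sup>2 + \<Sigma> * (w t x)\<^sup>2))" for x
      proof -
        have "0 \<le> (\<bar>w t x\<bar> - 1)\<^sup>2" by simp
        then have "\<bar>w t x\<bar> \<le> 1 + (w t x)\<^sup>2" by (simp add: power2_diff)
        also have "\<dots> \<le> 1 + 1 / \<Sigma> * (\<Lambda> * (norm (v t x))\<^sup>2 + \<Sigma> * (w t x)\<^sup>2)" using \<Lambda> \<Sigma> by (simp add: distrib_left)
        finally show ?thesis by simp
      qed
      then show "AE x in \<mu> t. norm (w t x) \<le> norm (1 + 1 / \<Sigma> * (\<Lambda> * (norm (v t x))\<^sup>2 + \<Sigma> * (w t x)\<^sup>2))" by (rule AE_I2)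
    qed measurable
    then have i: "integrable (add_measure (hmap \<alpha>t) \<rho>1) (w t)" by (simp only: \<rho>1(2))
    have se: "sets \<rho>1 = sets (hmap \<alpha>t)" using sets_fin_meas[OF \<rho>1(1)] sets_fin_meas[OF fh(1)] by simp
    show ?thesis using integral_add_measure[OF se integrable_add_measureD[OF se i]] unfolding \<rho>1(2) by simp
  qed
  also have "(\<integral>p. ?f p \<partial>\<beta>) = 2 * F_term \<Lambda> \<Sigma> (v t) (w t) \<beta>"
  proof -
    let ?E = "\<lambda>pq. (let x1 = fst (fst pq); r1 = snd (fst pq); x2 = fst (snd pq); r2 = snd (snd pq) in
       r1\<^sup>2 * w t x1 - r1 * r2 * w t x1 * cos (sqrt (\<Sigma> / (4 * \<Lambda>)) * norm (x1 - x2))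
       - r1 * r2 * sqrt (\<Lambda> / \<Sigma>) * inner (S_fun \<Lambda> \<Sigma> x1 x2) (v t x1))"
    have [measurable]: "(\<lambda>p. S_fun \<Lambda> \<Sigma> (fst (fst p)) (fst (snd p))) \<in> borel_measurable (borel :: (('a \<times> real) \<times> ('a \<times> real)) measure)"
      unfolding S_fun_def by measurable
    \<comment> \<open>Null sets of the completed plan are null for its summand \<beta>, so the angle
      bound descends to \<beta>.\<close>
    have angle: "AE p in \<beta>. 0 < snd (fst p) \<longrightarrow> 0 < snd (snd p) \<longrightarrow> sqrt (\<Sigma> / (4 * \<Lambda>)) * norm (fst (fst p) - fst (snd p)) \<le> pi / 2"
      by (rule AE_add_measureD[OF sets_add(1) optimal_plan_angle[OF \<Sigma> ft fin\<nu> \<gamma> opt, unfolded \<gamma>_def]])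
    have "AE p in \<beta>. ?f p = 4 * ?E p"
      using angle hplanD(3,4)[OF h\<beta>]
    proof eventually_elim
      case (elim p)
      then show ?case
        using dC_var_eq_of_angle[OF \<Lambda> \<Sigma> elim(2,3), of "fst (fst p)" "fst (snd p)" "v t (fst (fst p))" "w t (fst (fst p))"]
        by (simp add: Let_def)
    qed
    then have "(\<integral>p. ?f p \<partial>\<beta>) = (\<integral>p. 4 * ?E p \<partial>\<beta>)"
      using i\<beta> by (intro integral_cong_AE) (auto simp: Let_def)
    also have "\<dots> = 4 * (\<integral>p. ?E p \<partial>\<beta>)" by (rule integral_mult_right_zero)
    finally show ?thesis by (simp add: F_term_def)
  qed
  finally have "(\<integral>p. ?f p \<partial>\<gamma>) / 2 = F_term \<Lambda> \<Sigma> (v t) (w t) \<beta> + 2 * ((LINT x|\<mu> t. w t x) - (LINT x|hmap \<alpha>t. w t x))" by simp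
  with der show ?thesis by simp
qed

end
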